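(* Let $\Omega$ be an open set in $\mathbb{R}^n$, $n\ge 3$, and let $\varphi:[0,\infty)\to[0,\infty)$ be an increasing function such that $\varphi(0)=0$ and $$\int_1^\infty\left[\frac{t}{\varphi(t)}\right]^{\frac{1}{n-2}}dt<\infty .$$ Let $f:\Omega\to\mathbb{R}^n$ be a continuous open mapping in the Orlicz–Sobolev class $W^{1,\varphi}_{\rm loc}(\Omega)$. Then $f$ has a total differential (i.e. is differentiable in the classical Fréchet sense) at almost every point of $\Omega$.
   Context: For an open set $U\subset\mathbb{R}^n$ and an increasing function $\varphi:[0,\infty)\to[0,\infty)$ (not assumed convex), $W^{1,\varphi}_{\rm loc}(U)$ is the class of locally integrable mappings $f=(f_1,\dots,f_m):U\to\mathbb{R}^m$ with $f_i\in W^{1,1}_{\rm loc}(U)$ for all $i$ and such that $\varphi(|\nabla f|)$ is locally integrable in $U$, where $|\nabla f(x)|=\sqrt{\sum_{i,j}(\partial f_i/\partial x_j)^2}$. A mapping is open if it maps open sets to open sets. *)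

theory Defs
  imports "HOL-Analysis.Analysis"
begin

definition partial :: "'n \<Rightarrow> (real ^ 'n \<Rightarrow> real) \<Rightarrow> real ^ 'n \<Rightarrow> real" where
  "partial j u x = frechet_derivative u (at x) (axis j 1)"

(* C-infinity with compact support in U.  Every iterated partial derivative is required to be
   Frechet differentiable everywhere; this gives existence and continuity of the partial
   derivatives of all orders, and is implied by it. *)
definition test_functions :: "(real ^ 'n) set \<Rightarrow> (real ^ 'n \<Rightarrow> real) set" where
  "test_functions U = {\<psi>.
     (\<forall>js. fold partial js \<psi> differentiable_on UNIV) \<and>
     compact (closure {x. \<psi> x \<noteq> 0}) \<and> closure {x. \<psi> x \<noteq> 0} \<subseteq> U}"

definition locally_integrable_on :: "(real ^ 'n \<Rightarrow> 'b::euclidean_space) \<Rightarrow> (real ^ 'n) set \<Rightarrow> bool"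
    (infixr "locally'_integrable'_on" 46) where
  "u locally_integrable_on U \<longleftrightarrow>
     (\<forall>K. compact K \<and> K \<subseteq> U \<longrightarrow> u absolutely_integrable_on K)"

(* g is a (version of the) distributional derivative of u in the j-th coordinate direction.
   The minus sign comes from integration by parts. *)
definition weak_partial ::
    "(real ^ 'n) set \<Rightarrow> 'n \<Rightarrow> (real ^ 'n \<Rightarrow> real) \<Rightarrow> (real ^ 'n \<Rightarrow> real) \<Rightarrow> bool" where
  "weak_partial U j u g \<longleftrightarrow>
     u locally_integrable_on U \<and> g locally_integrable_on U \<and>
     (\<forall>\<psi>\<in>test_functions U.
        (LINT x:U|lebesgue. u x * partial j \<psi> x) = - (LINT x:U|lebesgue. g x * \<psi> x))"

definition W11_loc :: "(real ^ 'n) set \<Rightarrow> (real ^ 'n \<Rightarrow> real) set" where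
  "W11_loc U = {u. u locally_integrable_on U \<and> (\<forall>j. \<exists>g. weak_partial U j u g)}"

(* D x is the Jacobian matrix, D x $ i $ j being the weak derivative of f_i in direction j.
   It is determined up to a null set, so the choice of a version of it does not matter. *)
definition W1_phi_loc ::
    "(real \<Rightarrow> real) \<Rightarrow> (real ^ 'n) set \<Rightarrow> (real ^ 'n \<Rightarrow> real ^ 'm) set" where
  "W1_phi_loc \<phi> U = {f.
     f locally_integrable_on U \<and>
     (\<forall>i. (\<lambda>x. f x $ i) \<in> W11_loc U) \<and>
     (\<exists>D :: real ^ 'n \<Rightarrow> real ^ 'n ^ 'm.
        (\<forall>i j. weak_partial U j (\<lambda>x. f x $ i) (\<lambda>x. D x $ i $ j)) \<and>
        (\<lambda>x. \<phi> (sqrt (\<Sum>i\<in>UNIV. \<Sum>j\<in>UNIV. (D x $ i $ j)\<^sup>2))) locally_integrable_on U)}"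

(* The exponent p is 1 / (n - 2) in the application.  Where \<phi> vanishes, t / \<phi> t is read as
   infinity (and not as 0, the value of division by zero on type real), so that finiteness of
   the integral forces \<phi> t > 0 for t > 1. *)
definition calderon_integral :: "(real \<Rightarrow> real) \<Rightarrow> real \<Rightarrow> ennreal" where
  "calderon_integral \<phi> p =
     (\<integral>\<^sup>+ t\<in>{1..}. (if \<phi> t = 0 then \<infinity> else ennreal ((t / \<phi> t) powr p)) \<partial>lborel)"

end

theory Submission
  imports Defs
begin

text \<open>
  Averages of \<open>f\<close> over a box and over one of its halves differ by at most the side length times
  the average of the gradient; this follows from testing the weak derivative against a bump function.
  Halve repeatedly, in all directions but one, a slab whose thickness is that of the final boxes. The
  steps can be summed because the effective dimension is \<open>n - 1\<close> and the Calderon condition has the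
  exponent belonging to that dimension. Hence, on a slab on which the average of \<open>\<phi>(|\<nabla>f|)\<close> is
  controlled, the oscillation of \<open>f\<close> is at most a multiple of the diameter. Every cube is surrounded by
  such slabs, found by pigeonholing, and since \<open>f\<close> is open, \<open>|f - c|\<close> attains its maximum over a box
  on the boundary; so the oscillation on a cube of side \<open>s\<close> is at most \<open>C s (1 + A)\<close>, where \<open>A\<close> is the
  average of \<open>\<phi>(|\<nabla>f|)\<close> over a larger concentric cube.

  At a common Lebesgue point \<open>x\<close> of the gradient and of \<open>\<phi>(|\<nabla>f|)\<close>, halving in all directions
  shows that the averages of \<open>f\<close> over small cubes near \<open>x\<close>, whose side is a fixed fraction of their distance
  to \<open>x\<close>, agree to first order with the affine map given by the gradient, and the oscillation bound
  passes from the averages to the values of \<open>f\<close>.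
\<close>

section \<open>Smooth bump functions\<close>

text \<open>Dividing \<open>n - 1\<close> sides of a box by \<open>2 ^ m\<close> divides its volume
  by \<open>2 ^ (m * (n - 1))\<close>, while the step at scale \<open>m\<close> costs an average of
  the gradient times a side of order \<open>1 / 2 ^ m\<close>. Relative to the initial box the
  gradient therefore carries the weight \<open>2 ^ (m * (n - 2))\<close>. Halving all
  \<open>n\<close> sides would give \<open>2 ^ (m * (n - 1))\<close>, for which the hypothesis on
  \<phi> is too weak; hence one side is left alone. Instead each scale gets a height above which
  \<open>2 ^ (m * (n - 2)) * t\<close> is at most \<phi>\<open>(t)\<close>: the heights, divided by
  \<open>2 ^ m\<close>, are summable by the Calderon condition, and at gradients above them the
  weights form geometric sums of ratio at least \<open>2\<close>, bounded by their last term.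

  The slab bound does not depend on the thickness, so uniform continuity may fix it afterwards,
  making averages over the final boxes close to values of \<open>f\<close>.

  At a Lebesgue point \<open>x\<close>, boxes shrinking to \<open>x\<close> stay comparable to cubes
  centred at \<open>x\<close>, so halving may go on indefinitely. Boxes shrinking to another point
  \<open>y\<close> do not; there halving stops at a fixed fraction of the distance, and the
  oscillation bound takes over.\<close>

text \<open>Being a greatest fixed point, this says that derivatives of all orders exist, and every
  class of functions closed under differentiation consists of smooth functions.\<close>

coinductive smooth_real :: "(real \<Rightarrow> real) \<Rightarrow> bool" where
  "(\<And>x. (h has_real_derivative h' x) (at x)) \<Longrightarrow> smooth_real h' \<Longrightarrow> smooth_real h"

lemma smooth_realE:
  assumes "smooth_real h"
  obtains h' where "\<And>x. (h has_real_derivative h' x) (at x)" "smooth_real h'"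
  using assms by cases (blast intro: that)

lemma smooth_real_continuous: "smooth_real h \<Longrightarrow> continuous_on S h"
  by (meson DERIV_continuous_on has_field_derivative_at_within smooth_realE)

lemma smooth_real_add:
  assumes "smooth_real g" "smooth_real h"
  shows "smooth_real (\<lambda>x. g x + h x)"
  using assms
proof (coinduction arbitrary: g h)
  case smooth_real
  obtain g' h' where "\<And>x. (g has_real_derivative g' x) (at x)" "smooth_real g'"
    "\<And>x. (h has_real_derivative h' x) (at x)" "smooth_real h'"
    using smooth_real by (meson smooth_realE)
  then have "(\<forall>x. ((\<lambda>x. g x + h x) has_real_derivative g' x + h' x) (at x)) \<and> smooth_real g' \<and> smooth_real h'"
    by (auto intro!: DERIV_add)
  then show ?case
    by (intro exI[of _ "\<lambda>x. g x + h x"] exI[of _ "\<lambda>x. g' x + h' x"]) blast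
qed

text \<open>Differentiation brings out the factor \<open>r\<close>; \<open>c\<close> varies in the
  coinduction so that the family is closed under it.\<close>

lemma smooth_real_affine:
  assumes "smooth_real h"
  shows "smooth_real (\<lambda>x. c * h (r * x + s))"
  using assms
proof (coinduction arbitrary: h c)
  case smooth_real
  then obtain h' where h': "\<And>x. (h has_real_derivative h' x) (at x)" "smooth_real h'"
    by (meson smooth_realE)
  have "((\<lambda>x. c * h (r * x + s)) has_real_derivative (c * r) * h' (r * x + s)) (at x)" for x
    by (rule derivative_eq_intros DERIV_chain2[OF h'(1)] refl | simp)+
  then show ?case
    using h'(2) by (intro exI[of _ "\<lambda>x. c * h (r * x + s)"] exI[of _ "\<lambda>x. (c * r) * h' (r * x + s)"]) blast
qed

lemma smooth_real_antiderivative: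
  assumes "\<And>x. (g has_real_derivative h x) (at x)" "smooth_real h"
  shows "smooth_real g"
  using assms by (rule smooth_real.intros)

text \<open>Products of smooth functions are not closed under differentiation, but their finite sums are; this
  is the invariant for the coinductive proof that products are smooth.\<close>

inductive product_sum :: "(real \<Rightarrow> real) \<Rightarrow> bool" where
  base: "smooth_real g \<Longrightarrow> smooth_real h \<Longrightarrow> product_sum (\<lambda>x. g x * h x)"
| add: "product_sum u \<Longrightarrow> product_sum v \<Longrightarrow> product_sum (\<lambda>x. u x + v x)"

lemma product_sum_derivative:
  assumes "product_sum u"
  shows "\<exists>u'. (\<forall>x. (u has_real_derivative u' x) (at x)) \<and> product_sum u'"
  using assms
proof induction
  case (base g h)
  obtain g' where g': "\<And>x. (g has_real_derivative g' x) (at x)" "smooth_real g'"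
    using base smooth_realE by blast
  obtain h' where h': "\<And>x. (h has_real_derivative h' x) (at x)" "smooth_real h'"
    using base smooth_realE by blast
  have "product_sum (\<lambda>x. g' x * h x + h' x * g x)"
    by (intro product_sum.intros base g' h')
  moreover have "((\<lambda>x. g x * h x) has_real_derivative g' x * h x + h' x * g x) (at x)" for x
    using DERIV_mult[OF g'(1) h'(1)] .
  ultimately show ?case by (intro exI[of _ "\<lambda>x. g' x * h x + h' x * g x"]) simp
next
  case (add u v)
  then obtain u' v' where "\<And>x. (u has_real_derivative u' x) (at x)" "product_sum u'"
    "\<And>x. (v has_real_derivative v' x) (at x)" "product_sum v'"
    by blast
  then show ?case
    by (intro exI[of _ "\<lambda>x. u' x + v' x"]) (auto intro!: DERIV_add product_sum.add)
qed

lemma smooth_real_mult: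
  assumes "smooth_real g" "smooth_real h"
  shows "smooth_real (\<lambda>x. g x * h x)"
proof -
  have "smooth_real u" if "product_sum u" for u
    using that by (coinduction arbitrary: u) (use product_sum_derivative in blast)
  then show ?thesis using assms product_sum.base by blast
qed

text \<open>The derivatives of \<open>exp (- 1 / x)\<close> have the form \<open>p (1 / x) * exp (- 1 / x)\<close> with a polynomial
  \<open>p\<close>; carrying \<open>p\<close> along turns smoothness at \<open>0\<close> into a coinduction.\<close>

definition flat_exp :: "real poly \<Rightarrow> real \<Rightarrow> real" where
  "flat_exp p x = (if x \<le> 0 then 0 else poly p (1 / x) * exp (- (1 / x)))"

lemma poly_times_exp_neg_tendsto_0: "((\<lambda>y::real. poly p y * exp (- y)) \<longlongrightarrow> 0) at_top"
proof -
  have "((\<lambda>y::real. \<Sum>i\<le>degree p. coeff p i * (y ^ i / exp y)) \<longlongrightarrow> (\<Sum>i\<le>degree p. coeff p i * 0)) at_top"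
    by (intro tendsto_intros tendsto_power_div_exp_0)
  then show ?thesis
    by (simp add: poly_altdef sum_distrib_right exp_minus divide_inverse mult.assoc)
qed

text \<open>For \<open>x > 0\<close> and \<open>y = 1 / x\<close> the chain rule gives
  \<open>y ^ 2 * (poly p y - poly (pderiv p) y) * exp (- y)\<close>, so only the polynomial changes.
  At \<open>0\<close> the exponential decay beats every polynomial.\<close>

lemma flat_exp_derivative:
  "(flat_exp p has_real_derivative flat_exp ([:0, 0, 1:] * (p - pderiv p)) x) (at x)"
proof (cases x "0::real" rule: linorder_cases)
  case less
  have "((\<lambda>x. 0) has_real_derivative 0) (at x)" by simp
  then have "(flat_exp p has_real_derivative 0) (at x)"
    by (rule has_field_derivative_transform_within_open[of _ _ _ "{..<0}"])
       (use less in \<open>auto simp: flat_exp_def\<close>)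
  then show ?thesis using less by (simp add: flat_exp_def)
next
  case greater
  have "((\<lambda>x. poly p (1 / x) * exp (- (1 / x))) has_real_derivative
      flat_exp ([:0, 0, 1:] * (p - pderiv p)) x) (at x)"
    using greater
    by (auto intro!: derivative_eq_intros DERIV_chain2[OF poly_DERIV] simp: flat_exp_def field_simps power2_eq_square)
  then show ?thesis
    by (rule has_field_derivative_transform_within_open[of _ _ _ "{0<..}"])
       (use greater in \<open>auto simp: flat_exp_def\<close>)
next
  case equal
  \<comment> \<open>For \<open>h > 0\<close> the difference quotient at \<open>0\<close> is
    \<open>y * poly p y * exp (- y)\<close> with \<open>y = 1 / h\<close>, whence the extra factor
    \<open>[:0, 1:]\<close>.\<close>
  have "((\<lambda>y::real. poly ([:0, 1:] * p) y * exp (- y)) \<longlongrightarrow> 0) at_top"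
    by (rule poly_times_exp_neg_tendsto_0)
  then have "((\<lambda>h::real. poly ([:0, 1:] * p) (inverse h) * exp (- inverse h)) \<longlongrightarrow> 0) (at_right 0)"
    by (rule filterlim_compose[OF _ filterlim_inverse_at_top_right])
  then have r: "((\<lambda>h. (flat_exp p (0 + h) - flat_exp p 0) / h) \<longlongrightarrow> 0) (at_right 0)"
    by (rule Lim_transform_eventually)
       (auto simp: eventually_at_filter flat_exp_def divide_inverse intro!: always_eventually)
  have l: "((\<lambda>h. (flat_exp p (0 + h) - flat_exp p 0) / h) \<longlongrightarrow> 0) (at_left 0)"
    by (rule Lim_transform_eventually[of "\<lambda>_. 0"])
       (auto simp: eventually_at_filter flat_exp_def divide_inverse intro!: always_eventually)
  show ?thesis
    using r l equal by (simp add: DERIV_def flat_exp_def[of _ 0] filterlim_split_at)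
qed

lemma smooth_flat_exp: "smooth_real (flat_exp p)"
  by (coinduction arbitrary: p) (use flat_exp_derivative in blast)

text \<open>The parameter \<open>m\<close> steepens the flanks:
  \<open>exp (- 1 / (Suc m * y))\<close> tends to \<open>1\<close> for every \<open>y > 0\<close>,
  so the bumps converge to the indicator of the open interval while staying between \<open>0\<close>
  and \<open>1\<close>.\<close>

definition bump :: "real \<Rightarrow> real \<Rightarrow> nat \<Rightarrow> real \<Rightarrow> real" where
  "bump a b m x = flat_exp 1 (real (Suc m) * (x - a)) * flat_exp 1 (real (Suc m) * (b - x))"

lemma smooth_bump: "smooth_real (bump a b m)"
proof -
  have "smooth_real (\<lambda>x. (1 * flat_exp 1 (real (Suc m) * x + - real (Suc m) * a)) *
      (1 * flat_exp 1 (- real (Suc m) * x + real (Suc m) * b)))"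
    by (intro smooth_real_mult smooth_real_affine smooth_flat_exp)
  then show ?thesis
    by (simp add: bump_def[abs_def] algebra_simps)
qed

lemma bump_nonneg: "0 \<le> bump a b m x"
  and bump_le_1: "bump a b m x \<le> 1"
proof -
  have *: "0 \<le> flat_exp 1 y \<and> flat_exp 1 y \<le> 1" for y
    by (simp add: flat_exp_def)
  show "0 \<le> bump a b m x" "bump a b m x \<le> 1"
    using * unfolding bump_def by (auto intro: mult_nonneg_nonneg mult_le_one)
qed

lemma bump_eq_0: "x \<le> a \<or> b \<le> x \<Longrightarrow> bump a b m x = 0"
  by (auto simp: bump_def flat_exp_def mult_le_0_iff)

lemma bump_tendsto:
  "(\<lambda>m. bump a b m x) \<longlonglongrightarrow> indicator {a<..<b} x"
proof (cases "a < x \<and> x < b")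
  case True
  have *: "(\<lambda>m. flat_exp 1 (real (Suc m) * y)) \<longlonglongrightarrow> 1" if "y > 0" for y
  proof -
    have "(\<lambda>m. exp (- (inverse (real (Suc m)) * (1 / y)))) \<longlonglongrightarrow> exp (- (0 * (1 / y)))"
      by (intro tendsto_intros LIMSEQ_inverse_real_of_nat)
    moreover have "exp (- (inverse (real (Suc m)) * (1 / y))) = flat_exp 1 (real (Suc m) * y)" for m
      using that by (simp add: flat_exp_def divide_simps mult_le_0_iff)
    ultimately show ?thesis by simp
  qed
  show ?thesis
    using tendsto_mult[OF *[of "x - a"] *[of "b - x"]] True by (simp add: bump_def)
next
  case False
  then show ?thesis using bump_eq_0[of x a b] by (auto simp: not_less)
qed

section \<open>Weak derivatives and translations of boxes\<close>

definition coord_prod :: "('n \<Rightarrow> real \<Rightarrow> real) \<Rightarrow> real ^ 'n \<Rightarrow> real" where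
  "coord_prod h x = (\<Prod>j\<in>UNIV. h j (x $ j))"

lemma coord_prod_has_derivative:
  assumes "\<And>j x. (h j has_real_derivative h' j x) (at x)"
  shows "(coord_prod h has_derivative
    (\<lambda>v. \<Sum>j\<in>UNIV. (h' j (x $ j) * v $ j) * (\<Prod>k\<in>UNIV-{j}. h k (x $ k)))) (at x)"
proof -
  have "((\<lambda>x. h j (x $ j)) has_derivative (\<lambda>v. h' j (x $ j) * v $ j)) (at x)" for j
  proof -
    have "(h j has_derivative (\<lambda>v. h' j (x $ j) * v)) (at (x $ j))"
      using assms by (simp add: has_field_derivative_def)
    moreover have "((\<lambda>x. x $ j) has_derivative (\<lambda>v. v $ j)) (at x)"
      by (simp add: bounded_linear_imp_has_derivative bounded_linear_vec_nth)
    ultimately show ?thesis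
      using has_derivative_compose by blast
  qed
  then show ?thesis
    unfolding coord_prod_def[abs_def] by (rule has_derivative_prod)
qed

text \<open>Only the factor with index \<open>i\<close> depends on that coordinate, so a partial
  derivative is again such a product. This makes iterated partial derivatives accessible by
  induction on the list of directions.\<close>

lemma partial_coord_prod:
  assumes "\<And>j x. (h j has_real_derivative h' j x) (at x)"
  shows "partial i (coord_prod h) = coord_prod (h(i := h' i))"
proof
  fix x
  have "partial i (coord_prod h) x =
      (\<Sum>j\<in>UNIV. (h' j (x $ j) * axis i 1 $ j) * (\<Prod>k\<in>UNIV-{j}. h k (x $ k)))"
    unfolding partial_def frechet_derivative_at[OF coord_prod_has_derivative[OF assms], symmetric] ..
  also have "\<dots> = (\<Sum>j\<in>UNIV. if j = i then h' i (x $ i) * (\<Prod>k\<in>UNIV-{i}. h k (x $ k)) else 0)"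
    by (intro sum.cong) (auto simp: axis_def)
  also have "\<dots> = coord_prod (h(i := h' i)) x"
    unfolding coord_prod_def by (subst (2) prod.remove[of _ i]) (auto intro!: prod.cong)
  finally show "partial i (coord_prod h) x = coord_prod (h(i := h' i)) x" .
qed

lemma coord_prod_eq_0:
  assumes "\<And>j t. t \<le> a $ j \<or> b $ j \<le> t \<Longrightarrow> h j t = 0" "x \<notin> box a b"
  shows "coord_prod h x = 0"
proof -
  obtain j where "x $ j \<le> a $ j \<or> b $ j \<le> x $ j"
    using assms(2) unfolding mem_box_cart by (meson not_less)
  then have "h j (x $ j) = 0" by (rule assms(1))
  then show ?thesis
    unfolding coord_prod_def by (intro prod_zero) auto
qed

lemma smooth_real_choose_derivatives:
  assumes "\<And>j. smooth_real (h j)"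
  shows "\<exists>h'. (\<forall>j x. (h j has_real_derivative h' j x) (at x)) \<and> (\<forall>j. smooth_real (h' j))"
proof -
  have "\<forall>j. \<exists>h'. (\<forall>x. (h j has_real_derivative h' x) (at x)) \<and> smooth_real h'"
  proof
    fix j
    from assms[of j] show "\<exists>h'. (\<forall>x. (h j has_real_derivative h' x) (at x)) \<and> smooth_real h'"
      by (rule smooth_realE) (intro exI conjI allI)
  qed
  then obtain h' where "\<forall>j. (\<forall>x. (h j has_real_derivative h' j x) (at x)) \<and> smooth_real (h' j)"
    by (rule exE[OF choice])
  then show ?thesis by (intro exI[of _ h']) simp
qed

lemma fold_partial_coord_prod_differentiable:
  assumes "\<And>j. smooth_real (h j)"
  shows "fold partial js (coord_prod h) differentiable_on UNIV"
  using assms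
proof (induction js arbitrary: h)
  case (Nil h)
  from smooth_real_choose_derivatives[of h, OF Nil]
  obtain h' where "\<And>j x. (h j has_real_derivative h' j x) (at x)" by auto
  then show ?case
    by (auto simp: differentiable_on_def differentiable_def intro: has_derivative_at_withinI coord_prod_has_derivative)
next
  case (Cons i js h)
  from smooth_real_choose_derivatives[of h, OF Cons.prems]
  obtain h' where h': "\<And>j x. (h j has_real_derivative h' j x) (at x)" "\<And>j. smooth_real (h' j)" by auto
  have "fold partial js (coord_prod (h(i := h' i))) differentiable_on UNIV"
    using Cons h'(2) by (intro Cons.IH) auto
  then show ?case
    by (simp add: partial_coord_prod[OF h'(1)])
qed

lemma coord_prod_test_function:
  assumes "\<And>j. smooth_real (h j)" "\<And>j t. t \<le> a $ j \<or> b $ j \<le> t \<Longrightarrow> h j t = 0" "cbox a b \<subseteq> U"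
  shows "coord_prod h \<in> test_functions U"
proof -
  have "{x. coord_prod h x \<noteq> 0} \<subseteq> cbox a b"
    using coord_prod_eq_0[of a b h] assms(2) box_subset_cbox[of a b] by blast
  then have "closure {x. coord_prod h x \<noteq> 0} \<subseteq> cbox a b"
    by (rule closure_minimal) (rule closed_cbox)
  then show ?thesis
    using assms fold_partial_coord_prod_differentiable[of h]
    by (auto simp: test_functions_def compact_eq_bounded_closed intro: bounded_subset[OF bounded_cbox])
qed

lemma coord_prod_continuous:
  assumes "\<And>j. smooth_real (h j)"
  shows "continuous_on S (coord_prod h)"
proof -
  have "coord_prod h differentiable_on UNIV"
    using fold_partial_coord_prod_differentiable[of h "[]"] assms by simp
  then show ?thesis
    using differentiable_imp_continuous_on continuous_on_subset by blast
qed

lemma absolutely_integrable_continuous_mult: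
  fixes w k :: "real ^ 'n \<Rightarrow> real"
  assumes "w absolutely_integrable_on cbox a b" "continuous_on (cbox a b) k"
  shows "(\<lambda>x. w x * k x) absolutely_integrable_on cbox a b"
proof -
  have "(\<lambda>x. (k x) * w x) absolutely_integrable_on cbox a b"
  proof (rule absolutely_integrable_bounded_measurable_product[OF bilinear_times])
    show "bounded (k ` cbox a b)"
      using assms(2) by (intro compact_imp_bounded compact_continuous_image) auto
  qed (use assms in \<open>auto intro: continuous_imp_measurable_on_sets_lebesgue\<close>)
  then show ?thesis by (simp add: mult.commute)
qed

section \<open>Bumps approximating indicators of boxes\<close>

definition box_bump :: "real ^ 'n \<Rightarrow> real ^ 'n \<Rightarrow> nat \<Rightarrow> real ^ 'n \<Rightarrow> real" where
  "box_bump a b m = coord_prod (\<lambda>j. bump (a $ j) (b $ j) m)"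

lemma box_bump_continuous: "continuous_on S (box_bump a b m)"
  unfolding box_bump_def by (intro coord_prod_continuous smooth_bump)

lemma box_bump_bounds: "0 \<le> box_bump a b m x" "box_bump a b m x \<le> 1"
  by (simp_all add: box_bump_def coord_prod_def prod_nonneg bump_nonneg bump_le_1 prod_le_1)

lemma box_bump_eq_0: "x \<notin> box a b \<Longrightarrow> box_bump a b m x = 0"
  unfolding box_bump_def by (rule coord_prod_eq_0[of a b]) (auto simp: bump_eq_0)

lemma box_bump_tendsto: "(\<lambda>m. box_bump a b m x) \<longlonglongrightarrow> (if x \<in> box a b then 1 else 0)"
proof (cases "x \<in> box a b")
  case True
  have "(\<lambda>m. box_bump a b m x) \<longlonglongrightarrow> (\<Prod>j\<in>UNIV. indicator {a $ j<..<b $ j} (x $ j))"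
    unfolding box_bump_def coord_prod_def by (intro tendsto_prod bump_tendsto)
  also have "(\<Prod>j\<in>UNIV. indicator {a $ j<..<b $ j} (x $ j)) = (1 :: real)"
    using True by (intro prod.neutral) (auto simp: mem_box_cart)
  finally show ?thesis using True by simp
qed (simp add: box_bump_eq_0)

text \<open>Dominated convergence with majorant \<open>norm (w x)\<close>. The limit is the
  indicator of the open box, which for the integral is as good as that of the closed one.\<close>

lemma integral_box_bump_tendsto:
  assumes w: "w absolutely_integrable_on cbox p q" and sub: "cbox a b \<subseteq> cbox p q"
  shows "(\<lambda>m. integral (cbox p q) (\<lambda>x. w x * box_bump a b m x)) \<longlonglongrightarrow> integral (cbox a b) w"
proof -
  have "(\<lambda>m. integral (cbox p q) (\<lambda>x. w x * box_bump a b m x))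
      \<longlonglongrightarrow> integral (cbox p q) (\<lambda>x. w x * (if x \<in> box a b then 1 else 0))"
  proof (rule dominated_convergence)
    show "(\<lambda>x. w x * box_bump a b m x) integrable_on cbox p q" for m
      using absolutely_integrable_continuous_mult[OF w box_bump_continuous]
      by (simp add: absolutely_integrable_on_def)
    show "(\<lambda>x. norm (w x)) integrable_on cbox p q"
      using w by (simp add: absolutely_integrable_on_def)
    show "norm (w x * box_bump a b m x) \<le> norm (w x)" for m x
      using box_bump_bounds[of a b m x] by (simp add: abs_mult mult_left_le)
    show "(\<lambda>m. w x * box_bump a b m x) \<longlonglongrightarrow> w x * (if x \<in> box a b then 1 else 0)" for x
      by (intro tendsto_intros box_bump_tendsto)
  qed
  also have "integral (cbox p q) (\<lambda>x. w x * (if x \<in> box a b then 1 else 0)) = integral (cbox a b) w"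
  proof -
    have "w integrable_on cbox a b"
      using w sub by (meson absolutely_integrable_on_def integrable_on_subcbox)
    from has_integral_restrict_open_subinterval[OF integrable_integral[OF this] sub]
    show ?thesis by (simp add: mult_if_delta if_distrib integral_unique cong: if_cong)
  qed
  finally show ?thesis .
qed

lemma integral_eq_on_support:
  fixes g :: "real ^ 'n \<Rightarrow> real"
  assumes "cbox a b \<subseteq> cbox p q" "\<And>x. x \<notin> cbox a b \<Longrightarrow> g x = 0"
  shows "integral (cbox p q) g = integral (cbox a b) g"
proof -
  have "integral (cbox p q) g = integral (cbox p q \<inter> cbox a b) g"
    using assms by (intro integral_spike_set) (auto intro: negligible_subset[of "{}"] simp: set_eq_iff)
  then show ?thesis using assms by (simp add: Int_absorb1)
qed

text \<open>Trades the Lebesgue integrals over \<open>U\<close> for gauge integrals over one box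
  outside of which the test function and its partial derivative vanish; the shifts and limits of the
  next estimate take place inside such a box.\<close>

lemma weak_partial_test:
  assumes weak: "weak_partial U i u D" and sub: "cbox p q \<subseteq> U"
    and test: "\<psi> \<in> test_functions U" and cont: "continuous_on (cbox p q) \<psi>" "continuous_on (cbox p q) (partial i \<psi>)"
    and zero: "\<And>x. x \<notin> cbox p q \<Longrightarrow> \<psi> x = 0 \<and> partial i \<psi> x = 0"
  shows "integral (cbox p q) (\<lambda>x. u x * partial i \<psi> x) = - integral (cbox p q) (\<lambda>x. D x * \<psi> x)"
proof -
  have int: "u absolutely_integrable_on cbox p q" "D absolutely_integrable_on cbox p q"
    using weak sub by (auto simp: weak_partial_def locally_integrable_on_def)
  have *: "(LINT x:U|lebesgue. w x * g x) = integral (cbox p q) (\<lambda>x. w x * g x)"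
    if "w absolutely_integrable_on cbox p q" "continuous_on (cbox p q) g" "\<And>x. x \<notin> cbox p q \<Longrightarrow> g x = 0" for w g :: "real ^ 'a \<Rightarrow> real"
  proof -
    have "(LINT x:U|lebesgue. w x * g x) = (LINT x:cbox p q|lebesgue. w x * g x)"
      unfolding set_lebesgue_integral_def
      by (rule Bochner_Integration.integral_cong) (use that(3) sub in \<open>auto simp: indicator_def\<close>)
    also have "\<dots> = integral (cbox p q) (\<lambda>x. w x * g x)"
      using absolutely_integrable_continuous_mult[OF that(1,2)] by (rule set_lebesgue_integral_eq_integral)
    finally show ?thesis .
  qed
  have "(LINT x:U|lebesgue. u x * partial i \<psi> x) = - (LINT x:U|lebesgue. D x * \<psi> x)"
    using weak test by (auto simp: weak_partial_def)
  then show ?thesis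
    using int cont zero by (simp add: *)
qed

lemma integral_translate_box:
  fixes g :: "real ^ 'n \<Rightarrow> real"
  assumes "cbox a b \<subseteq> cbox p q" "cbox (a + v) (b + v) \<subseteq> cbox p q" "\<And>x. x \<notin> cbox a b \<Longrightarrow> g x = 0"
  shows "integral (cbox p q) (\<lambda>x. g (x - v)) = integral (cbox p q) g"
proof -
  have "integral (cbox p q) (\<lambda>x. g (x - v)) = integral (cbox (a + v) (b + v)) (\<lambda>x. g (x - v))"
    using assms(2)
  proof (rule integral_eq_on_support)
    fix x assume "x \<notin> cbox (a + v) (b + v)"
    then have "x - v \<notin> cbox a b" by (force simp: mem_box_cart algebra_simps)
    then show "g (x - v) = 0" by (rule assms(3))
  qed
  also have "\<dots> = integral (cbox a b) g"
    using integral_shift_cbox[of a "-v" b g] by simp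
  also have "\<dots> = integral (cbox p q) g"
    using assms by (simp add: integral_eq_on_support)
  finally show ?thesis .
qed

text \<open>The definition of the weak derivative is applied to a bump for the box, averaged over its
  translates by \<open>t *\<^sub>R axis i 1\<close> with \<open>0 \<le> t \<le> l\<close>: the partial derivative of this test
  function is the difference of the bumps for the box and for its translate by \<open>l\<close>.\<close>

lemma weak_partial_box_shift:
  fixes u D :: "real ^ 'n \<Rightarrow> real"
  assumes weak: "weak_partial U i u D" and l: "l \<ge> 0" and ab: "cbox a b \<noteq> {}"
    and sub: "cbox a (b + l *\<^sub>R axis i 1) \<subseteq> U"
  shows "\<bar>integral (cbox (a + l *\<^sub>R axis i 1) (b + l *\<^sub>R axis i 1)) u - integral (cbox a b) u
      - c * l * measure lborel (cbox a b)\<bar> \<le> l * integral (cbox a (b + l *\<^sub>R axis i 1)) (\<lambda>x. \<bar>D x - c\<bar>)"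
proof -
  define e :: "real ^ 'n" where "e = axis i 1"
  have e: "e $ j = (if j = i then 1 else 0)" for j
    by (simp add: e_def axis_def)
  define q where "q = b + l *\<^sub>R e"
  have int: "u absolutely_integrable_on cbox a q" "D absolutely_integrable_on cbox a q"
    using weak sub by (auto simp: weak_partial_def locally_integrable_on_def q_def e_def)
  have ab': "a $ j \<le> b $ j" for j
    using ab by (simp add: interval_ne_empty_cart)
  have shift_sub: "cbox (a + t *\<^sub>R e) (b + t *\<^sub>R e) \<subseteq> cbox a q" if "0 \<le> t" "t \<le> l" for t
  proof
    fix x assume "x \<in> cbox (a + t *\<^sub>R e) (b + t *\<^sub>R e)"
    then have "a $ j + t * e $ j \<le> x $ j \<and> x $ j \<le> b $ j + t * e $ j" for j
      by (simp add: mem_box_cart)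
    moreover have "0 \<le> t * e $ j \<and> t * e $ j \<le> l * e $ j" for j
      using that l by (simp add: e)
    ultimately have "a $ j \<le> x $ j \<and> x $ j \<le> b $ j + l * e $ j" for j
      by (smt (verit))
    then show "x \<in> cbox a q"
      unfolding mem_box_cart q_def by simp
  qed
  have sub0: "cbox a b \<subseteq> cbox a q" using shift_sub[of 0] l by simp
  have Dc: "(\<lambda>x. D x - c) absolutely_integrable_on cbox a q"
    by (intro set_integral_diff int absolutely_integrable_on_const) auto
  let ?X = "\<lambda>m. box_bump a b m"
  let ?Y = "\<lambda>m. box_bump (a + l *\<^sub>R e) (b + l *\<^sub>R e) m"
  have shift: "box_bump (a + t *\<^sub>R e) (b + t *\<^sub>R e) m x = box_bump a b m (x - t *\<^sub>R e)" for t m x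
    unfolding box_bump_def coord_prod_def bump_def by (simp add: algebra_simps)
  \<comment> \<open>The claim with bumps in place of indicators; the limit in \<open>m\<close> is
    taken at the end.\<close>
  have approx: "\<bar>integral (cbox a q) (\<lambda>x. u x * ?Y m x) - integral (cbox a q) (\<lambda>x. u x * ?X m x)
      - c * l * integral (cbox a q) (\<lambda>x. 1 * ?X m x)\<bar> \<le> l * integral (cbox a q) (\<lambda>x. \<bar>D x - c\<bar>)" for m
  proof -
    define \<eta> where "\<eta> = bump (a $ i) (b $ i) m"
    have cont_\<eta>: "continuous_on S \<eta>" for S
      unfolding \<eta>_def by (intro smooth_real_continuous smooth_bump)
    obtain F where F: "\<And>x. (F has_real_derivative \<eta> x) (at x)"
      using einterval_antiderivative[of "-\<infinity>" "\<infinity>" \<eta>] cont_\<eta>[of UNIV]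
      by (auto simp: continuous_on_eq_continuous_at has_real_derivative_iff_has_vector_derivative)
    \<comment> \<open>This is the integral of \<open>\<eta> (x - t)\<close> over
      \<open>0 \<le> t \<le> l\<close>. The antiderivative makes smoothness and the derivative
      evident; the integral form \<open>\<theta>_int\<close> gives the bounds \<open>0\<close> and
      \<open>l\<close>.\<close>
    define \<theta> where "\<theta> x = F x - F (x - l)" for x
    have smooth_F: "smooth_real F"
      using F smooth_bump unfolding \<eta>_def by (rule smooth_real_antiderivative)
    have smooth_\<theta>: "smooth_real \<theta>"
      using smooth_real_add[OF smooth_F smooth_real_affine[OF smooth_F, of "-1" 1 "-l"]]
      by (simp add: \<theta>_def[abs_def])
    have d\<theta>: "(\<theta> has_real_derivative \<eta> x - \<eta> (x - l)) (at x)" for x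
    proof -
      have "((\<lambda>x. F (x - l)) has_real_derivative \<eta> (x - l)) (at x)"
        using DERIV_chain2[where f = F and g = "\<lambda>x. x - l", OF F DERIV_diff[OF DERIV_ident DERIV_const]]
        by simp
      then show ?thesis
        unfolding \<theta>_def[abs_def] by (rule DERIV_diff[OF F])
    qed
    have \<theta>_int: "((\<lambda>t. \<eta> (x - t)) has_integral \<theta> x) {0..l}" for x
    proof -
      have "((\<lambda>t. - F (x - t)) has_real_derivative \<eta> (x - t)) (at t)" for t
        using DERIV_minus[OF DERIV_chain2[where f = F and g = "\<lambda>t. x - t", OF F DERIV_diff[OF DERIV_const DERIV_ident]]]
        by simp
      then have "((\<lambda>t. \<eta> (x - t)) has_integral - F (x - l) - (- F (x - 0))) {0..l}"
        using l by (intro fundamental_theorem_of_calculus)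
          (auto simp: has_real_derivative_iff_has_vector_derivative[symmetric] intro: has_field_derivative_at_within)
      then show ?thesis by (simp add: \<theta>_def)
    qed
    have \<theta>_bounds: "0 \<le> \<theta> x \<and> \<theta> x \<le> l" for x
    proof
      show "0 \<le> \<theta> x" using has_integral_nonneg[OF \<theta>_int] bump_nonneg by (simp add: \<eta>_def)
      show "\<theta> x \<le> l"
        using has_integral_le[OF \<theta>_int has_integral_const_real[of 1 0 l]] bump_le_1 l by (simp add: \<eta>_def)
    qed
    have \<theta>_0: "\<theta> x = 0" if "x \<le> a $ i \<or> b $ i + l \<le> x" for x
    proof -
      have "((\<lambda>t. \<eta> (x - t)) has_integral 0) {0..l}"
        by (rule has_integral_is_0) (use that in \<open>auto simp: \<eta>_def intro!: bump_eq_0\<close>)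
      then show ?thesis using \<theta>_int has_integral_unique by blast
    qed
    define h where "h = (\<lambda>j. bump (a $ j) (b $ j) m)(i := \<theta>)"
    define \<psi> where "\<psi> = coord_prod h"
    have smooth_h: "smooth_real (h j)" for j
      by (simp add: h_def smooth_\<theta> smooth_bump)
    have h_0: "h j t = 0" if "t \<le> a $ j \<or> q $ j \<le> t" for j t
      using that l by (auto simp: h_def q_def e \<theta>_0 bump_eq_0 split: if_splits)
    obtain h' where h': "\<And>j x. (h j has_real_derivative h' j x) (at x)" "h' i = (\<lambda>x. \<eta> x - \<eta> (x - l))"
    proof -
      from smooth_real_choose_derivatives[of h, OF smooth_h]
      obtain k' where k': "\<And>j x. (h j has_real_derivative k' j x) (at x)" by auto
      have "(h j has_real_derivative (k'(i := (\<lambda>x. \<eta> x - \<eta> (x - l)))) j x) (at x)" for j x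
        by (cases "j = i") (use k'[of j x] d\<theta>[of x] in \<open>simp_all add: h_def\<close>)
      then show ?thesis
        by (rule that) simp
    qed
    have split_coord: "coord_prod g x = g i (x $ i) * (\<Prod>j\<in>UNIV-{i}. g j (x $ j))" for g and x :: "real ^ 'n"
      unfolding coord_prod_def by (subst prod.remove[of _ i]) auto
    have part: "partial i \<psi> x = ?X m x - ?Y m x" for x
    proof -
      have "?Y m x = \<eta> (x $ i - l) * (\<Prod>j\<in>UNIV-{i}. bump (a $ j) (b $ j) m (x $ j))"
        unfolding shift by (auto simp: box_bump_def split_coord e \<eta>_def intro!: prod.cong)
      moreover have "?X m x = \<eta> (x $ i) * (\<Prod>j\<in>UNIV-{i}. bump (a $ j) (b $ j) m (x $ j))"
        by (simp add: box_bump_def split_coord \<eta>_def)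
      moreover have "partial i \<psi> x = (\<eta> (x $ i) - \<eta> (x $ i - l)) * (\<Prod>j\<in>UNIV-{i}. bump (a $ j) (b $ j) m (x $ j))"
        unfolding \<psi>_def partial_coord_prod[OF h'(1)] split_coord by (simp add: h'(2) h_def)
      ultimately show ?thesis by (simp add: algebra_simps)
    qed
    have \<psi>_int: "((\<lambda>t. ?X m (x - t *\<^sub>R e)) has_integral \<psi> x) {0..l}" for x
    proof -
      have "?X m (x - t *\<^sub>R e) = \<eta> (x $ i - t) * (\<Prod>j\<in>UNIV-{i}. bump (a $ j) (b $ j) m (x $ j))" for t
        by (auto simp: box_bump_def split_coord e \<eta>_def intro!: prod.cong)
      moreover have "\<psi> x = \<theta> (x $ i) * (\<Prod>j\<in>UNIV-{i}. bump (a $ j) (b $ j) m (x $ j))"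
        by (simp add: \<psi>_def split_coord h_def)
      ultimately show ?thesis
        using has_integral_mult_left[OF \<theta>_int] by simp
    qed
    have \<psi>_bounds: "0 \<le> \<psi> x \<and> \<psi> x \<le> l" for x
    proof
      show "0 \<le> \<psi> x" by (rule has_integral_nonneg[OF \<psi>_int box_bump_bounds(1)])
      show "\<psi> x \<le> l"
        using has_integral_le[OF \<psi>_int has_integral_const_real[of 1 0 l] box_bump_bounds(2)] l by simp
    qed
    have cont_\<psi>: "continuous_on S \<psi>" for S
      unfolding \<psi>_def using smooth_h by (rule coord_prod_continuous)
    have X_0: "?X m x = 0" if "x \<notin> cbox a b" for x
      using that box_subset_cbox[of a b] by (intro box_bump_eq_0) auto
    \<comment> \<open>By Fubini and translation invariance the mass of \<open>\<psi>\<close> is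
      \<open>l\<close> times that of the bump. Thus subtracting the constant \<open>c\<close> from
      \<open>D\<close> produces exactly the term \<open>c * l\<close> times that mass.\<close>
    have "integral (cbox a q) \<psi> = integral (cbox a q) (\<lambda>x. integral (cbox 0 l) (\<lambda>t. ?X m (x - t *\<^sub>R e)))"
      using integral_unique[OF \<psi>_int] by (simp add: cbox_interval)
    also have "\<dots> = integral (cbox 0 l) (\<lambda>t. integral (cbox a q) (\<lambda>x. ?X m (x - t *\<^sub>R e)))"
      by (intro integral_swap_continuous)
         (auto simp: case_prod_unfold intro!: continuous_on_compose2[OF box_bump_continuous[of UNIV]] continuous_intros)
    also have "\<dots> = integral (cbox 0 l) (\<lambda>t. integral (cbox a q) (?X m))"
      using shift_sub X_0 by (intro integral_cong integral_translate_box[OF sub0]) auto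
    finally have \<psi>_total: "integral (cbox a q) \<psi> = l * integral (cbox a q) (?X m)"
      using l by simp
    have "integral (cbox a q) (\<lambda>x. u x * partial i \<psi> x) = - integral (cbox a q) (\<lambda>x. D x * \<psi> x)"
    proof (rule weak_partial_test[OF weak])
      show "cbox a q \<subseteq> U" using sub by (simp add: q_def e_def)
      then show "\<psi> \<in> test_functions U"
        unfolding \<psi>_def using smooth_h h_0 by (intro coord_prod_test_function) auto
      show "continuous_on (cbox a q) (partial i \<psi>)"
        unfolding part[abs_def] by (intro continuous_intros box_bump_continuous)
      fix x assume x: "x \<notin> cbox a q"
      then have "\<psi> x = 0"
        unfolding \<psi>_def using h_0 box_subset_cbox[of a q] by (intro coord_prod_eq_0[of a q]) auto
      moreover have "x \<notin> cbox a b" "x \<notin> cbox (a + l *\<^sub>R e) (b + l *\<^sub>R e)"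
        using x sub0 shift_sub[of l] l by auto
      ultimately show "\<psi> x = 0 \<and> partial i \<psi> x = 0"
        unfolding part using box_subset_cbox by (metis box_bump_eq_0 diff_self subsetD)
    qed (rule cont_\<psi>)
    moreover have "integral (cbox a q) (\<lambda>x. u x * partial i \<psi> x)
        = integral (cbox a q) (\<lambda>x. u x * ?X m x) - integral (cbox a q) (\<lambda>x. u x * ?Y m x)"
      unfolding part right_diff_distrib
      by (intro integral_diff set_lebesgue_integral_eq_integral(1) absolutely_integrable_continuous_mult int box_bump_continuous)
    moreover have "integral (cbox a q) (\<lambda>x. (D x - c) * \<psi> x)
        = integral (cbox a q) (\<lambda>x. D x * \<psi> x) - c * integral (cbox a q) \<psi>"
      unfolding left_diff_distrib
      by (subst integral_diff) (auto intro!: integrable_continuous continuous_intros cont_\<psi>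
          set_lebesgue_integral_eq_integral(1) absolutely_integrable_continuous_mult int)
    ultimately have "integral (cbox a q) (\<lambda>x. u x * ?Y m x) - integral (cbox a q) (\<lambda>x. u x * ?X m x)
      - c * l * integral (cbox a q) (\<lambda>x. 1 * ?X m x) = integral (cbox a q) (\<lambda>x. (D x - c) * \<psi> x)"
      by (simp add: \<psi>_total)
    moreover have "norm (integral (cbox a q) (\<lambda>x. (D x - c) * \<psi> x)) \<le> integral (cbox a q) (\<lambda>x. l * \<bar>D x - c\<bar>)"
    proof (rule Henstock_Kurzweil_Integration.integral_norm_bound_integral)
      show "(\<lambda>x. (D x - c) * \<psi> x) integrable_on cbox a q"
        by (intro set_lebesgue_integral_eq_integral(1) absolutely_integrable_continuous_mult Dc cont_\<psi>)
      show "(\<lambda>x. l * \<bar>D x - c\<bar>) integrable_on cbox a q"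
        using Dc unfolding absolutely_integrable_on_def by (intro integrable_on_mult_right) simp
      show "norm ((D x - c) * \<psi> x) \<le> l * \<bar>D x - c\<bar>" for x
        using \<psi>_bounds[of x] by (simp add: abs_mult mult.commute mult_right_mono)
    qed
    ultimately show ?thesis by simp
  qed
  have sub1: "cbox (a + l *\<^sub>R e) (b + l *\<^sub>R e) \<subseteq> cbox a q" using shift_sub[of l] l by simp
  have one: "(\<lambda>x. 1 :: real) absolutely_integrable_on cbox a q"
    by (intro absolutely_integrable_on_const) auto
  have "(\<lambda>m. \<bar>integral (cbox a q) (\<lambda>x. u x * ?Y m x) - integral (cbox a q) (\<lambda>x. u x * ?X m x)
      - c * l * integral (cbox a q) (\<lambda>x. 1 * ?X m x)\<bar>) \<longlonglongrightarrow>
      \<bar>integral (cbox (a + l *\<^sub>R e) (b + l *\<^sub>R e)) u - integral (cbox a b) u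
      - c * l * integral (cbox a b) (\<lambda>x. 1)\<bar>"
    by (intro tendsto_intros integral_box_bump_tendsto int one sub0 sub1)
  then have "\<bar>integral (cbox (a + l *\<^sub>R e) (b + l *\<^sub>R e)) u - integral (cbox a b) u
      - c * l * integral (cbox a b) (\<lambda>x. 1)\<bar> \<le> l * integral (cbox a q) (\<lambda>x. \<bar>D x - c\<bar>)"
    by (rule LIMSEQ_le_const2) (use approx in blast)
  then show ?thesis
    unfolding e_def q_def by simp
qed

section \<open>Averages over nested boxes\<close>

lemma norm_le_card_mult:
  fixes v :: "real ^ 'n"
  assumes "\<And>j. \<bar>v $ j\<bar> \<le> s"
  shows "norm v \<le> real CARD('n) * s"
proof -
  have "norm v \<le> (\<Sum>j\<in>UNIV. \<bar>v $ j\<bar>)" by (rule norm_le_l1_cart)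
  also have "\<dots> \<le> (\<Sum>j\<in>(UNIV::'n set). s)" by (rule sum_mono) (rule assms)
  finally show ?thesis by simp
qed

lemma norm_diff_in_box:
  fixes x z :: "real ^ 'n"
  assumes "x \<in> cbox a b" "z \<in> cbox a b" "\<And>j. b $ j - a $ j \<le> s"
  shows "norm (z - x) \<le> real CARD('n) * s"
proof (rule norm_le_card_mult)
  fix j
  have "a $ j \<le> z $ j" "z $ j \<le> b $ j" "a $ j \<le> x $ j" "x $ j \<le> b $ j"
    using assms(1,2) by (auto simp: mem_box_cart)
  then show "\<bar>(z - x) $ j\<bar> \<le> s" using assms(3)[of j] by (simp add: abs_le_iff)
qed

definition box_avg :: "real ^ 'n \<Rightarrow> real ^ 'n \<Rightarrow> (real ^ 'n \<Rightarrow> 'b::real_normed_vector) \<Rightarrow> 'b" where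
  "box_avg a b g = integral (cbox a b) g /\<^sub>R measure lborel (cbox a b)"

lemma cbox_subset_cart:
  fixes a b :: "real ^ 'n"
  assumes "\<And>j. a $ j \<le> a' $ j" "\<And>j. b' $ j \<le> b $ j"
  shows "cbox a' b' \<subseteq> cbox a b"
  using assms by (meson mem_box_cart order_trans subsetI)

lemma measure_box:
  fixes a b :: "real ^ 'n"
  assumes "\<And>j. a $ j < b $ j"
  shows "measure lborel (cbox a b) = (\<Prod>j\<in>UNIV. b $ j - a $ j)"
proof -
  have "cbox a b \<noteq> {}" using assms by (simp add: interval_ne_empty_cart less_imp_le)
  then show ?thesis by (rule content_cbox_cart)
qed

lemma measure_box_pos:
  fixes a b :: "real ^ 'n"
  assumes "\<And>j. a $ j < b $ j"
  shows "measure lborel (cbox a b) > 0"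
  using assms by (simp add: measure_box prod_pos)

lemma measure_box_halved:
  fixes a b a' b' :: "real ^ 'n"
  assumes "\<And>j. a $ j < b $ j" "\<And>j. b' $ j - a' $ j = (if j \<in> I then (b $ j - a $ j) / 2 ^ m else b $ j - a $ j)"
  shows "measure lborel (cbox a' b') = measure lborel (cbox a b) / 2 ^ (m * card I)"
proof -
  have "a' $ j < b' $ j" for j
    using assms(1)[of j] assms(2)[of j] by (smt (verit) divide_pos_pos zero_less_power)
  then have "measure lborel (cbox a' b') = (\<Prod>j\<in>UNIV. b' $ j - a' $ j)"
    by (rule measure_box)
  also have "\<dots> = (\<Prod>j\<in>UNIV. (b $ j - a $ j) * (if j \<in> I then 1 / 2 ^ m else 1))"
    by (intro prod.cong) (auto simp: assms(2))
  also have "\<dots> = measure lborel (cbox a b) * (1 / 2 ^ m) ^ card I"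
    using assms(1) by (simp add: prod.distrib measure_box prod.If_cases)
  finally show ?thesis by (simp add: power_divide power_mult)
qed

lemma box_avg_real:
  fixes g :: "real ^ 'n \<Rightarrow> real"
  shows "box_avg a b g = integral (cbox a b) g / measure lborel (cbox a b)"
  by (simp add: box_avg_def divide_inverse)

lemma box_avg_mono_box:
  assumes "g integrable_on cbox a b" "\<And>x. 0 \<le> g x" "cbox a' b' \<subseteq> cbox a b" "\<And>j. a $ j < b $ j"
    and "measure lborel (cbox a' b') = measure lborel (cbox a b) / r" "r > 0"
  shows "box_avg a' b' g \<le> r * box_avg a b g"
proof -
  have "integral (cbox a' b') g \<le> integral (cbox a b) g"
    using assms by (intro integral_subset_le) (auto intro: integrable_on_subcbox)
  then have "r * (integral (cbox a' b') g / measure lborel (cbox a b))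
      \<le> r * (integral (cbox a b) g / measure lborel (cbox a b))"
    using assms(6) by (intro mult_left_mono divide_right_mono) auto
  then show ?thesis
    by (simp add: box_avg_def assms(5) divide_inverse mult_ac)
qed

lemma box_avg_nonneg:
  fixes g :: "real ^ 'n \<Rightarrow> real"
  assumes "\<And>x. 0 \<le> g x"
  shows "0 \<le> box_avg a b g"
proof -
  have "0 \<le> integral (cbox a b) g"
    using assms by (cases "g integrable_on cbox a b") (simp_all add: not_integrable_integral Henstock_Kurzweil_Integration.integral_nonneg)
  then show ?thesis by (simp add: box_avg_def)
qed

lemma integral_halves:
  fixes g :: "real ^ 'n \<Rightarrow> real" and i :: 'n
  assumes int: "g integrable_on cbox a b" and ab: "\<And>j. a $ j < b $ j"
  defines "v \<equiv> ((b $ i - a $ i) / 2) *\<^sub>R axis i 1"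
  shows "integral (cbox a b) g = integral (cbox a (b - v)) g + integral (cbox (a + v) b) g"
    and "measure lborel (cbox a (b - v)) = measure lborel (cbox a b) / 2"
    and "measure lborel (cbox (a + v) b) = measure lborel (cbox a b) / 2"
proof -
  define m where "m = (a $ i + b $ i) / 2"
  have v: "v $ j = (if j = i then (b $ i - a $ i) / 2 else 0)" for j
    by (simp add: v_def axis_def)
  have "(\<chi> j. if j = i then min (b $ i) m else b $ j) = b - v"
    using ab[of i] by (auto simp: vec_eq_iff v m_def field_simps)
  then have lo: "cbox a b \<inter> {x. x $ i \<le> m} = cbox a (b - v)"
    using interval_split_cart(1)[where a = a and b = b and k = i and c = m] by (simp only: interval_cbox_cart)
  have "(\<chi> j. if j = i then max (a $ i) m else a $ j) = a + v"
    using ab[of i] by (auto simp: vec_eq_iff v m_def field_simps)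
  then have hi: "cbox a b \<inter> {x. x $ i \<ge> m} = cbox (a + v) b"
    using interval_split_cart(2)[where a = a and b = b and k = i and c = m] by (simp only: interval_cbox_cart)
  have "integral (cbox a b) g = integral (cbox a b \<inter> {x. x \<bullet> axis i 1 \<le> m}) g
      + integral (cbox a b \<inter> {x. x \<bullet> axis i 1 \<ge> m}) g"
    by (rule integral_split[OF int]) (simp add: axis_in_Basis_iff)
  then show "integral (cbox a b) g = integral (cbox a (b - v)) g + integral (cbox (a + v) b) g"
    by (simp add: inner_axis lo hi)
  have "measure lborel (cbox a (b - v)) = measure lborel (cbox a b) / 2 ^ (1 * card {i})"
    by (rule measure_box_halved) (auto simp: ab v field_simps)
  then show "measure lborel (cbox a (b - v)) = measure lborel (cbox a b) / 2" by simp
  have "measure lborel (cbox (a + v) b) = measure lborel (cbox a b) / 2 ^ (1 * card {i})"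
    by (rule measure_box_halved) (auto simp: ab v field_simps)
  then show "measure lborel (cbox (a + v) b) = measure lborel (cbox a b) / 2" by simp
qed

text \<open>The halves are translates of each other by \<open>s / 2\<close>, so the shift estimate
  compares their integrals \<open>P\<close> and \<open>Q\<close>; the average over either half
  differs from that over the box by \<open>(P - Q) / V\<close> up to sign. The term
  \<open>c * s / 4\<close> is the change of an affine function of slope \<open>c\<close> between the
  midpoints of the box and of a half.\<close>

lemma weak_partial_halve:
  fixes u D :: "real ^ 'n \<Rightarrow> real"
  assumes weak: "weak_partial U i u D" and sub: "cbox a b \<subseteq> U" and ab: "\<And>j. a $ j < b $ j"
  defines "s \<equiv> b $ i - a $ i"
  shows "\<bar>box_avg a b u - box_avg a (b - (s / 2) *\<^sub>R axis i 1) u - c * s / 4\<bar>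
      \<le> (s / 2) * box_avg a b (\<lambda>x. \<bar>D x - c\<bar>)"
    and "\<bar>box_avg (a + (s / 2) *\<^sub>R axis i 1) b u - box_avg a b u - c * s / 4\<bar>
      \<le> (s / 2) * box_avg a b (\<lambda>x. \<bar>D x - c\<bar>)"
proof -
  define v :: "real ^ 'n" where "v = (s / 2) *\<^sub>R axis i 1"
  have v: "v $ j = (if j = i then s / 2 else 0)" for j
    by (simp add: v_def axis_def)
  have s: "s > 0" using ab[of i] by (simp add: s_def)
  have int_u: "u integrable_on cbox a b"
    using weak sub by (auto simp: weak_partial_def locally_integrable_on_def absolutely_integrable_on_def)
  note halves = integral_halves[OF int_u ab, of i, folded s_def, folded v_def]
  have "a $ j \<le> (b - v) $ j" for j
    using ab[of j] s by (auto simp: v s_def field_simps)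
  then have "\<bar>integral (cbox (a + v) (b - v + v)) u - integral (cbox a (b - v)) u
      - c * (s / 2) * measure lborel (cbox a (b - v))\<bar> \<le> (s / 2) * integral (cbox a (b - v + v)) (\<lambda>x. \<bar>D x - c\<bar>)"
    using s sub unfolding v_def
    by (intro weak_partial_box_shift[OF weak]) (auto simp: interval_ne_empty_cart)
  then have main: "\<bar>integral (cbox (a + v) b) u - integral (cbox a (b - v)) u - c * (s / 2) * (measure lborel (cbox a b) / 2)\<bar>
      \<le> (s / 2) * integral (cbox a b) (\<lambda>x. \<bar>D x - c\<bar>)"
    unfolding halves by simp
  define V where "V = measure lborel (cbox a b)"
  define P where "P = integral (cbox (a + v) b) u"
  define Q where "Q = integral (cbox a (b - v)) u"
  have V0: "V > 0" unfolding V_def by (rule measure_box_pos[OF ab])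
  have div: "\<bar>(P - Q) / V - c * s / 4\<bar> \<le> (s / 2) * (integral (cbox a b) (\<lambda>x. \<bar>D x - c\<bar>) / V)"
  proof -
    have "(P - Q) / V - c * s / 4 = (P - Q - c * (s / 2) * (V / 2)) / V"
      using V0 by (simp add: field_simps)
    then have "\<bar>(P - Q) / V - c * s / 4\<bar> = \<bar>P - Q - c * (s / 2) * (V / 2)\<bar> / V"
      using V0 by (simp only: abs_divide abs_of_pos)
    also have "\<dots> \<le> ((s / 2) * integral (cbox a b) (\<lambda>x. \<bar>D x - c\<bar>)) / V"
      using main V0 unfolding P_def Q_def V_def by (intro divide_right_mono) auto
    finally show ?thesis by simp
  qed
  have B: "box_avg a b u = (P + Q) / V" "box_avg a (b - v) u = 2 * Q / V" "box_avg (a + v) b u = 2 * P / V"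
    "box_avg a b (\<lambda>x. \<bar>D x - c\<bar>) = integral (cbox a b) (\<lambda>x. \<bar>D x - c\<bar>) / V"
    unfolding box_avg_real halves P_def[symmetric] Q_def[symmetric] V_def[symmetric]
    using V0 by (simp_all add: field_simps)
  have diffs: "(P + Q) / V - 2 * Q / V = (P - Q) / V" "2 * P / V - (P + Q) / V = (P - Q) / V"
    by (simp_all add: diff_divide_distrib add_divide_distrib)
  show "\<bar>box_avg a b u - box_avg a (b - (s / 2) *\<^sub>R axis i 1) u - c * s / 4\<bar>
      \<le> (s / 2) * box_avg a b (\<lambda>x. \<bar>D x - c\<bar>)"
    using div unfolding v_def[symmetric] B diffs .
  show "\<bar>box_avg (a + (s / 2) *\<^sub>R axis i 1) b u - box_avg a b u - c * s / 4\<bar>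
      \<le> (s / 2) * box_avg a b (\<lambda>x. \<bar>D x - c\<bar>)"
    using div unfolding v_def[symmetric] B diffs .
qed

section \<open>Chains of halved boxes for a Sobolev map\<close>

locale sobolev_map =
  fixes U :: "(real ^ 'n) set" and f :: "real ^ 'n \<Rightarrow> real ^ 'm" and D :: "real ^ 'n \<Rightarrow> real ^ 'n ^ 'm"
  assumes weak: "weak_partial U j (\<lambda>x. f x $ i) (\<lambda>x. D x $ i $ j)"
begin

text \<open>For \<open>C = 0\<close> the average of \<open>f\<close>; in general the average of \<open>f y - C *v y\<close>, because
  the linear part averages to its value at the midpoint.\<close>

definition deviation :: "real ^ 'n ^ 'm \<Rightarrow> real ^ 'n \<Rightarrow> real ^ 'n \<Rightarrow> real ^ 'm" where
  "deviation C a b = box_avg a b f - C *v ((1/2) *\<^sub>R (a + b))"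

lemma integrable_map:
  assumes "cbox a b \<subseteq> U"
  shows "f absolutely_integrable_on cbox a b"
proof (rule absolutely_integrable_componentwise)
  fix v :: "real ^ 'm" assume "v \<in> Basis"
  then obtain k where "v = axis k 1" by (auto simp: Basis_vec_def)
  then show "(\<lambda>x. f x \<bullet> v) absolutely_integrable_on cbox a b"
    using weak[of _ k] assms by (simp add: weak_partial_def locally_integrable_on_def inner_axis)
qed

lemma integrable_gradient:
  assumes "cbox a b \<subseteq> U"
  shows "D absolutely_integrable_on cbox a b"
proof (rule absolutely_integrable_componentwise)
  fix v :: "real ^ 'n ^ 'm" assume "v \<in> Basis"
  then obtain k j where "v = axis k (axis j 1)" by (auto simp: Basis_vec_def)
  then show "(\<lambda>x. D x \<bullet> v) absolutely_integrable_on cbox a b"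
    using weak[of j k] assms by (simp add: weak_partial_def locally_integrable_on_def inner_axis)
qed

lemma integrable_gradient_diff:
  assumes "cbox a b \<subseteq> U"
  shows "(\<lambda>x. norm (D x - C)) integrable_on cbox a b"
proof -
  have "(\<lambda>x. D x - C) absolutely_integrable_on cbox a b"
    using assms by (intro set_integral_diff integrable_gradient absolutely_integrable_on_const) auto
  then show ?thesis by (simp add: absolutely_integrable_on_def)
qed

lemma box_avg_component:
  assumes "cbox a b \<subseteq> U"
  shows "box_avg a b f $ k = box_avg a b (\<lambda>x. f x $ k)"
  using integrable_map[OF assms] by (simp add: box_avg_def absolutely_integrable_on_def integral_component_eq_cart)

lemma box_avg_entry_le:
  assumes "cbox a b \<subseteq> U"
  shows "box_avg a b (\<lambda>x. \<bar>D x $ k $ i - c $ k $ i\<bar>) \<le> box_avg a b (\<lambda>x. norm (D x - c))"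
proof -
  have le: "\<bar>D x $ k $ i - c $ k $ i\<bar> \<le> norm (D x - c)" for x
    using component_le_norm_cart[of "(D x - c) $ k" i] Finite_Cartesian_Product.norm_nth_le[of "D x - c" k] by simp
  have "integral (cbox a b) (\<lambda>x. \<bar>D x $ k $ i - c $ k $ i\<bar>) \<le> integral (cbox a b) (\<lambda>x. norm (D x - c))"
  proof (rule integral_le)
    have "(\<lambda>x. D x $ k $ i) absolutely_integrable_on cbox a b"
      using weak assms by (auto simp: weak_partial_def locally_integrable_on_def)
    then have "(\<lambda>x. D x $ k $ i - c $ k $ i) absolutely_integrable_on cbox a b"
      by (intro set_integral_diff absolutely_integrable_on_const) auto
    then show "(\<lambda>x. \<bar>D x $ k $ i - c $ k $ i\<bar>) integrable_on cbox a b"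
      by (simp add: absolutely_integrable_on_def)
  qed (use integrable_gradient_diff[OF assms] le in auto)
  then show ?thesis
    by (simp add: box_avg_def divide_right_mono mult_left_mono)
qed

text \<open>One of the halves contains \<open>x\<close>. Its midpoint is displaced by a quarter of
  the side, and the resulting change in the linear part of \<open>deviation\<close> cancels the term
  \<open>c * s / 4\<close> of the halving estimate, with \<open>c\<close> the entry of
  \<open>C\<close>. The factor \<open>CARD('m)\<close> comes from bounding the norm by the sum of
  the components.\<close>

lemma halve_coordinate:
  assumes sub: "cbox a b \<subseteq> U" and ab: "\<And>j. a $ j < b $ j" and x: "x \<in> cbox a b"
  shows "\<exists>a' b'. x \<in> cbox a' b' \<and> cbox a' b' \<subseteq> cbox a b \<and>
    (\<forall>j. b' $ j - a' $ j = (if j = i then (b $ j - a $ j) / 2 else b $ j - a $ j)) \<and>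
    norm (deviation C a' b' - deviation C a b)
      \<le> real CARD('m) * (b $ i - a $ i) * box_avg a b (\<lambda>y. norm (D y - C))"
proof -
  define s where "s = b $ i - a $ i"
  define h where "h = box_avg a b (\<lambda>y. norm (D y - C))"
  have s: "s > 0" using ab[of i] by (simp add: s_def)
  have h0: "h \<ge> 0" unfolding h_def by (rule box_avg_nonneg) simp
  define e :: "real ^ 'n" where "e = axis i 1"
  have e: "e $ j = (if j = i then 1 else 0)" for j
    by (simp add: e_def axis_def)
  have Ce: "(C *v e) $ k = C $ k $ i" for k
    by (simp add: e_def matrix_vector_mult_basis column_def)
  have bound: "norm v \<le> real CARD('m) * s * h" if "\<And>k. \<bar>v $ k\<bar> \<le> (s / 2) * h" for v :: "real ^ 'm"
  proof -
    have "norm v \<le> (\<Sum>k\<in>UNIV. \<bar>v $ k\<bar>)" by (rule norm_le_l1_cart)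
    also have "\<dots> \<le> (\<Sum>k\<in>(UNIV::'m set). s * h)"
    proof (rule sum_mono)
      fix k
      have "(s / 2) * h \<le> s * h" using s h0 by (intro mult_right_mono) auto
      then show "\<bar>v $ k\<bar> \<le> s * h" using that[of k] by linarith
    qed
    finally show ?thesis by simp
  qed
  have avg_le: "(s / 2) * box_avg a b (\<lambda>x. \<bar>D x $ k $ i - C $ k $ i\<bar>) \<le> (s / 2) * h" for k
    unfolding h_def using s by (intro mult_left_mono box_avg_entry_le sub) auto
  show ?thesis
  proof (cases "x $ i \<le> a $ i + s / 2")
    case True
    define b' where "b' = b - (s / 2) *\<^sub>R e"
    have sub': "cbox a b' \<subseteq> cbox a b"
      using s by (intro cbox_subset_cart) (auto simp: b'_def e)
    have "norm (deviation C a b' - deviation C a b) \<le> real CARD('m) * s * h"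
    proof (rule bound)
      fix k
      have "(deviation C a b' - deviation C a b) $ k =
          - (box_avg a b (\<lambda>x. f x $ k) - box_avg a b' (\<lambda>x. f x $ k) - C $ k $ i * s / 4)"
        using sub sub' by (simp add: deviation_def box_avg_component b'_def matrix_vector_mult_diff_distrib Ce
            matrix_vector_mult_scaleR matrix_vector_right_distrib scaleR_add_right scaleR_diff_right algebra_simps)
      moreover have "\<bar>box_avg a b (\<lambda>x. f x $ k) - box_avg a b' (\<lambda>x. f x $ k) - C $ k $ i * s / 4\<bar> \<le> (s / 2) * h"
        unfolding b'_def e_def s_def
        by (rule order_trans[OF weak_partial_halve(1)[OF weak sub ab] avg_le[unfolded s_def]])
      ultimately show "\<bar>(deviation C a b' - deviation C a b) $ k\<bar> \<le> (s / 2) * h"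
        by (simp only: abs_minus_cancel)
    qed
    moreover have "x \<in> cbox a b'"
      using x True by (auto simp: mem_box_cart b'_def e s_def field_simps)
    moreover have "\<forall>j. b' $ j - a $ j = (if j = i then (b $ j - a $ j) / 2 else b $ j - a $ j)"
      by (simp add: b'_def e s_def field_simps)
    ultimately show ?thesis
      using sub' unfolding s_def h_def by blast
  next
    case False
    define a' where "a' = a + (s / 2) *\<^sub>R e"
    have sub': "cbox a' b \<subseteq> cbox a b"
      using s by (intro cbox_subset_cart) (auto simp: a'_def e)
    have "norm (deviation C a' b - deviation C a b) \<le> real CARD('m) * s * h"
    proof (rule bound)
      fix k
      have "(deviation C a' b - deviation C a b) $ k =
          (box_avg a' b (\<lambda>x. f x $ k) - box_avg a b (\<lambda>x. f x $ k) - C $ k $ i * s / 4)"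
        using sub sub' by (simp add: deviation_def box_avg_component a'_def matrix_vector_mult_diff_distrib Ce
            matrix_vector_mult_scaleR matrix_vector_right_distrib scaleR_add_right scaleR_diff_right algebra_simps)
      moreover have "\<bar>box_avg a' b (\<lambda>x. f x $ k) - box_avg a b (\<lambda>x. f x $ k) - C $ k $ i * s / 4\<bar> \<le> (s / 2) * h"
        unfolding a'_def e_def s_def
        by (rule order_trans[OF weak_partial_halve(2)[OF weak sub ab] avg_le[unfolded s_def]])
      ultimately show "\<bar>(deviation C a' b - deviation C a b) $ k\<bar> \<le> (s / 2) * h"
        by (simp only:)
    qed
    moreover have "x \<in> cbox a' b"
      using x False by (auto simp: mem_box_cart a'_def e s_def)
    moreover have "\<forall>j. b $ j - a' $ j = (if j = i then (b $ j - a $ j) / 2 else b $ j - a $ j)"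
      by (simp add: a'_def e s_def field_simps)
    ultimately show ?thesis
      using sub' unfolding s_def h_def by blast
  qed
qed

text \<open>The coordinates in \<open>I\<close> are halved one after the other. Each earlier halving
  may double the average of \<open>norm (D y - C)\<close>, which accounts for the power of
  \<open>2\<close>. Only sides with index in \<open>I\<close> enter the error, so a slab may have
  any thickness in the direction left out.\<close>

lemma halve_coordinates:
  fixes I :: "'n set"
  assumes sub: "cbox a b \<subseteq> U" and ab: "\<And>j. a $ j < b $ j" and x: "x \<in> cbox a b"
    and L: "\<And>j. j \<in> I \<Longrightarrow> b $ j - a $ j \<le> L" "0 \<le> L"
  shows "\<exists>a' b'. x \<in> cbox a' b' \<and> cbox a' b' \<subseteq> cbox a b \<and>
    (\<forall>j. b' $ j - a' $ j = (if j \<in> I then (b $ j - a $ j) / 2 else b $ j - a $ j)) \<and>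
    norm (deviation C a' b' - deviation C a b)
      \<le> real (CARD('m) * card I * 2 ^ card I) * L * box_avg a b (\<lambda>y. norm (D y - C))"
  using finite[of I] L(1)
proof (induction I rule: finite_induct)
  case empty
  show ?case using x by (intro exI[of _ a] exI[of _ b]) auto
next
  case (insert i I)
  define A where "A = box_avg a b (\<lambda>y. norm (D y - C))"
  have A: "A \<ge> 0" unfolding A_def by (rule box_avg_nonneg) simp
  have "\<And>j. j \<in> I \<Longrightarrow> b $ j - a $ j \<le> L" using insert.prems by blast
  from insert.IH[OF this]
  obtain a1 b1 where 1: "x \<in> cbox a1 b1" "cbox a1 b1 \<subseteq> cbox a b"
    "\<And>j. b1 $ j - a1 $ j = (if j \<in> I then (b $ j - a $ j) / 2 else b $ j - a $ j)"
    "norm (deviation C a1 b1 - deviation C a b) \<le> real (CARD('m) * card I * 2 ^ card I) * L * A"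
    unfolding A_def by blast
  have ab1: "a1 $ j < b1 $ j" for j
    using 1(3)[of j] ab[of j] by (auto split: if_splits)
  have sub1: "cbox a1 b1 \<subseteq> U" using 1(2) sub by blast
  obtain a2 b2 where 2: "x \<in> cbox a2 b2" "cbox a2 b2 \<subseteq> cbox a1 b1"
    "\<And>j. b2 $ j - a2 $ j = (if j = i then (b1 $ j - a1 $ j) / 2 else b1 $ j - a1 $ j)"
    "norm (deviation C a2 b2 - deviation C a1 b1)
      \<le> real CARD('m) * (b1 $ i - a1 $ i) * box_avg a1 b1 (\<lambda>y. norm (D y - C))"
    using halve_coordinate[OF sub1 ab1 1(1)] by blast
  have "box_avg a1 b1 (\<lambda>y. norm (D y - C)) \<le> 2 ^ card I * A"
    unfolding A_def
  proof (rule box_avg_mono_box[OF integrable_gradient_diff[OF sub] _ 1(2) ab])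
    show "measure lborel (cbox a1 b1) = measure lborel (cbox a b) / 2 ^ card I"
      using measure_box_halved[OF ab, of b1 a1 I 1] 1(3) by simp
  qed auto
  moreover have "b1 $ i - a1 $ i \<le> L" "0 \<le> b1 $ i - a1 $ i"
    using 1(3)[of i] insert.hyps(2) insert.prems[of i] ab1[of i] by auto
  ultimately have "real CARD('m) * (b1 $ i - a1 $ i) * box_avg a1 b1 (\<lambda>y. norm (D y - C))
      \<le> real CARD('m) * L * (2 ^ card I * A)"
    using \<open>0 \<le> L\<close> by (intro mult_mono box_avg_nonneg) auto
  then have "norm (deviation C a2 b2 - deviation C a b)
      \<le> real CARD('m) * L * (2 ^ card I * A) + real (CARD('m) * card I * 2 ^ card I) * L * A"
    using 1(4) 2(4) norm_triangle_ineq[of "deviation C a2 b2 - deviation C a1 b1" "deviation C a1 b1 - deviation C a b"]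
    unfolding diff_add_cancel add_diff_eq by linarith
  also have "\<dots> \<le> real (CARD('m) * card (insert i I) * 2 ^ card (insert i I)) * L * A"
    using insert.hyps A \<open>0 \<le> L\<close> by (simp add: algebra_simps)
  finally show ?case
    using 1 2 insert.hyps unfolding A_def
    by (intro exI[of _ a2] exI[of _ b2]) (auto 0 3)
qed

definition chain_const :: "'n set \<Rightarrow> real" where
  "chain_const I = real (CARD('m) * card I * 2 ^ card I)"

text \<open>Rounds of halving are iterated around \<open>x\<close>; the sides shrink, so round
  \<open>m\<close> costs a factor \<open>L / 2 ^ m\<close>. The gradient averages are left in the
  statement because the two applications control them differently: by splitting at levels on slabs,
  and through a Lebesgue point on cubes.\<close>

lemma dyadic_chain:
  fixes I :: "'n set"
  assumes sub: "cbox a b \<subseteq> U" and ab: "\<And>j. a $ j < b $ j" and x: "x \<in> cbox a b"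
    and L: "\<forall>j\<in>I. b $ j - a $ j \<le> L" "0 \<le> L"
  shows "\<exists>A B. A 0 = a \<and> B 0 = b \<and> (\<forall>m. x \<in> cbox (A m) (B m) \<and> cbox (A m) (B m) \<subseteq> cbox a b \<and>
    (\<forall>j. B m $ j - A m $ j = (if j \<in> I then (b $ j - a $ j) / 2 ^ m else b $ j - a $ j)) \<and>
    norm (deviation C (A (Suc m)) (B (Suc m)) - deviation C (A m) (B m))
      \<le> chain_const I * (L / 2 ^ m) * box_avg (A m) (B m) (\<lambda>y. norm (D y - C)))"
proof -
  \<comment> \<open>The last conjunct pins down the start of the sequence, which dependent choice
    would leave open.\<close>
  define P where "P m w \<longleftrightarrow> x \<in> cbox (fst w) (snd w) \<and> cbox (fst w) (snd w) \<subseteq> cbox a b \<and>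
    (\<forall>j. snd w $ j - fst w $ j = (if j \<in> I then (b $ j - a $ j) / 2 ^ m else b $ j - a $ j)) \<and> (m = 0 \<longrightarrow> w = (a, b))"
    for m :: nat and w
  define Q where "Q m w w' \<longleftrightarrow> norm (deviation C (fst w') (snd w') - deviation C (fst w) (snd w))
      \<le> chain_const I * (L / 2 ^ m) * box_avg (fst w) (snd w) (\<lambda>y. norm (D y - C))" for m :: nat and w w'
  have "\<exists>w. \<forall>m. P m (w m) \<and> Q m (w m) (w (Suc m))"
  proof (rule dependent_nat_choice)
    show "\<exists>w. P 0 w" using x by (auto simp: P_def)
    fix w m assume w: "P m w"
    obtain a1 b1 where w_eq: "w = (a1, b1)" by force
    have 1: "x \<in> cbox a1 b1" "cbox a1 b1 \<subseteq> cbox a b"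
      "\<And>j. b1 $ j - a1 $ j = (if j \<in> I then (b $ j - a $ j) / 2 ^ m else b $ j - a $ j)"
      using w by (auto simp: P_def w_eq)
    have ab1: "a1 $ j < b1 $ j" for j
    proof -
      have "0 < b1 $ j - a1 $ j" unfolding 1(3) using ab[of j] by auto
      then show ?thesis by simp
    qed
    have sub1: "cbox a1 b1 \<subseteq> U" using 1(2) sub by blast
    have L1: "b1 $ j - a1 $ j \<le> L / 2 ^ m" if "j \<in> I" for j
      using bspec[OF L(1) that] that 1(3)[of j] by (simp add: divide_right_mono)
    obtain a2 b2 where 2: "x \<in> cbox a2 b2" "cbox a2 b2 \<subseteq> cbox a1 b1"
      "\<And>j. b2 $ j - a2 $ j = (if j \<in> I then (b1 $ j - a1 $ j) / 2 else b1 $ j - a1 $ j)"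
      "norm (deviation C a2 b2 - deviation C a1 b1)
        \<le> chain_const I * (L / 2 ^ m) * box_avg a1 b1 (\<lambda>y. norm (D y - C))"
      using halve_coordinates[OF sub1 ab1 1(1) L1, of I C] L(2) unfolding chain_const_def by auto
    have "b2 $ j - a2 $ j = (if j \<in> I then (b $ j - a $ j) / 2 ^ Suc m else b $ j - a $ j)" for j
      unfolding 2(3) 1(3) by simp
    then have "P (Suc m) (a2, b2)" using 1 2 by (auto simp: P_def)
    moreover have "Q m w (a2, b2)" using 2 by (simp add: Q_def w_eq)
    ultimately show "\<exists>w'. P (Suc m) w' \<and> Q m w w'" by blast
  qed
  then obtain w where w: "\<And>m. P m (w m)" "\<And>m. Q m (w m) (w (Suc m))" by blast
  have "w 0 = (a, b)" using w(1)[of 0] by (simp add: P_def)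
  then show ?thesis
    using w by (intro exI[of _ "fst \<circ> w"] exI[of _ "snd \<circ> w"]) (simp add: P_def Q_def)
qed

end

section \<open>The Calderon condition at dyadic levels\<close>

text \<open>A geometric sum of ratio at least \<open>2\<close> is at most twice its largest term, so
  a bound for the single terms bounds the sum over any finite index set.\<close>

lemma sum_powers_le:
  fixes q Y :: real
  assumes "q \<ge> 2" "finite A" "\<And>m. m \<in> A \<Longrightarrow> q ^ m \<le> Y" "0 \<le> Y"
  shows "(\<Sum>m\<in>A. q ^ m) \<le> 2 * Y"
proof (cases "A = {}")
  case False
  have *: "(\<Sum>m\<le>M. q ^ m) \<le> 2 * q ^ M" for M
  proof (induction M)
    case (Suc M)
    have "2 * q ^ M \<le> q ^ Suc M" using assms(1) by (simp add: mult_right_mono)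
    then show ?case using Suc by simp
  qed simp
  have "(\<Sum>m\<in>A. q ^ m) \<le> (\<Sum>m\<le>Max A. q ^ m)"
    using assms by (intro sum_mono2) auto
  also have "\<dots> \<le> 2 * Y"
    using *[of "Max A"] assms(3)[of "Max A"] assms(2) False by simp
  finally show ?thesis .
qed (use assms in auto)

text \<open>Here the largest term belongs to the least exponent.\<close>

lemma sum_half_powers_le:
  fixes Y :: real
  assumes "finite A" "\<And>m. m \<in> A \<Longrightarrow> (1/2) ^ m \<le> Y" "0 \<le> Y"
  shows "(\<Sum>m\<in>A. (1/2) ^ m) \<le> 2 * Y"
proof (cases "A = {}")
  case False
  have *: "(\<Sum>m=M..M+d. (1/2::real) ^ m) = 2 * (1/2) ^ M - (1/2) ^ (M + d)" for M d
    by (induction d) auto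
  have "(\<Sum>m\<in>A. (1/2) ^ m) \<le> (\<Sum>m=Min A..Max A. (1/2::real) ^ m)"
    using assms by (intro sum_mono2) auto
  also have "\<dots> \<le> 2 * (1/2) ^ Min A"
    using *[of "Min A" "Max A - Min A"] assms(1) False by simp
  also have "\<dots> \<le> 2 * Y"
    using assms(2)[of "Min A"] assms(1) False by simp
  finally show ?thesis .
qed (use assms in auto)

lemma dyadic_scale:
  fixes t :: real
  assumes "t \<ge> 1"
  obtains i :: nat where "2 ^ i \<le> t" "t < 2 ^ Suc i"
proof -
  obtain n where "t < 2 ^ n" using real_arch_pow[of 2 t] by auto
  then have "\<exists>i<n. (\<forall>j\<le>i. \<not> t < 2 ^ j) \<and> t < 2 ^ Suc i"
    using assms by (intro ex_least_nat_less) auto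
  then show ?thesis using that by (meson not_less order_refl)
qed

locale calderon =
  fixes \<phi> :: "real \<Rightarrow> real" and r :: nat
  assumes r: "r \<ge> 1"
    and nonneg: "t \<ge> 0 \<Longrightarrow> \<phi> t \<ge> 0"
    and mono: "0 \<le> s \<Longrightarrow> s \<le> t \<Longrightarrow> \<phi> s \<le> \<phi> t"
    and integral_finite: "calderon_integral \<phi> (1 / real r) < \<infinity>"
begin

definition weight :: "real \<Rightarrow> ennreal" where
  "weight t = (if \<phi> t = 0 then \<infinity> else ennreal ((t / \<phi> t) powr (1 / real r))) * indicator {1..} t"

lemma integral_weight: "(\<integral>\<^sup>+ t. weight t \<partial>lborel) < \<infinity>"
  using integral_finite unfolding calderon_integral_def weight_def .

text \<open>Otherwise \<phi> would vanish on \<open>{1..t}\<close> by monotonicity, and the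
  integrand would be infinite on a set of positive measure.\<close>

lemma positive:
  assumes "t > 1"
  shows "\<phi> t > 0"
proof (rule ccontr)
  assume "\<not> \<phi> t > 0"
  then have zero: "\<phi> t = 0" using nonneg[of t] assms by simp
  have "(\<integral>\<^sup>+ s. \<infinity> * indicator {1..t} s \<partial>lborel) \<le> (\<integral>\<^sup>+ s. weight s \<partial>lborel)"
  proof (rule nn_integral_mono)
    fix s
    show "\<infinity> * indicator {1..t} s \<le> weight s"
    proof (cases "s \<in> {1..t}")
      case True
      then have "\<phi> s = 0" using mono[of s t] nonneg[of s] zero by simp
      then show ?thesis using True by (simp add: weight_def)
    qed simp
  qed
  moreover have "(\<integral>\<^sup>+ s. \<infinity> * indicator {1..t} s \<partial>lborel) = \<infinity> * emeasure lborel {1..t}"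
    by (rule nn_integral_cmult_indicator) simp
  moreover have "\<infinity> * emeasure lborel {1..t} = \<infinity>"
    using assms by (simp add: ennreal_top_mult)
  ultimately show False using integral_weight by simp
qed

text \<open>Up to constants, the share of the dyadic interval ending at \<open>2 ^ Suc i\<close> in the Calderon integral.\<close>

definition dyadic_weight :: "nat \<Rightarrow> real" where
  "dyadic_weight i = 2 ^ Suc i * (2 ^ Suc i / \<phi> (2 ^ Suc i)) powr (1 / real r)"

lemma dyadic_weight_nonneg: "dyadic_weight i \<ge> 0"
  by (simp add: dyadic_weight_def)

text \<open>Since \<phi> is increasing, the step function with value \<open>c i\<close> on
  \<open>{2 ^ i..<2 ^ Suc i}\<close> lies below the Calderon integrand. Its integral is the sum of
  the \<open>c i * 2 ^ i\<close>, which are the dyadic weights up to a constant factor.\<close>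

lemma summable_dyadic_weight: "summable dyadic_weight"
proof -
  define c where "c i = (2 ^ i / \<phi> (2 ^ Suc i)) powr (1 / real r)" for i :: nat
  have pos: "\<phi> (2 ^ Suc i) > 0" for i :: nat
    by (rule positive) (rule one_less_power, auto)
  have dyadic_weight_eq: "dyadic_weight i = 2 * 2 powr (1 / real r) * (c i * 2 ^ i)" for i
  proof -
    have "2 ^ Suc i / \<phi> (2 ^ Suc i) = 2 * (2 ^ i / \<phi> (2 ^ Suc i))" by simp
    then show ?thesis
      unfolding dyadic_weight_def c_def using pos[of i] by (subst \<open>_ = 2 * _\<close>, subst powr_mult) (auto simp: mult_ac)
  qed
  define C where "C = enn2real (\<integral>\<^sup>+ t. weight t \<partial>lborel)"
  have "(\<Sum>i<N. c i * 2 ^ i) \<le> C" for N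
  proof -
    have c0: "c i \<ge> 0" for i by (simp add: c_def)
    have "(\<Sum>i<N. ennreal (c i) * indicator {2 ^ i..<2 ^ Suc i} t) \<le> weight t" for t
    proof (cases "t \<ge> 1")
      case True
      then obtain k where k: "2 ^ k \<le> t" "t < 2 ^ Suc k" by (rule dyadic_scale)
      have uniq: "t \<in> {2 ^ i..<2 ^ Suc i} \<longleftrightarrow> i = k" for i
      proof
        assume i: "t \<in> {2 ^ i..<2 ^ Suc i}"
        have "(2::real) ^ i < 2 ^ Suc k" "(2::real) ^ k < 2 ^ Suc i" using i k by auto
        then show "i = k" by (metis less_Suc_eq_le nle_le one_less_numeral_iff order_antisym power_strict_increasing_iff semiring_norm(76))
      qed (use k in auto)
      have "(\<Sum>i<N. ennreal (c i) * indicator {2 ^ i..<2 ^ Suc i} t) = (\<Sum>i<N. if i = k then ennreal (c k) else 0)"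
        unfolding indicator_def uniq by (intro sum.cong) auto
      also have "\<dots> \<le> ennreal (c k)" by simp
      also have "\<dots> \<le> weight t"
      proof (cases "\<phi> t = 0")
        case False
        then have "\<phi> t > 0" using nonneg[of t] True by simp
        moreover have "\<phi> t \<le> \<phi> (2 ^ Suc k)" using k True by (intro mono) auto
        ultimately have "2 ^ k / \<phi> (2 ^ Suc k) \<le> t / \<phi> t"
          using k True by (intro frac_le) auto
        then have "c k \<le> (t / \<phi> t) powr (1 / real r)"
          unfolding c_def using pos[of k] by (intro powr_mono2) auto
        then show ?thesis using False True by (simp add: weight_def ennreal_leI)
      qed (use True in \<open>simp add: weight_def\<close>)
      finally show ?thesis .
    next
      case False
      have "t \<notin> {2 ^ i..<2 ^ Suc i}" for i
      proof -
      have "t < 2 ^ i" using False one_le_power[of "2::real" i] by linarith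
      then show ?thesis by simp
    qed
      then show ?thesis by (simp add: indicator_def del: atLeastLessThan_iff)
    qed
    then have "(\<integral>\<^sup>+ (t::real). (\<Sum>i<N. ennreal (c i) * indicator {2 ^ i..<2 ^ Suc i} t) \<partial>lborel) \<le> (\<integral>\<^sup>+ t. weight t \<partial>lborel)"
      by (rule nn_integral_mono)
    moreover have "(\<integral>\<^sup>+ (t::real). (\<Sum>i<N. ennreal (c i) * indicator {2 ^ i..<2 ^ Suc i} t) \<partial>lborel)
        = (\<Sum>i<N. ennreal (c i * 2 ^ i))"
      by (subst nn_integral_sum) (auto simp: nn_integral_cmult_indicator ennreal_mult c0 intro!: sum.cong)
    moreover have "(\<integral>\<^sup>+ t. weight t \<partial>lborel) = ennreal C"
      using integral_weight by (simp add: C_def)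
    ultimately have "ennreal (\<Sum>i<N. c i * 2 ^ i) \<le> ennreal C"
      using c0 by (simp add: sum_ennreal)
    then show ?thesis
      by (subst (asm) ennreal_le_iff) (simp_all add: C_def)
  qed
  then have "summable (\<lambda>i. c i * 2 ^ i)"
    by (intro summableI_nonneg_bounded[of _ C]) (auto simp: c_def)
  then show ?thesis
    unfolding dyadic_weight_eq[abs_def] by (rule summable_mult)
qed

text \<open>The sum extends over those \<open>i\<close> for which \<open>\<phi> t < 2 ^ (m * r) * t\<close> is possible for some \<open>t\<close>
  between \<open>2 ^ Suc i\<close> and \<open>2 ^ Suc (Suc i)\<close>, so that \<open>level m\<close> exceeds all such \<open>t\<close>.\<close>

definition level :: "nat \<Rightarrow> real" where
  "level m = 2 + (\<Sum>i. if (1/2) ^ m \<le> 2 * dyadic_weight i / 2 ^ Suc i then 2 ^ Suc (Suc i) else 0)"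

text \<open>The condition selecting \<open>i\<close> is itself the estimate: it says that
  \<open>2 ^ Suc i\<close> is at most \<open>2 ^ Suc m * dyadic_weight i\<close>.\<close>

lemma level_summand:
  "summable (\<lambda>i. if (1/2) ^ m \<le> 2 * dyadic_weight i / 2 ^ Suc i then 2 ^ Suc (Suc i) else (0::real))"
proof (rule summable_comparison_test')
  show "summable (\<lambda>i. 2 ^ Suc (Suc m) * dyadic_weight i)" using summable_dyadic_weight by (rule summable_mult)
  show "norm (if (1/2) ^ m \<le> 2 * dyadic_weight i / 2 ^ Suc i then 2 ^ Suc (Suc i) else (0::real)) \<le> 2 ^ Suc (Suc m) * dyadic_weight i"
    if "i \<ge> 0" for i
    using dyadic_weight_nonneg[of i] by (auto simp: field_simps)
qed

lemma level_ge_2: "level m \<ge> 2"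
proof -
  have "0 \<le> (\<Sum>i. if (1/2) ^ m \<le> 2 * dyadic_weight i / 2 ^ Suc i then 2 ^ Suc (Suc i) else (0::real))"
    by (rule suminf_nonneg[OF level_summand]) auto
  then show ?thesis by (simp add: level_def)
qed

lemma level_nonneg: "level m \<ge> 0"
  using level_ge_2[of m] by linarith

text \<open>Interchange the sums. For fixed \<open>i\<close> the admissible \<open>m\<close> form a
  geometric tail starting below \<open>2 * dyadic_weight i / 2 ^ Suc i\<close>, and multiplied by
  \<open>2 ^ Suc (Suc i)\<close> it contributes at most \<open>8 * dyadic_weight i\<close>. The
  \<open>4\<close> comes from the summand \<open>2\<close> of \<open>level\<close>.\<close>

lemma summable_level: "summable (\<lambda>m. level m / 2 ^ m)"
proof (rule summableI_nonneg_bounded[of _ "4 + 8 * suminf dyadic_weight"])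
  show "0 \<le> level m / 2 ^ m" for m using level_nonneg by simp
  fix N
  define g where "g i m = (if (1/2) ^ m \<le> 2 * dyadic_weight i / 2 ^ Suc i then 2 ^ Suc (Suc i) else (0::real)) * (1/2) ^ m" for i m :: nat
  have g_sum: "summable (\<lambda>i. g i m)" for m
    unfolding g_def by (intro summable_mult2 level_summand)
  have "level m / 2 ^ m = 2 * (1/2) ^ m + (\<Sum>i. g i m)" for m
    unfolding level_def g_def suminf_mult2[OF level_summand, symmetric] by (simp add: field_simps power_one_over)
  then have "(\<Sum>m<N. level m / 2 ^ m) = 2 * (\<Sum>m<N. (1/2) ^ m) + (\<Sum>i. \<Sum>m<N. g i m)"
    using g_sum by (simp add: sum.distrib sum_distrib_left suminf_sum)
  also have "(\<Sum>m<N. (1/2::real) ^ m) \<le> 2 * 1"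
    by (rule sum_half_powers_le) (auto simp: power_le_one)
  also have "(\<Sum>i. \<Sum>m<N. g i m) \<le> (\<Sum>i. 8 * dyadic_weight i)"
  proof (rule suminf_le)
    show "summable (\<lambda>i. \<Sum>m<N. g i m)" using g_sum by (intro summable_sum)
    show "summable (\<lambda>i. 8 * dyadic_weight i)" using summable_dyadic_weight by (rule summable_mult)
    fix i
    have "(\<Sum>m<N. g i m) = 2 ^ Suc (Suc i) * (\<Sum>m\<in>{m. m < N \<and> (1/2) ^ m \<le> 2 * dyadic_weight i / 2 ^ Suc i}. (1/2) ^ m)"
      unfolding sum_distrib_left g_def by (intro sum.mono_neutral_cong_right) auto
    also have "\<dots> \<le> 2 ^ Suc (Suc i) * (2 * (2 * dyadic_weight i / 2 ^ Suc i))"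
      using dyadic_weight_nonneg by (intro mult_left_mono sum_half_powers_le) auto
    also have "\<dots> = 8 * dyadic_weight i" by simp
    finally show "(\<Sum>m<N. g i m) \<le> 8 * dyadic_weight i" .
  qed
  also have "(\<Sum>i. 8 * dyadic_weight i) = 8 * suminf dyadic_weight" using summable_dyadic_weight by (rule suminf_mult)
  finally show "(\<Sum>m<N. level m / 2 ^ m) \<le> 4 + 8 * suminf dyadic_weight" by simp
qed

text \<open>If the inequality failed for \<open>t\<close> in
  \<open>{2 ^ Suc i..<2 ^ Suc (Suc i)}\<close>, then by monotonicity \<phi> would be so small at
  \<open>2 ^ Suc i\<close> that the index \<open>i\<close> is selected in \<open>level m\<close>;
  its summand alone would exceed \<open>t\<close>.\<close>

lemma above_level:
  assumes "t > level m"
  shows "2 ^ (m * r) * t \<le> \<phi> t"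
proof (rule ccontr)
  assume less: "\<not> 2 ^ (m * r) * t \<le> \<phi> t"
  \<comment> \<open>The summand \<open>2\<close> in \<open>level\<close> excludes the first dyadic
    interval, so that \<open>k\<close> is a successor.\<close>
  have "t > 2"
    using assms level_ge_2[of m] by linarith
  obtain k where k: "2 ^ k \<le> t" "t < 2 ^ Suc k" using dyadic_scale[of t] \<open>t > 2\<close> by auto
  obtain i where i: "k = Suc i"
    using k(2) \<open>t > 2\<close> by (cases k) auto
  have pos: "\<phi> (2 ^ Suc i) > 0"
    by (rule positive) (rule one_less_power, auto)
  have "\<phi> (2 ^ Suc i) \<le> \<phi> t" using k i by (intro mono) auto
  also have "\<dots> < 2 ^ (m * r) * t" using less by simp
  also have "\<dots> \<le> 2 ^ (m * r) * 2 ^ Suc k" using k by simp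
  finally have "1 / (2 * 2 ^ (m * r)) \<le> 2 ^ Suc i / \<phi> (2 ^ Suc i)"
    using pos i by (simp add: field_simps)
  then have "(1 / (2 * 2 ^ (m * r))) powr (1 / real r) \<le> (2 ^ Suc i / \<phi> (2 ^ Suc i)) powr (1 / real r)"
    by (intro powr_mono2) auto
  moreover have "(1 / (2 * 2 ^ (m * r))) powr (1 / real r) = (1/2) powr (1 / real r) * (1/2) ^ m"
  proof -
    have "((1/2::real) ^ (m * r)) powr (1 / real r) = ((1/2) powr (real (m * r))) powr (1 / real r)"
      by (simp add: powr_realpow[symmetric])
    also have "\<dots> = (1/2) ^ m"
      using r by (simp add: powr_powr powr_realpow)
    finally have "((1/2::real) ^ (m * r)) powr (1 / real r) = (1/2) ^ m" .
    moreover have "(1 / (2 * 2 ^ (m * r))) powr (1 / real r) = ((1/2) * (1/2::real) ^ (m * r)) powr (1 / real r)"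
      by (simp add: power_one_over)
    moreover have "((1/2) * (1/2::real) ^ (m * r)) powr (1 / real r)
        = (1/2) powr (1 / real r) * ((1/2) ^ (m * r)) powr (1 / real r)"
      by (rule powr_mult)
    ultimately show ?thesis by (simp only:)
  qed
  \<comment> \<open>Passing to the left end of the dyadic interval lost a factor \<open>2\<close>.
    Its root of order \<open>r\<close> is at most \<open>2\<close>, and the factor \<open>2\<close>
    in the condition of \<open>level\<close> absorbs it.\<close>
  moreover have "(1/2::real) * (1/2) ^ m \<le> (1/2) powr (1 / real r) * (1/2) ^ m"
  proof (rule mult_right_mono)
    have "(1/2::real) powr 1 \<le> (1/2) powr (1 / real r)"
      using r by (intro powr_mono') auto
    then show "1/2 \<le> (1/2::real) powr (1 / real r)" by simp
  qed simp
  moreover have "dyadic_weight i / 2 ^ Suc i = (2 ^ Suc i / \<phi> (2 ^ Suc i)) powr (1 / real r)"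
    by (simp add: dyadic_weight_def)
  ultimately have "(1/2) * (1/2) ^ m \<le> dyadic_weight i / 2 ^ Suc i"
    by linarith
  then have cond: "(1/2) ^ m \<le> 2 * dyadic_weight i / 2 ^ Suc i" by simp
  have "(if (1/2) ^ m \<le> 2 * dyadic_weight i / 2 ^ Suc i then 2 ^ Suc (Suc i) else (0::real)) \<le> level m - 2"
    unfolding level_def using sum_le_suminf[OF level_summand[of m], of "{i}"] by simp
  then have "2 ^ Suc (Suc i) \<le> level m - 2" using cond by simp
  then show False using k i assms by simp
qed

text \<open>This pointwise inequality stands in for Jensen's. Only scales with
  \<open>level m < t\<close> count, and for these \<open>2 ^ (m * r)\<close> is at most
  \<open>\<phi> t / t\<close>. Because \<open>r \<ge> 1\<close> the ratio \<open>2 ^ r\<close> is at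
  least \<open>2\<close>, and the geometric sum is at most twice that bound.\<close>

lemma weighted_levels_le:
  assumes "0 \<le> t" "t \<le> s"
  shows "(\<Sum>m<M. 2 ^ (m * r) * max (t - level m) 0) \<le> 2 * \<phi> s"
proof (cases "t = 0")
  case True
  then have "(\<Sum>m<M. 2 ^ (m * r) * max (t - level m) 0) = 0"
    using level_nonneg by (intro sum.neutral) (auto simp: max_def)
  then show ?thesis using nonneg[of s] assms True by simp
next
  case False
  then have t: "t > 0" using assms by simp
  define A where "A = {m. m < M \<and> level m < t}"
  have "(\<Sum>m<M. 2 ^ (m * r) * max (t - level m) 0) = (\<Sum>m\<in>A. 2 ^ (m * r) * (t - level m))"
    unfolding A_def by (intro sum.mono_neutral_cong_right) auto
  also have "\<dots> \<le> (\<Sum>m\<in>A. (2 ^ r) ^ m * t)"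
    using level_nonneg by (intro sum_mono) (simp add: power_mult[symmetric] mult.commute)
  also have "\<dots> = (\<Sum>m\<in>A. (2 ^ r) ^ m) * t" by (simp add: sum_distrib_right)
  also have "\<dots> \<le> (2 * (\<phi> t / t)) * t"
  proof (intro mult_right_mono sum_powers_le)
    show "(2::real) \<le> 2 ^ r" using r by (simp add: self_le_power)
    show "(2 ^ r) ^ m \<le> \<phi> t / t" if "m \<in> A" for m
      using above_level[of m t] that t by (simp add: A_def field_simps power_mult[symmetric] mult.commute)
  qed (use t nonneg[of t] in \<open>auto simp: A_def\<close>)
  also have "\<dots> = 2 * \<phi> t" using t by simp
  also have "\<dots> \<le> 2 * \<phi> s" using mono[of t s] assms by simp
  finally show ?thesis .
qed

end

section \<open>Oscillation on thin slabs\<close>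

text \<open>Pigeonholing for a thin slab takes the place of Fubini's theorem and of the restriction of Sobolev
  functions to hyperplanes.\<close>

lemma thin_slab:
  fixes g :: "real ^ 'n \<Rightarrow> real"
  assumes int: "g integrable_on cbox a b" and ab: "\<And>j. a $ j < b $ j"
  shows "\<exists>a' b'. cbox a' b' \<subseteq> cbox a b \<and> (\<forall>j. j \<noteq> i \<longrightarrow> a' $ j = a $ j \<and> b' $ j = b $ j) \<and>
    a' $ i < b' $ i \<and> b' $ i - a' $ i = (b $ i - a $ i) / 2 ^ M \<and> box_avg a' b' g \<le> box_avg a b g"
proof (induction M)
  case 0
  then show ?case using ab by (intro exI[of _ a] exI[of _ b]) auto
next
  case (Suc M)
  then obtain a' b' where 1: "cbox a' b' \<subseteq> cbox a b" "\<And>j. j \<noteq> i \<Longrightarrow> a' $ j = a $ j \<and> b' $ j = b $ j"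
    "a' $ i < b' $ i" "b' $ i - a' $ i = (b $ i - a $ i) / 2 ^ M" "box_avg a' b' g \<le> box_avg a b g"
    by blast
  have ab': "a' $ j < b' $ j" for j
    using 1(2)[of j] 1(3) ab[of j] by (cases "j = i") auto
  define v where "v = ((b' $ i - a' $ i) / 2) *\<^sub>R axis i (1 :: real)"
  have v: "v $ j = (if j = i then (b' $ i - a' $ i) / 2 else 0)" for j
    by (simp add: v_def axis_def)
  note halves = integral_halves[OF integrable_on_subcbox[OF int 1(1)] ab', of i, folded v_def]
  have "w \<le> (p + q) /\<^sub>R V \<or> z \<le> (p + q) /\<^sub>R V"
    if "V > 0" "w = p /\<^sub>R (V / 2)" "z = q /\<^sub>R (V / 2)" for V w z p q :: real
  proof (rule ccontr)
    assume "\<not> ?thesis"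
    then have "p + q < 2 * p" "p + q < 2 * q"
      using that by (simp_all add: field_simps)
    then show False by simp
  qed
  from this[OF measure_box_pos[OF ab']]
  have "box_avg a' (b' - v) g \<le> box_avg a' b' g \<or> box_avg (a' + v) b' g \<le> box_avg a' b' g"
    unfolding box_avg_def halves by blast
  then show ?case
  proof
    assume le: "box_avg a' (b' - v) g \<le> box_avg a' b' g"
    have "cbox a' (b' - v) \<subseteq> cbox a' b'"
      using ab'[of i] by (intro cbox_subset_cart) (auto simp: v)
    then have "cbox a' (b' - v) \<subseteq> cbox a b" using 1(1) by blast
    moreover have "\<forall>j. j \<noteq> i \<longrightarrow> a' $ j = a $ j \<and> (b' - v) $ j = b $ j"
      using 1(2) by (simp add: v)
    moreover have "a' $ i < (b' - v) $ i" "(b' - v) $ i - a' $ i = (b $ i - a $ i) / 2 ^ Suc M"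
      using ab'[of i] 1(4) by (simp_all add: v field_simps)
    ultimately show ?thesis using order_trans[OF le 1(5)] by blast
  next
    assume le: "box_avg (a' + v) b' g \<le> box_avg a' b' g"
    have "cbox (a' + v) b' \<subseteq> cbox a' b'"
      using ab'[of i] by (intro cbox_subset_cart) (auto simp: v)
    then have "cbox (a' + v) b' \<subseteq> cbox a b" using 1(1) by blast
    moreover have "\<forall>j. j \<noteq> i \<longrightarrow> (a' + v) $ j = a $ j \<and> b' $ j = b $ j"
      using 1(2) by (simp add: v)
    moreover have "(a' + v) $ i < b' $ i" "b' $ i - (a' + v) $ i = (b $ i - a $ i) / 2 ^ Suc M"
      using ab'[of i] 1(4) by (simp_all add: v field_simps)
    ultimately show ?thesis using order_trans[OF le 1(5)] by blast
  qed
qed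

lemma box_avg_close:
  fixes g :: "real ^ 'n \<Rightarrow> 'b::euclidean_space"
  assumes int: "g integrable_on cbox a b" and ab: "\<And>j. a $ j < b $ j"
    and close: "\<And>x. x \<in> cbox a b \<Longrightarrow> norm (g x - v) \<le> e" and "e \<ge> 0"
  shows "norm (box_avg a b g - v) \<le> e"
proof -
  define V where "V = measure lborel (cbox a b)"
  have V: "V > 0" unfolding V_def by (rule measure_box_pos[OF ab])
  have "((\<lambda>x. g x - v) has_integral integral (cbox a b) g - V *\<^sub>R v) (cbox a b)"
    unfolding V_def by (intro has_integral_diff integrable_integral int has_integral_const)
  from has_integral_bound[OF \<open>e \<ge> 0\<close> this] close
  have "norm (integral (cbox a b) g - V *\<^sub>R v) \<le> e * V"
    by (simp add: V_def)
  moreover have "integral (cbox a b) g - V *\<^sub>R v = V *\<^sub>R (box_avg a b g - v)"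
    using V by (simp add: box_avg_def V_def[symmetric] scaleR_diff_right)
  ultimately have "V * norm (box_avg a b g - v) \<le> V * e"
    using V by (simp add: mult.commute)
  then show ?thesis using V by simp
qed

text \<open>At an interior maximum point \<open>z\<close> of \<open>norm (f x - c)\<close>, the
  image of the open box would contain a ball around \<open>f z\<close>, hence a value still farther
  from \<open>c\<close>.\<close>

lemma open_map_max_principle:
  fixes f :: "real ^ 'n \<Rightarrow> real ^ 'm"
  assumes U: "open U" "cbox a b \<subseteq> U" and cont: "continuous_on U f" and om: "open_map (top_of_set U) euclidean f"
    and bd: "\<And>x. x \<in> cbox a b \<Longrightarrow> x \<notin> box a b \<Longrightarrow> norm (f x - c) \<le> e"
    and x: "x \<in> cbox a b"
  shows "norm (f x - c) \<le> e"
proof -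
  have "continuous_on (cbox a b) (\<lambda>x. norm (f x - c))"
    using cont U by (intro continuous_intros continuous_on_subset[OF cont]) auto
  then obtain z where z: "z \<in> cbox a b" "\<And>w. w \<in> cbox a b \<Longrightarrow> norm (f w - c) \<le> norm (f z - c)"
    using continuous_attains_sup[of "cbox a b" "\<lambda>x. norm (f x - c)"] x by (metis compact_cbox empty_iff)
  have "z \<notin> box a b"
  proof
    assume zb: "z \<in> box a b"
    have sub: "box a b \<subseteq> U" using U(2) box_subset_cbox by blast
    then have "openin (top_of_set U) (box a b)" using U(1) by (simp add: openin_open_eq open_box)
    then have "open (f ` box a b)"
      using om by (auto simp: open_map_def)
    then obtain d where d: "d > 0" "ball (f z) d \<subseteq> f ` box a b"
      using zb open_contains_ball by blast
    define n where "n = norm (f z - c)"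
    \<comment> \<open>The unit direction pointing away from \<open>c\<close>; when
      \<open>f z = c\<close> any unit vector will do.\<close>
    define u where "u = (if n = 0 then axis undefined 1 else (f z - c) /\<^sub>R n)"
    have u: "norm u = 1" "f z - c = n *\<^sub>R u"
      by (auto simp: u_def n_def)
    have "f z + (d / 2) *\<^sub>R u \<in> ball (f z) d"
      using d(1) u by (simp add: dist_norm)
    then obtain w where w: "w \<in> box a b" "f w = f z + (d / 2) *\<^sub>R u"
      using d(2) by (metis imageE subsetD)
    have "f w - c = (n + d / 2) *\<^sub>R u"
      using u(2) unfolding w(2) by (simp add: scaleR_left_distrib algebra_simps)
    then have "norm (f w - c) = n + d / 2"
      using u(1) d(1) by (simp add: n_def)
    moreover have "norm (f w - c) \<le> n"
      unfolding n_def using w(1) box_subset_cbox by (intro z(2)) blast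
    ultimately show False using d(1) by simp
  qed
  then show ?thesis using bd z x by (meson order_trans)
qed

text \<open>The condition on \<open>r\<close> inherited from \<open>calderon\<close> becomes
  \<open>1 \<le> CARD('n) - 2\<close>; this encodes dimension at least \<open>3\<close> and makes
  the truncated subtraction harmless.\<close>

locale orlicz_sobolev_map = sobolev_map U f D + calderon \<phi> "CARD('n) - 2"
  for U :: "(real ^ 'n) set" and f :: "real ^ 'n \<Rightarrow> real ^ 'm" and D and \<phi> +
  assumes open_domain: "open U"
    and continuous_map: "continuous_on U f"
    and energy_integrable: "(\<lambda>x. \<phi> (norm (D x))) locally_integrable_on U"
begin

definition energy :: "real ^ 'n \<Rightarrow> real ^ 'n \<Rightarrow> real" where
  "energy a b = box_avg a b (\<lambda>x. \<phi> (norm (D x)))"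

definition level_total :: real where
  "level_total = (\<Sum>m. level m / 2 ^ m)"

definition K :: real where
  "K = chain_const (UNIV :: 'n set)"

lemma K_nonneg: "K \<ge> 0"
  by (simp add: K_def chain_const_def)

lemma chain_const_le: "chain_const (I :: 'n set) \<le> K"
  unfolding K_def chain_const_def of_nat_mult of_nat_power
  by (intro mult_mono power_increasing) (auto intro: card_mono)

lemma level_total_nonneg: "level_total \<ge> 0"
  unfolding level_total_def by (intro suminf_nonneg summable_level) (simp add: level_nonneg)

lemma sum_level_le: "(\<Sum>m<M. level m / 2 ^ m) \<le> level_total"
  unfolding level_total_def by (intro sum_le_suminf summable_level) (auto simp: level_nonneg)

lemma integrable_energy: "cbox a b \<subseteq> U \<Longrightarrow> (\<lambda>x. \<phi> (norm (D x))) integrable_on cbox a b"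
  using energy_integrable by (auto simp: locally_integrable_on_def absolutely_integrable_on_def)

text \<open>The volume drops by \<open>2 ^ m * R\<close>, and dividing by \<open>2 ^ m\<close>
  leaves the weight \<open>R\<close>. The norm is estimated by \<open>level m\<close> plus its
  excess; the excess, being nonnegative, is then integrated over the whole slab. The thickness in
  direction \<open>l\<close> cancels.\<close>

lemma scaled_avg_gradient_le:
  assumes sub: "cbox a b \<subseteq> U" and ab: "\<And>j. a $ j < b $ j"
    and sub': "cbox a' b' \<subseteq> cbox a b"
    and sides: "\<And>j. b' $ j - a' $ j = (if j \<in> - {l} then (b $ j - a $ j) / 2 ^ m else b $ j - a $ j)"
  shows "box_avg a' b' (\<lambda>x. norm (D x)) / 2 ^ m \<le> level m / 2 ^ m +
    box_avg a b (\<lambda>x. 2 ^ (m * (CARD('n) - 2)) * max (norm (D x) - level m) 0)"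
proof -
  define V where "V = measure lborel (cbox a b)"
  have V: "V > 0" unfolding V_def by (rule measure_box_pos[OF ab])
  let ?g = "\<lambda>x. max (norm (D x) - level m) 0"
  have D_int: "(\<lambda>x. norm (D x)) absolutely_integrable_on cbox a b"
    using integrable_gradient[OF sub] by (rule absolutely_integrable_norm[unfolded o_def])
  have "(\<lambda>x. norm (D x) - level m) absolutely_integrable_on cbox a b"
    by (intro set_integral_diff D_int absolutely_integrable_on_const) auto
  then have "?g absolutely_integrable_on cbox a b"
    by (intro absolutely_integrable_max_1 absolutely_integrable_on_const) auto
  then have g_int: "?g integrable_on cbox a b"
    by (simp add: absolutely_integrable_on_def)
  have card: "card (- {l}) = Suc (CARD('n) - 2)"
    using r by (simp add: Compl_eq_Diff_UNIV)
  define R where "R = (2::real) ^ (m * (CARD('n) - 2))"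
  have V': "measure lborel (cbox a' b') = V / (2 ^ m * R)"
    using measure_box_halved[OF ab sides] by (simp add: card V_def R_def power_add)
  have "integral (cbox a' b') (\<lambda>x. norm (D x)) \<le> integral (cbox a' b') (\<lambda>x. level m + ?g x)"
    using D_int g_int sub'
    by (intro integral_le integrable_add integrable_const)
       (auto simp: absolutely_integrable_on_def intro: integrable_on_subcbox)
  also have "\<dots> = measure lborel (cbox a' b') * level m + integral (cbox a' b') ?g"
    using integrable_on_subcbox[OF g_int sub'] by (subst integral_add) (auto intro: integrable_const)
  also have "integral (cbox a' b') ?g \<le> integral (cbox a b) ?g"
    using g_int sub' by (intro integral_subset_le) (auto intro: integrable_on_subcbox)
  finally have "integral (cbox a' b') (\<lambda>x. norm (D x)) / (V / R)
      \<le> (V / (2 ^ m * R) * level m + integral (cbox a b) ?g) / (V / R)"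
    using V unfolding V' by (intro divide_right_mono) (auto simp: R_def)
  moreover have "box_avg a' b' (\<lambda>x. norm (D x)) / 2 ^ m = integral (cbox a' b') (\<lambda>x. norm (D x)) / (V / R)"
    unfolding box_avg_def V' using V by (simp add: R_def field_simps)
  moreover have "box_avg a b (\<lambda>x. R * ?g x) = integral (cbox a b) ?g / (V / R)"
    by (simp add: box_avg_def V_def field_simps)
  moreover have "(V / (2 ^ m * R) * level m + integral (cbox a b) ?g) / (V / R)
      = level m / 2 ^ m + integral (cbox a b) ?g / (V / R)"
    using V by (simp add: R_def field_simps)
  ultimately show ?thesis by (simp add: R_def)
qed

text \<open>At scale \<open>m\<close> the gradient is split at height \<open>level m\<close>. The parts below sum to
  \<open>level_total\<close>; for the parts above, the number of scales that contribute at a given point is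
  controlled by \<open>\<phi>\<close>, so that no convexity of \<open>\<phi>\<close> is needed.\<close>

lemma sum_scaled_avg_gradient_le:
  assumes sub: "cbox a b \<subseteq> U" and ab: "\<And>j. a $ j < b $ j"
    and sub': "\<And>m. cbox (A m) (B m) \<subseteq> cbox a b"
    and sides: "\<And>m j. B m $ j - A m $ j = (if j \<in> - {l} then (b $ j - a $ j) / 2 ^ m else b $ j - a $ j)"
  shows "(\<Sum>m<M. box_avg (A m) (B m) (\<lambda>x. norm (D x)) / 2 ^ m) \<le> level_total + 2 * energy a b"
proof -
  let ?g = "\<lambda>m x. 2 ^ (m * (CARD('n) - 2)) * max (norm (D x) - level m) 0"
  have int: "?g m integrable_on cbox a b" for m
  proof -
    have "(\<lambda>x. norm (D x)) absolutely_integrable_on cbox a b"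
      using integrable_gradient[OF sub] by (rule absolutely_integrable_norm[unfolded o_def])
    then have "(\<lambda>x. norm (D x) - level m) absolutely_integrable_on cbox a b"
      by (intro set_integral_diff absolutely_integrable_on_const) auto
    then have "(\<lambda>x. max (norm (D x) - level m) 0) absolutely_integrable_on cbox a b"
      by (intro absolutely_integrable_max_1 absolutely_integrable_on_const) auto
    then show ?thesis
      unfolding absolutely_integrable_on_def by (intro integrable_on_mult_right) auto
  qed
  have "(\<Sum>m<M. box_avg (A m) (B m) (\<lambda>x. norm (D x)) / 2 ^ m)
      \<le> (\<Sum>m<M. level m / 2 ^ m + box_avg a b (?g m))"
    using scaled_avg_gradient_le[OF sub ab sub' sides] by (intro sum_mono) auto
  also have "\<dots> = (\<Sum>m<M. level m / 2 ^ m) + box_avg a b (\<lambda>x. \<Sum>m<M. ?g m x)"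
    using int by (simp add: sum.distrib box_avg_def integral_sum sum_distrib_left)
  also have "box_avg a b (\<lambda>x. \<Sum>m<M. ?g m x) \<le> box_avg a b (\<lambda>x. 2 * \<phi> (norm (D x)))"
  proof -
    have "integral (cbox a b) (\<lambda>x. \<Sum>m<M. ?g m x) \<le> integral (cbox a b) (\<lambda>x. 2 * \<phi> (norm (D x)))"
      using int integrable_energy[OF sub] weighted_levels_le
      by (intro integral_le integrable_sum integrable_on_mult_right) auto
    then show ?thesis
      unfolding box_avg_def real_scaleR_def by (rule mult_left_mono) simp
  qed
  also have "box_avg a b (\<lambda>x. 2 * \<phi> (norm (D x))) = 2 * energy a b"
    by (simp add: energy_def box_avg_def)
  finally show ?thesis using sum_level_le[of M] by linarith
qed

text \<open>The chain is telescoped with \<open>C = 0\<close>, for which \<open>deviation\<close> is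
  the plain average. The bound depends neither on \<open>M\<close> nor on the thickness in direction
  \<open>l\<close>, so both can be chosen later.\<close>

lemma slab_average:
  assumes sub: "cbox a b \<subseteq> U" and ab: "\<And>j. a $ j < b $ j" and x: "x \<in> cbox a b"
    and L: "\<forall>j\<in>- {l}. b $ j - a $ j \<le> L" "0 \<le> L"
  shows "\<exists>a' b'. x \<in> cbox a' b' \<and> cbox a' b' \<subseteq> cbox a b \<and>
    (\<forall>j. b' $ j - a' $ j = (if j \<in> - {l} then (b $ j - a $ j) / 2 ^ M else b $ j - a $ j)) \<and>
    norm (box_avg a' b' f - box_avg a b f) \<le> K * L * (level_total + 2 * energy a b)"
proof -
  from dyadic_chain[OF sub ab x, of "- {l}" L 0, OF L]
  obtain A B where AB: "A 0 = a" "B 0 = b" and chain: "\<forall>m. x \<in> cbox (A m) (B m) \<and> cbox (A m) (B m) \<subseteq> cbox a b \<and>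
    (\<forall>j. B m $ j - A m $ j = (if j \<in> - {l} then (b $ j - a $ j) / 2 ^ m else b $ j - a $ j)) \<and>
    norm (deviation 0 (A (Suc m)) (B (Suc m)) - deviation 0 (A m) (B m))
      \<le> chain_const (- {l}) * (L / 2 ^ m) * box_avg (A m) (B m) (\<lambda>y. norm (D y - 0))"
    by (elim exE conjE)
  have mem: "x \<in> cbox (A m) (B m)" and sub': "cbox (A m) (B m) \<subseteq> cbox a b"
    and sides: "B m $ j - A m $ j = (if j \<in> - {l} then (b $ j - a $ j) / 2 ^ m else b $ j - a $ j)"
    and step: "norm (deviation 0 (A (Suc m)) (B (Suc m)) - deviation 0 (A m) (B m))
      \<le> chain_const (- {l}) * (L / 2 ^ m) * box_avg (A m) (B m) (\<lambda>y. norm (D y - 0))" for m j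
    using chain[rule_format, of m] by simp_all
  have dev: "deviation 0 p q = box_avg p q f" for p q
    by (simp add: deviation_def)
  have "norm (box_avg (A M) (B M) f - box_avg a b f)
      = norm (\<Sum>m<M. box_avg (A (Suc m)) (B (Suc m)) f - box_avg (A m) (B m) f)"
    by (subst sum_lessThan_telescope) (simp add: AB)
  also have "\<dots> \<le> (\<Sum>m<M. K * L * (box_avg (A m) (B m) (\<lambda>y. norm (D y)) / 2 ^ m))"
  proof (rule sum_norm_le)
    fix m
    have "norm (box_avg (A (Suc m)) (B (Suc m)) f - box_avg (A m) (B m) f)
        \<le> chain_const (- {l}) * (L * (box_avg (A m) (B m) (\<lambda>y. norm (D y)) / 2 ^ m))"
      using step[of m] by (simp add: dev)
    also have "\<dots> \<le> K * (L * (box_avg (A m) (B m) (\<lambda>y. norm (D y)) / 2 ^ m))"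
      using L(2) by (intro mult_right_mono chain_const_le mult_nonneg_nonneg divide_nonneg_nonneg box_avg_nonneg) auto
    finally show "norm (box_avg (A (Suc m)) (B (Suc m)) f - box_avg (A m) (B m) f)
        \<le> K * L * (box_avg (A m) (B m) (\<lambda>y. norm (D y)) / 2 ^ m)" by (simp add: mult.assoc)
  qed
  also have "\<dots> = K * L * (\<Sum>m<M. box_avg (A m) (B m) (\<lambda>y. norm (D y)) / 2 ^ m)"
    by (simp add: sum_distrib_left)
  also have "\<dots> \<le> K * L * (level_total + 2 * energy a b)"
    using sum_scaled_avg_gradient_le[OF sub ab sub' sides, of M] K_nonneg L(2) by (intro mult_left_mono) auto
  finally show ?thesis using mem[of M] sub'[of M] sides[of M] by blast
qed

end

section \<open>Oscillation on cubes\<close>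

context orlicz_sobolev_map
begin

text \<open>Twice a bound for the distance of \<open>f\<close> from its average over the slab. The
  first \<open>s\<close> is the error from uniform continuity, \<open>4 * s\<close> is the side of
  the cube, and \<open>8\<close> is the \<open>2\<close> of the energy estimate times the volume
  ratio \<open>4\<close> of the cube to a band of width \<open>s\<close>.\<close>

definition face_bound :: "real ^ 'n \<Rightarrow> real \<Rightarrow> real" where
  "face_bound y s = 2 * (s + K * (4 * s) * (level_total + 8 * energy (y - vec (2 * s)) (y + vec (2 * s))))"

text \<open>Within the band between \<open>p\<close> and \<open>p + s\<close> a thin slab is found
  with no larger average energy, and \<open>slab_average\<close> applies around each of its points.
  The plane at its lower face is a full cross section of the cube on which \<open>f\<close> varies
  little.\<close>

lemma quiet_face:
  assumes s: "s > 0" and sub: "cbox (y - vec (2 * s)) (y + vec (2 * s)) \<subseteq> U"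
    and pos: "y $ l - 2 * s \<le> p" "p + s \<le> y $ l + 2 * s"
  shows "\<exists>q. p \<le> q \<and> q \<le> p + s \<and>
    (\<forall>x\<in>cbox (y - vec (2 * s)) (y + vec (2 * s)). \<forall>x'\<in>cbox (y - vec (2 * s)) (y + vec (2 * s)).
      x $ l = q \<longrightarrow> x' $ l = q \<longrightarrow> norm (f x - f x') \<le> face_bound y s)"
proof -
  define P where "P = cbox (y - vec (2 * s)) (y + vec (2 * s))"
  define E where "E = energy (y - vec (2 * s)) (y + vec (2 * s))"
  define a :: "real ^ 'n" where "a = (\<chi> j. if j = l then p else y $ j - 2 * s)"
  define b :: "real ^ 'n" where "b = (\<chi> j. if j = l then p + s else y $ j + 2 * s)"
  have a: "a $ j = (if j = l then p else y $ j - 2 * s)" and b: "b $ j = (if j = l then p + s else y $ j + 2 * s)" for j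
    by (simp_all add: a_def b_def)
  have ab: "a $ j < b $ j" for j using s by (simp add: a b)
  have y_lt: "(y - vec (2 * s)) $ j < (y + vec (2 * s)) $ j" for j using s by simp
  have T_sub: "cbox a b \<subseteq> P"
    unfolding P_def using pos by (intro cbox_subset_cart) (auto simp: a b)
  have T_U: "cbox a b \<subseteq> U" using T_sub sub unfolding P_def by blast
  have "measure lborel (cbox a b) = measure lborel P / 2 ^ (2 * card {l})"
    unfolding P_def by (rule measure_box_halved[OF y_lt]) (auto simp: a b)
  then have E_T: "energy a b \<le> 4 * E"
    unfolding energy_def E_def using integrable_energy[OF sub] T_sub y_lt
    by (intro box_avg_mono_box) (auto simp: nonneg P_def)
  have "uniformly_continuous_on P f"
    unfolding P_def using continuous_on_subset[OF continuous_map sub] by (intro compact_uniformly_continuous) auto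
  then obtain \<delta> where \<delta>: "\<delta> > 0" "\<And>x x'. x \<in> P \<Longrightarrow> x' \<in> P \<Longrightarrow> dist x' x < \<delta> \<Longrightarrow> dist (f x') (f x) < s"
    using s unfolding uniformly_continuous_on_def by blast
  \<comment> \<open>The same \<open>M\<close> thins the slab and counts the halvings along it, so
    the final boxes have all sides at most \<open>4 * s / 2 ^ M\<close>, and \<open>f\<close> varies
    on them by less than \<open>s\<close>.\<close>
  obtain M where M: "(1/2) ^ M < \<delta> / (real CARD('n) * (4 * s))"
    using real_arch_pow_inv[of "\<delta> / (real CARD('n) * (4 * s))" "1/2"] \<delta>(1) s by auto
  have fine: "real CARD('n) * (4 * s / 2 ^ M) < \<delta>"
    using M s by (simp add: field_simps power_one_over)
  obtain a' b' where T': "cbox a' b' \<subseteq> cbox a b" "\<And>j. j \<noteq> l \<Longrightarrow> a' $ j = a $ j \<and> b' $ j = b $ j"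
    "a' $ l < b' $ l" "b' $ l - a' $ l = (b $ l - a $ l) / 2 ^ M" "energy a' b' \<le> energy a b"
    using thin_slab[OF integrable_energy[OF T_U] ab, of l M] unfolding energy_def by blast
  have ab': "a' $ j < b' $ j" for j
    using T'(2)[of j] T'(3) ab[of j] by (cases "j = l") auto
  have T'_U: "cbox a' b' \<subseteq> U" using T'(1) T_U by blast
  have close: "norm (f x - box_avg a' b' f) \<le> s + K * (4 * s) * (level_total + 8 * E)" if x: "x \<in> cbox a' b'" for x
  proof -
    have L: "\<forall>j\<in>- {l}. b' $ j - a' $ j \<le> 4 * s" "0 \<le> 4 * s"
      using T'(2) s by (simp_all add: a b)
    obtain a1 b1 where B: "x \<in> cbox a1 b1" "cbox a1 b1 \<subseteq> cbox a' b'"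
      "\<forall>j. b1 $ j - a1 $ j = (if j \<in> - {l} then (b' $ j - a' $ j) / 2 ^ M else b' $ j - a' $ j)"
      "norm (box_avg a1 b1 f - box_avg a' b' f) \<le> K * (4 * s) * (level_total + 2 * energy a' b')"
      using slab_average[OF T'_U ab' x L, where M = M] by blast
    have side: "0 < b1 $ j - a1 $ j \<and> b1 $ j - a1 $ j \<le> 4 * s / 2 ^ M" for j
    proof (cases "j = l")
      case True
      then have "b1 $ j - a1 $ j = s / 2 ^ M" using B(3) T'(4) by (simp add: a b)
      then show ?thesis using s by (simp add: divide_right_mono)
    next
      case False
      then have "b1 $ j - a1 $ j = 4 * s / 2 ^ M" using B(3) T'(2)[of j] by (simp add: a b)
      then show ?thesis using s by simp
    qed
    have "norm (f z - f x) \<le> s" if z: "z \<in> cbox a1 b1" for z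
    proof -
      have "norm (z - x) \<le> real CARD('n) * (4 * s / 2 ^ M)"
        using side by (intro norm_diff_in_box[OF B(1) z]) blast
      also have "\<dots> < \<delta>" by (rule fine)
      finally have "dist (f z) (f x) < s"
        using z B(1,2) T'(1) T_sub by (intro \<delta>(2)) (auto simp: dist_norm)
      then show ?thesis by (simp add: dist_norm)
    qed
    then have "norm (box_avg a1 b1 f - f x) \<le> s"
      using integrable_map[of a1 b1] B(2) T'_U side s
      by (intro box_avg_close) (auto simp: absolutely_integrable_on_def)
    moreover have "K * (4 * s) * (level_total + 2 * energy a' b') \<le> K * (4 * s) * (level_total + 8 * E)"
      using K_nonneg s T'(5) E_T by (intro mult_left_mono) auto
    moreover have "norm (f x - box_avg a' b' f) \<le> norm (box_avg a1 b1 f - f x) + norm (box_avg a1 b1 f - box_avg a' b' f)"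
      using norm_triangle_ineq[of "f x - box_avg a1 b1 f" "box_avg a1 b1 f - box_avg a' b' f"]
      by (simp add: norm_minus_commute)
    ultimately show ?thesis using B(4) by linarith
  qed
  have "a' \<in> cbox a' b'" using ab' by (simp add: mem_box_cart less_imp_le)
  then have a'_in: "a' \<in> cbox a b" using T'(1) by blast
  show ?thesis
  proof (intro exI[of _ "a' $ l"] conjI ballI impI)
    show "p \<le> a' $ l" "a' $ l \<le> p + s"
      using a'_in by (auto simp: mem_box_cart a b dest!: spec[of _ l])
    fix x x' assume x: "x \<in> cbox (y - vec (2 * s)) (y + vec (2 * s))" "x $ l = a' $ l"
      and x': "x' \<in> cbox (y - vec (2 * s)) (y + vec (2 * s))" "x' $ l = a' $ l"
    have slab: "z \<in> cbox a' b'" if z: "z \<in> cbox (y - vec (2 * s)) (y + vec (2 * s))" "z $ l = a' $ l" for z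
      unfolding mem_box_cart
    proof
      fix j
      show "a' $ j \<le> z $ j \<and> z $ j \<le> b' $ j"
        using z T'(2)[of j] T'(3) by (cases "j = l") (auto simp: mem_box_cart a b)
    qed
    have "norm (f x - f x') \<le> norm (f x - box_avg a' b' f) + norm (f x' - box_avg a' b' f)"
      using norm_triangle_ineq4[of "f x - box_avg a' b' f" "f x' - box_avg a' b' f"] by simp
    also have "\<dots> \<le> face_bound y s"
      using close[OF slab[OF x]] close[OF slab[OF x']] by (simp add: face_bound_def E_def)
    finally show "norm (f x - f x') \<le> face_bound y s" .
  qed
qed

text \<open>Quiet planes on both sides of the inner cube, in each direction, bound a box between the
  two cubes. Its faces intersect, so \<open>f\<close> on the whole boundary is within
  \<open>2 * face_bound y s\<close> of its value at the corner \<open>b\<close>, and the maximum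
  principle carries this inside. Comparing two points doubles it again.\<close>

lemma oscillation_bound:
  assumes s: "s > 0" and sub: "cbox (y - vec (2 * s)) (y + vec (2 * s)) \<subseteq> U"
    and om: "open_map (top_of_set U) euclidean f"
    and x: "x \<in> cbox (y - vec s) (y + vec s)" and x': "x' \<in> cbox (y - vec s) (y + vec s)"
  shows "norm (f x - f x') \<le> 4 * face_bound y s"
proof -
  define P where "P = cbox (y - vec (2 * s)) (y + vec (2 * s))"
  have "\<forall>l. \<exists>q. y $ l - 2 * s \<le> q \<and> q \<le> y $ l - s \<and>
    (\<forall>x\<in>P. \<forall>x'\<in>P. x $ l = q \<longrightarrow> x' $ l = q \<longrightarrow> norm (f x - f x') \<le> face_bound y s)"
  proof
    fix l
    show "\<exists>q. y $ l - 2 * s \<le> q \<and> q \<le> y $ l - s \<and>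
      (\<forall>x\<in>P. \<forall>x'\<in>P. x $ l = q \<longrightarrow> x' $ l = q \<longrightarrow> norm (f x - f x') \<le> face_bound y s)"
      using quiet_face[OF s sub, of l "y $ l - 2 * s"] s unfolding P_def by simp
  qed
  from choice[OF this] obtain lo where lo: "\<And>l. y $ l - 2 * s \<le> lo l" "\<And>l. lo l \<le> y $ l - s"
    "\<And>l x x'. x \<in> P \<Longrightarrow> x' \<in> P \<Longrightarrow> x $ l = lo l \<Longrightarrow> x' $ l = lo l \<Longrightarrow> norm (f x - f x') \<le> face_bound y s"
    by blast
  have "\<forall>l. \<exists>q. y $ l + s \<le> q \<and> q \<le> y $ l + 2 * s \<and>
    (\<forall>x\<in>P. \<forall>x'\<in>P. x $ l = q \<longrightarrow> x' $ l = q \<longrightarrow> norm (f x - f x') \<le> face_bound y s)"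
  proof
    fix l
    show "\<exists>q. y $ l + s \<le> q \<and> q \<le> y $ l + 2 * s \<and>
      (\<forall>x\<in>P. \<forall>x'\<in>P. x $ l = q \<longrightarrow> x' $ l = q \<longrightarrow> norm (f x - f x') \<le> face_bound y s)"
    proof -
      have "y $ l - 2 * s \<le> y $ l + s" "y $ l + s + s \<le> y $ l + 2 * s" using s by auto
      from quiet_face[OF s sub this] show ?thesis
        unfolding P_def by (simp only: add.assoc mult_2)
    qed
  qed
  from choice[OF this] obtain hi where hi: "\<And>l. y $ l + s \<le> hi l" "\<And>l. hi l \<le> y $ l + 2 * s"
    "\<And>l x x'. x \<in> P \<Longrightarrow> x' \<in> P \<Longrightarrow> x $ l = hi l \<Longrightarrow> x' $ l = hi l \<Longrightarrow> norm (f x - f x') \<le> face_bound y s"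
    by blast
  define a :: "real ^ 'n" where "a = (\<chi> l. lo l)"
  define b :: "real ^ 'n" where "b = (\<chi> l. hi l)"
  have lo_le_hi: "lo l \<le> hi l" for l
    using lo(2)[of l] hi(1)[of l] s by simp
  have box_sub: "cbox a b \<subseteq> P"
    unfolding P_def using lo(1) hi(2) by (intro cbox_subset_cart) (auto simp: a_def b_def)
  have cube_sub: "cbox (y - vec s) (y + vec s) \<subseteq> cbox a b"
    using lo(2) hi(1) by (intro cbox_subset_cart) (auto simp: a_def b_def)
  have b_in: "b \<in> P" using box_sub lo_le_hi by (auto simp: mem_box_cart a_def b_def)
  have E: "face_bound y s \<ge> 0"
    using hi(3)[OF b_in b_in] by (simp add: b_def)
  have bdry: "norm (f z - f b) \<le> 2 * face_bound y s" if z: "z \<in> cbox a b" "z \<notin> box a b" for z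
  proof -
    obtain l where "\<not> (a $ l < z $ l \<and> z $ l < b $ l)"
      using z(2) by (auto simp: mem_box_cart)
    moreover have "a $ l \<le> z $ l \<and> z $ l \<le> b $ l"
      using z(1) by (simp add: mem_box_cart)
    ultimately have "z $ l = lo l \<or> z $ l = hi l"
      by (auto simp: a_def b_def)
    then show ?thesis
    proof
      assume "z $ l = hi l"
      then have "norm (f z - f b) \<le> face_bound y s"
        using z(1) box_sub b_in by (intro hi(3)[of _ _ l]) (auto simp: b_def)
      then show ?thesis using E by linarith
    next
      assume zl: "z $ l = lo l"
      have "\<exists>j. j \<noteq> l"
      proof (rule ccontr)
        assume "\<not> (\<exists>j. j \<noteq> l)"
        then have "(UNIV :: 'n set) = {l}" by auto
        then have "CARD('n) = 1" by (metis card_1_singleton_iff One_nat_def)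
        then show False using r by simp
      qed
      then obtain j where j: "j \<noteq> l" by blast
      \<comment> \<open>A corner on the lower face in direction \<open>l\<close> and on an upper
        face in another direction \<open>j\<close>; it links the lower face to
        \<open>b\<close>.\<close>
      define c :: "real ^ 'n" where "c = (\<chi> i. if i = l then lo l else hi i)"
      have "c \<in> cbox a b" using lo_le_hi by (simp add: mem_box_cart a_def b_def c_def)
      then have c_in: "c \<in> P" using box_sub by blast
      have "norm (f z - f c) \<le> face_bound y s"
        using z(1) box_sub c_in zl by (intro lo(3)[of _ _ l]) (auto simp: c_def)
      moreover have "norm (f c - f b) \<le> face_bound y s"
        using b_in c_in j by (intro hi(3)[of _ _ j]) (auto simp: c_def b_def)
      moreover have "norm (f z - f b) \<le> norm (f z - f c) + norm (f c - f b)"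
        using norm_triangle_ineq[of "f z - f c" "f c - f b"] by simp
      ultimately show ?thesis by linarith
    qed
  qed
  have box_U: "cbox a b \<subseteq> U" using box_sub sub unfolding P_def by blast
  have "norm (f w - f b) \<le> 2 * face_bound y s" if "w \<in> cbox (y - vec s) (y + vec s)" for w
    using open_map_max_principle[OF open_domain box_U continuous_map om bdry] that cube_sub by blast
  from this[OF x] this[OF x'] show ?thesis
    using norm_triangle_ineq4[of "f x - f b" "f x' - f b"] by simp
qed

end

section \<open>Lebesgue points\<close>

text \<open>A cube with a corner at \<open>x\<close>, extending into the orthant with signs
  \<open>\<sigma>\<close>; \<open>min\<close> and \<open>max\<close> put the endpoints in
  order.\<close>

definition orthant_cube :: "('n \<Rightarrow> real) \<Rightarrow> real ^ 'n \<Rightarrow> real \<Rightarrow> (real ^ 'n) set" where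
  "orthant_cube \<sigma> x h = cbox (\<chi> i. min (x $ i) (x $ i + \<sigma> i * h)) (\<chi> i. max (x $ i) (x $ i + \<sigma> i * h))"

text \<open>The coordinate reflection \<open>R\<close> preserves integrals and negligible sets and
  is its own inverse. It reduces the claim to cubes whose lower corner is the point, for which
  \<open>integrable_ccontinuous_explicit\<close> applies.\<close>

lemma orthant_Lebesgue_differentiation:
  fixes F :: "real ^ 'n \<Rightarrow> real"
  assumes F: "\<And>a b. F integrable_on cbox a b" and \<sigma>: "\<And>i. \<sigma> i = 1 \<or> \<sigma> i = -1"
  shows "\<exists>N. negligible N \<and> (\<forall>x e. x \<notin> N \<longrightarrow> e > 0 \<longrightarrow>
    (\<exists>d>0. \<forall>h. 0 < h \<and> h < d \<longrightarrow> \<bar>integral (orthant_cube \<sigma> x h) F / h ^ CARD('n) - F x\<bar> < e))"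
proof -
  define R :: "real ^ 'n \<Rightarrow> real ^ 'n" where "R x = (\<chi> k. \<sigma> k * x $ k)" for x
  have sq: "\<sigma> k * (\<sigma> k * t) = t" for k t
    using \<sigma>[of k] by auto
  have R_R: "R (R x) = x" for x
    by (simp add: R_def vec_eq_iff sq)
  have R_div: "(\<chi> k. x $ k / \<sigma> k) = R x" for x
  proof -
    have "x $ k / \<sigma> k = \<sigma> k * x $ k" for k using \<sigma>[of k] by auto
    then show ?thesis by (simp add: R_def)
  qed
  have prod_\<sigma>: "\<bar>prod \<sigma> UNIV\<bar> = 1"
  proof -
    have "\<bar>\<sigma> i\<bar> = 1" for i using \<sigma>[of i] by auto
    then show ?thesis by (simp add: abs_prod)
  qed
  have R_image: "R ` cbox a b = cbox (\<chi> k. min (\<sigma> k * a $ k) (\<sigma> k * b $ k)) (\<chi> k. max (\<sigma> k * a $ k) (\<sigma> k * b $ k))"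
    if "cbox a b \<noteq> {}" for a b
    using that unfolding R_def by (subst image_stretch_interval_cart) simp
  have R_integral: "((F \<circ> R) has_integral i) (R ` cbox a b)" if "(F has_integral i) (cbox a b)" for i a b
  proof -
    have "\<sigma> k \<noteq> 0" for k using \<sigma>[of k] by auto
    from has_integral_stretch_cart[where m = \<sigma>, OF that this] show ?thesis
      unfolding R_div by (simp add: prod_\<sigma> o_def R_def)
  qed
  have "(F \<circ> R) integrable_on cbox a b" for a b
  proof (cases "cbox a b = {}")
    case False
    obtain a' b' where "R ` cbox a b = cbox a' b'" using R_image[OF False] by blast
    moreover have "R ` R ` cbox a b = cbox a b" by (simp add: image_image R_R)
    ultimately show ?thesis
      using R_integral[OF integrable_integral[OF F[of a' b']]] by (auto simp: integrable_on_def)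
  qed (simp add: integrable_on_empty)
  from integrable_ccontinuous_explicit[OF this] obtain N where N: "negligible N"
    "\<And>x e. x \<notin> N \<Longrightarrow> 0 < e \<Longrightarrow> \<exists>d>0. \<forall>h. 0 < h \<and> h < d \<longrightarrow>
      norm (integral (cbox x (x + h *\<^sub>R One)) (F \<circ> R) /\<^sub>R h ^ DIM(real ^ 'n) - (F \<circ> R) x) < e"
    by blast
  have "linear R"
    unfolding R_def by (intro linearI) (simp_all add: vec_eq_iff algebra_simps)
  have "negligible (R ` N)"
    using N(1) \<open>linear R\<close>
    by (intro negligible_differentiable_image_negligible linear_imp_differentiable_on) auto
  moreover have "\<exists>d>0. \<forall>h. 0 < h \<and> h < d \<longrightarrow> \<bar>integral (orthant_cube \<sigma> x h) F / h ^ CARD('n) - F x\<bar> < e"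
    if "x \<notin> R ` N" "e > 0" for x e
  proof -
    have "R x \<notin> N" using that(1) R_R by (metis image_eqI)
    from N(2)[OF this that(2)] obtain d where d: "d > 0" "\<And>h. 0 < h \<Longrightarrow> h < d \<Longrightarrow>
      norm (integral (cbox (R x) (R x + h *\<^sub>R One)) (F \<circ> R) /\<^sub>R h ^ DIM(real ^ 'n) - (F \<circ> R) (R x)) < e"
      by blast
    have One_nth: "(One :: real ^ 'n) $ k = 1" for k
    proof -
      have "(One :: real ^ 'n) \<bullet> axis k 1 = 1" by (simp add: axis_in_Basis_iff)
      then show ?thesis by (simp add: inner_axis)
    qed
    have "integral (orthant_cube \<sigma> x h) F = integral (cbox (R x) (R x + h *\<^sub>R One)) (F \<circ> R)" if "h > 0" for h
    proof -
      have eq: "R ` orthant_cube \<sigma> x h = cbox (R x) (R x + h *\<^sub>R One)"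
        unfolding orthant_cube_def
      proof (subst R_image)
        show "cbox (\<chi> i. min (x $ i) (x $ i + \<sigma> i * h)) (\<chi> i. max (x $ i) (x $ i + \<sigma> i * h)) \<noteq> {}"
          by (simp add: interval_ne_empty_cart min_def max_def)
        have "min (\<sigma> k * min (x $ k) (x $ k + \<sigma> k * h)) (\<sigma> k * max (x $ k) (x $ k + \<sigma> k * h)) = \<sigma> k * x $ k
          \<and> max (\<sigma> k * min (x $ k) (x $ k + \<sigma> k * h)) (\<sigma> k * max (x $ k) (x $ k + \<sigma> k * h)) = \<sigma> k * x $ k + h" for k
          using \<sigma>[of k] that by (auto simp: min_def max_def)
        then show "cbox (\<chi> k. min (\<sigma> k * (\<chi> i. min (x $ i) (x $ i + \<sigma> i * h)) $ k) (\<sigma> k * (\<chi> i. max (x $ i) (x $ i + \<sigma> i * h)) $ k))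
           (\<chi> k. max (\<sigma> k * (\<chi> i. min (x $ i) (x $ i + \<sigma> i * h)) $ k) (\<sigma> k * (\<chi> i. max (x $ i) (x $ i + \<sigma> i * h)) $ k))
           = cbox (R x) (R x + h *\<^sub>R One)"
          by (intro arg_cong2[where f = cbox]) (simp_all add: vec_eq_iff R_def One_nth del: sum_component)
      qed
      have "((F \<circ> R) has_integral integral (orthant_cube \<sigma> x h) F) (R ` orthant_cube \<sigma> x h)"
        unfolding orthant_cube_def by (intro R_integral integrable_integral F)
      then show ?thesis
        unfolding eq by (rule integral_unique[symmetric])
    qed
    then show ?thesis
      using d by (intro exI[of _ d]) (simp add: R_R divide_inverse mult.commute)
  qed
  ultimately show ?thesis by blast
qed

text \<open>The orthant cubes cover the centred cube. As \<open>F\<close> is nonnegative, their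
  overlaps do not disturb the inequality.\<close>

lemma cube_integral_le_orthants:
  fixes F :: "real ^ 'n \<Rightarrow> real"
  assumes F: "\<And>a b. F integrable_on cbox a b" "\<And>x. 0 \<le> F x" and h: "h \<ge> 0"
  shows "integral (cbox (x - vec h) (x + vec h)) F
    \<le> (\<Sum>\<sigma>\<in>UNIV \<rightarrow>\<^sub>E {1, -1}. integral (orthant_cube \<sigma> x h) F)"
proof -
  define C where "C = cbox (x - vec h) (x + vec h)"
  have fin: "finite ((UNIV :: 'n set) \<rightarrow>\<^sub>E {1, -1 :: real})" by (simp add: finite_PiE)
  have sub: "orthant_cube \<sigma> x h \<subseteq> C" if "\<sigma> \<in> UNIV \<rightarrow>\<^sub>E {1, -1}" for \<sigma> :: "'n \<Rightarrow> real"
  proof -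
    have \<sigma>: "\<sigma> i = 1 \<or> \<sigma> i = -1" for i using PiE_mem[OF that, of i] by auto
    have "x $ i - h \<le> min (x $ i) (x $ i + \<sigma> i * h) \<and> max (x $ i) (x $ i + \<sigma> i * h) \<le> x $ i + h" for i
      using \<sigma>[of i] h by (auto simp: min_def max_def)
    then show ?thesis
      unfolding C_def orthant_cube_def by (intro cbox_subset_cart) simp_all
  qed
  have restrict: "((\<lambda>z. if z \<in> orthant_cube \<sigma> x h then F z else 0) has_integral integral (orthant_cube \<sigma> x h) F) C"
    if "\<sigma> \<in> UNIV \<rightarrow>\<^sub>E {1, -1}" for \<sigma>
    using sub[OF that] unfolding C_def orthant_cube_def
    by (intro has_integral_restrict_closed_subinterval integrable_integral F)
  have "integral C F \<le> integral C (\<lambda>z. \<Sum>\<sigma>\<in>UNIV \<rightarrow>\<^sub>E {1, -1}. if z \<in> orthant_cube \<sigma> x h then F z else 0)"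
  proof (rule integral_le)
    show "F integrable_on C" unfolding C_def by (rule F)
    show "(\<lambda>z. \<Sum>\<sigma>\<in>UNIV \<rightarrow>\<^sub>E {1, -1}. if z \<in> orthant_cube \<sigma> x h then F z else 0) integrable_on C"
      using restrict by (intro integrable_sum fin) (auto simp: integrable_on_def)
    fix z assume z: "z \<in> C"
    define \<tau> where "\<tau> i = (if x $ i \<le> z $ i then 1 else -1 :: real)" for i
    have \<tau>: "\<tau> \<in> UNIV \<rightarrow>\<^sub>E {1, -1}" by (auto simp: \<tau>_def)
    have "x $ i - h \<le> z $ i \<and> z $ i \<le> x $ i + h" for i
      using z by (simp add: C_def mem_box_cart)
    then have "z \<in> orthant_cube \<tau> x h"
      using h by (auto simp: orthant_cube_def mem_box_cart \<tau>_def min_def max_def)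
    then have "F z \<le> (if z \<in> orthant_cube \<tau> x h then F z else 0)" by simp
    also have "\<dots> \<le> (\<Sum>\<sigma>\<in>UNIV \<rightarrow>\<^sub>E {1, -1}. if z \<in> orthant_cube \<sigma> x h then F z else 0)"
      using F(2) by (intro member_le_sum \<tau> fin) auto
    finally show "F z \<le> (\<Sum>\<sigma>\<in>UNIV \<rightarrow>\<^sub>E {1, -1}. if z \<in> orthant_cube \<sigma> x h then F z else 0)" .
  qed
  also have "\<dots> = (\<Sum>\<sigma>\<in>UNIV \<rightarrow>\<^sub>E {1, -1}. integral (orthant_cube \<sigma> x h) F)"
    using has_integral_sum[OF fin restrict] by (intro integral_unique) auto
  finally show ?thesis unfolding C_def .
qed

lemma measure_cube:
  fixes x :: "real ^ 'n"
  assumes "h > 0"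
  shows "measure lborel (cbox (x - vec h) (x + vec h)) = 2 ^ CARD('n) * h ^ CARD('n)"
proof -
  have "measure lborel (cbox (x - vec h) (x + vec h)) = (\<Prod>j\<in>(UNIV::'n set). 2 * h)"
    using assms by (subst measure_box) auto
  then show ?thesis by (simp add: power_mult_distrib)
qed

text \<open>Each of the \<open>2 ^ CARD('n)\<close> orthant cubes obeys the bound, and the centred
  cube has the sum of their volumes. An upper bound is enough for controlling averages of
  \<open>norm (g z - q)\<close>.\<close>

lemma cube_Lebesgue_differentiation:
  fixes F :: "real ^ 'n \<Rightarrow> real"
  assumes F: "\<And>a b. F integrable_on cbox a b" "\<And>x. 0 \<le> F x"
  shows "\<exists>N. negligible N \<and> (\<forall>x e. x \<notin> N \<longrightarrow> e > 0 \<longrightarrow>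
    (\<exists>d>0. \<forall>h. 0 < h \<and> h < d \<longrightarrow> box_avg (x - vec h) (x + vec h) F \<le> F x + e))"
proof -
  define S where "S = (UNIV :: 'n set) \<rightarrow>\<^sub>E {1, -1 :: real}"
  have fin: "finite S" unfolding S_def by (simp add: finite_PiE)
  have card: "card S = 2 ^ CARD('n)"
    unfolding S_def by (simp add: card_PiE numeral_2_eq_2)
  have "\<forall>\<sigma>\<in>S. \<exists>N. negligible N \<and> (\<forall>x e. x \<notin> N \<longrightarrow> e > 0 \<longrightarrow>
    (\<exists>d>0. \<forall>h. 0 < h \<and> h < d \<longrightarrow> \<bar>integral (orthant_cube \<sigma> x h) F / h ^ CARD('n) - F x\<bar> < e))"
  proof
    fix \<sigma> assume "\<sigma> \<in> S"
    then have "\<sigma> i = 1 \<or> \<sigma> i = -1" for i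
      unfolding S_def using PiE_mem[of \<sigma> UNIV "\<lambda>_. {1, -1}" i] by auto
    then show "\<exists>N. negligible N \<and> (\<forall>x e. x \<notin> N \<longrightarrow> e > 0 \<longrightarrow>
      (\<exists>d>0. \<forall>h. 0 < h \<and> h < d \<longrightarrow> \<bar>integral (orthant_cube \<sigma> x h) F / h ^ CARD('n) - F x\<bar> < e))"
      by (rule orthant_Lebesgue_differentiation[OF F(1)])
  qed
  then obtain N where N: "\<forall>\<sigma>\<in>S. negligible (N \<sigma>) \<and> (\<forall>x e. x \<notin> N \<sigma> \<longrightarrow> e > 0 \<longrightarrow>
    (\<exists>d>0. \<forall>h. 0 < h \<and> h < d \<longrightarrow> \<bar>integral (orthant_cube \<sigma> x h) F / h ^ CARD('n) - F x\<bar> < e))"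
    by (rule exE[OF bchoice])
  have "\<exists>d>0. \<forall>h. 0 < h \<and> h < d \<longrightarrow> box_avg (x - vec h) (x + vec h) F \<le> F x + e"
    if x: "x \<notin> (\<Union>\<sigma>\<in>S. N \<sigma>)" and e: "e > 0" for x e
  proof -
    have "\<forall>\<sigma>\<in>S. \<forall>\<^sub>F h in at_right 0. integral (orthant_cube \<sigma> x h) F / h ^ CARD('n) \<le> F x + e"
    proof
      fix \<sigma> assume "\<sigma> \<in> S"
      then obtain d where "d > 0" "\<forall>h. 0 < h \<and> h < d \<longrightarrow> \<bar>integral (orthant_cube \<sigma> x h) F / h ^ CARD('n) - F x\<bar> < e"
        using N[rule_format, of \<sigma>] x e by blast
      then show "\<forall>\<^sub>F h in at_right 0. integral (orthant_cube \<sigma> x h) F / h ^ CARD('n) \<le> F x + e"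
        unfolding eventually_at_right_field by (intro exI[of _ d]) (auto simp: abs_less_iff)
    qed
    then have "\<forall>\<^sub>F h in at_right 0. \<forall>\<sigma>\<in>S. integral (orthant_cube \<sigma> x h) F / h ^ CARD('n) \<le> F x + e"
      by (simp add: eventually_ball_finite_distrib fin)
    then obtain d where d: "d > 0" "\<And>h \<sigma>. 0 < h \<Longrightarrow> h < d \<Longrightarrow> \<sigma> \<in> S \<Longrightarrow>
        integral (orthant_cube \<sigma> x h) F / h ^ CARD('n) \<le> F x + e"
      unfolding eventually_at_right_field by auto
    show ?thesis
    proof (intro exI[of _ d] conjI allI impI d(1))
      fix h assume h: "0 < h \<and> h < d"
      have "integral (cbox (x - vec h) (x + vec h)) F \<le> (\<Sum>\<sigma>\<in>S. integral (orthant_cube \<sigma> x h) F)"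
        unfolding S_def using h by (intro cube_integral_le_orthants F) auto
      also have "\<dots> \<le> (\<Sum>\<sigma>\<in>S. (F x + e) * h ^ CARD('n))"
        using d(2)[of h] h by (intro sum_mono) (simp add: pos_divide_le_eq)
      also have "\<dots> = (F x + e) * (2 ^ CARD('n) * h ^ CARD('n))"
        by (simp add: card)
      finally show "box_avg (x - vec h) (x + vec h) F \<le> F x + e"
        using h unfolding box_avg_def by (subst measure_cube) (auto simp: field_simps)
    qed
  qed
  moreover have "negligible (\<Union>\<sigma>\<in>S. N \<sigma>)"
    using N fin by (intro negligible_Union) auto
  ultimately show ?thesis by blast
qed

definition lebesgue_point :: "(real ^ 'n) set \<Rightarrow> (real ^ 'n \<Rightarrow> 'b::real_normed_vector) \<Rightarrow> real ^ 'n \<Rightarrow> bool" where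
  "lebesgue_point U g x \<longleftrightarrow> (\<forall>e>0. \<exists>d>0. \<forall>h. 0 < h \<and> h < d \<longrightarrow>
    cbox (x - vec h) (x + vec h) \<subseteq> U \<and> box_avg (x - vec h) (x + vec h) (\<lambda>z. norm (g z - g x)) \<le> e)"

lemma small_cube_subset:
  fixes x :: "real ^ 'n"
  assumes "open S" "x \<in> S"
  shows "\<exists>d>0. \<forall>h. 0 < h \<and> h < d \<longrightarrow> cbox (x - vec h) (x + vec h) \<subseteq> S"
proof -
  obtain r where r: "r > 0" "ball x r \<subseteq> S" using assms open_contains_ball by blast
  have "cbox (x - vec h) (x + vec h) \<subseteq> ball x r" if h: "0 < h" "h < r / real CARD('n)" for h
  proof
    fix z assume z: "z \<in> cbox (x - vec h) (x + vec h)"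
    have "norm (z - x) \<le> real CARD('n) * h"
    proof (rule norm_le_card_mult)
      fix j
      have "x $ j - h \<le> z $ j \<and> z $ j \<le> x $ j + h" using z by (simp add: mem_box_cart)
      then show "\<bar>(z - x) $ j\<bar> \<le> h" by (simp add: abs_le_iff)
    qed
    also have "\<dots> < r" using h(2) by (simp add: field_simps)
    finally show "z \<in> ball x r" by (simp add: dist_norm norm_minus_commute)
  qed
  moreover have "r / real CARD('n) > 0" using r(1) by simp
  ultimately show ?thesis using r(2) by (meson subset_trans)
qed

text \<open>Scalar differentiation is applied to \<open>norm (g z - q)\<close> for all
  \<open>q\<close> in a countable dense set, so that the exceptional sets still have a negligible
  union; at a given point \<open>q\<close> is taken close to \<open>g x\<close>. Discarding the
  boundary of the box leaves room for small cubes, on which the extension by zero in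
  \<open>F\<close> is invisible.\<close>

lemma AE_lebesgue_point_box:
  fixes g :: "real ^ 'n \<Rightarrow> 'b::euclidean_space"
  assumes g: "g absolutely_integrable_on cbox a b" and sub: "cbox a b \<subseteq> U"
  shows "\<exists>N. negligible N \<and> (\<forall>x\<in>cbox a b. x \<notin> N \<longrightarrow> lebesgue_point U g x)"
proof -
  obtain Q :: "'b set" where Q: "countable Q" "\<And>X. open X \<Longrightarrow> X \<noteq> {} \<Longrightarrow> \<exists>q\<in>Q. q \<in> X"
    using countable_dense_exists by blast
  define F where "F q z = (if z \<in> cbox a b then norm (g z - q) else 0)" for q z
  have diff: "(\<lambda>z. norm (g z - q)) integrable_on cbox a b" for q
  proof -
    have "(\<lambda>z. g z - q) absolutely_integrable_on cbox a b"
      by (intro set_integral_diff g absolutely_integrable_on_const) auto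
    then show ?thesis by (simp add: absolutely_integrable_on_def)
  qed
  have F_int: "F q integrable_on cbox c d" for q c d
  proof -
    have "F q integrable_on UNIV"
      unfolding F_def[abs_def] using integrable_restrict_UNIV[of "cbox a b" "\<lambda>z. norm (g z - q)"] diff by simp
    then show ?thesis by (rule integrable_on_subcbox) simp
  qed
  have "\<forall>q\<in>Q. \<exists>N. negligible N \<and> (\<forall>x e. x \<notin> N \<longrightarrow> e > 0 \<longrightarrow>
    (\<exists>d>0. \<forall>h. 0 < h \<and> h < d \<longrightarrow> box_avg (x - vec h) (x + vec h) (F q) \<le> F q x + e))"
    using F_int by (intro ballI cube_Lebesgue_differentiation) (auto simp: F_def)
  then obtain N where N: "\<forall>q\<in>Q. negligible (N q) \<and> (\<forall>x e. x \<notin> N q \<longrightarrow> e > 0 \<longrightarrow>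
    (\<exists>d>0. \<forall>h. 0 < h \<and> h < d \<longrightarrow> box_avg (x - vec h) (x + vec h) (F q) \<le> F q x + e))"
    by (rule exE[OF bchoice])
  define N' where "N' = (\<Union>q\<in>Q. N q) \<union> (cbox a b - box a b)"
  have "negligible (\<Union>q\<in>Q. N q)"
    using N Q(1) by (intro negligible_countable_Union) auto
  then have neg: "negligible N'"
    unfolding N'_def by (intro negligible_Un negligible_frontier_interval)
  have "lebesgue_point U g x" if x: "x \<in> cbox a b" "x \<notin> N'" for x
    unfolding lebesgue_point_def
  proof (intro allI impI)
    fix e :: real assume e: "e > 0"
    have xb: "x \<in> box a b" using x by (auto simp: N'_def)
    obtain q where q: "q \<in> Q" "dist (g x) q < e / 3"
      using Q(2)[of "ball (g x) (e / 3)"] e by auto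
    obtain d1 where d1: "d1 > 0" "\<And>h. 0 < h \<Longrightarrow> h < d1 \<Longrightarrow> box_avg (x - vec h) (x + vec h) (F q) \<le> F q x + e / 3"
    proof -
      have "x \<notin> N q" "e / 3 > 0" using x(2) q(1) e by (auto simp: N'_def)
      then show ?thesis using N[rule_format, OF q(1)] that by blast
    qed
    obtain d2 where d2: "d2 > 0" "\<And>h. 0 < h \<Longrightarrow> h < d2 \<Longrightarrow> cbox (x - vec h) (x + vec h) \<subseteq> box a b"
      using small_cube_subset[OF open_box xb] by auto
    show "\<exists>d>0. \<forall>h. 0 < h \<and> h < d \<longrightarrow> cbox (x - vec h) (x + vec h) \<subseteq> U \<and>
      box_avg (x - vec h) (x + vec h) (\<lambda>z. norm (g z - g x)) \<le> e"
    proof (intro exI[of _ "min d1 d2"] conjI allI impI)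
      show "min d1 d2 > 0" using d1 d2 by simp
      fix h assume h: "0 < h \<and> h < min d1 d2"
      define C where "C = cbox (x - vec h) (x + vec h)"
      have C_box: "C \<subseteq> cbox a b"
        unfolding C_def using d2(2)[of h] h box_subset_cbox by (meson min_less_iff_conj subset_trans)
      then show "cbox (x - vec h) (x + vec h) \<subseteq> U" using sub unfolding C_def by blast
      have pos: "measure lborel C > 0" unfolding C_def using h by (intro measure_box_pos) auto
      have "integral C (\<lambda>z. norm (g z - g x)) \<le> integral C (\<lambda>z. F q z + e / 3)"
      proof (rule integral_le)
        show "(\<lambda>z. norm (g z - g x)) integrable_on C"
          using diff C_box unfolding C_def by (rule integrable_on_subcbox)
        show "(\<lambda>z. F q z + e / 3) integrable_on C"
          unfolding C_def by (intro integrable_add F_int integrable_const)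
        fix z assume "z \<in> C"
        then have "F q z = norm (g z - q)" using C_box by (auto simp: F_def)
        moreover have "norm (g z - g x) \<le> norm (g z - q) + norm (q - g x)"
          using norm_triangle_ineq[of "g z - q" "q - g x"] by simp
        ultimately show "norm (g z - g x) \<le> F q z + e / 3"
          using q(2) by (simp add: dist_norm norm_minus_commute)
      qed
      also have "\<dots> = integral C (F q) + measure lborel C * (e / 3)"
        unfolding C_def by (subst integral_add) (auto intro: F_int)
      finally have "integral C (\<lambda>z. norm (g z - g x)) / measure lborel C
          \<le> (integral C (F q) + measure lborel C * (e / 3)) / measure lborel C"
        using pos by (intro divide_right_mono) auto
      also have "\<dots> = box_avg (x - vec h) (x + vec h) (F q) + e / 3"
        using pos unfolding box_avg_real C_def[symmetric] by (simp add: add_divide_distrib)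
      also have "box_avg (x - vec h) (x + vec h) (F q) \<le> F q x + e / 3" using d1(2) h by simp
      also have "F q x \<le> e / 3" using q(2) x(1) by (simp add: F_def dist_norm)
      finally show "box_avg (x - vec h) (x + vec h) (\<lambda>z. norm (g z - g x)) \<le> e"
        unfolding box_avg_real C_def[symmetric] by simp
    qed
  qed
  then show ?thesis using neg by blast
qed

lemma AE_lebesgue_point:
  fixes g :: "real ^ 'n \<Rightarrow> 'b::euclidean_space"
  assumes U: "open U" and g: "g locally_integrable_on U"
  shows "AE x in lebesgue. x \<in> U \<longrightarrow> lebesgue_point U g x"
proof -
  obtain \<D> where \<D>: "countable \<D>" "\<D> \<subseteq> Pow U" "\<And>X. X \<in> \<D> \<Longrightarrow> \<exists>a b. X = cbox a b" "\<Union>\<D> = U"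
    using open_countable_Union_open_cbox[OF U] by metis
  have "\<forall>X\<in>\<D>. \<exists>N. negligible N \<and> (\<forall>x\<in>X. x \<notin> N \<longrightarrow> lebesgue_point U g x)"
  proof
    fix X assume X: "X \<in> \<D>"
    then obtain a b where ab: "X = cbox a b" using \<D>(3) by blast
    have "cbox a b \<subseteq> U" using X \<D>(2) ab by blast
    moreover have "g absolutely_integrable_on cbox a b"
      using g \<open>cbox a b \<subseteq> U\<close> by (auto simp: locally_integrable_on_def)
    ultimately show "\<exists>N. negligible N \<and> (\<forall>x\<in>X. x \<notin> N \<longrightarrow> lebesgue_point U g x)"
      unfolding ab by (intro AE_lebesgue_point_box)
  qed
  then obtain N where N: "\<forall>X\<in>\<D>. negligible (N X) \<and> (\<forall>x\<in>X. x \<notin> N X \<longrightarrow> lebesgue_point U g x)"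
    by (rule exE[OF bchoice])
  have "negligible (\<Union>X\<in>\<D>. N X)"
    using N \<D>(1) by (intro negligible_countable_Union) auto
  then have "(\<Union>X\<in>\<D>. N X) \<in> null_sets lebesgue"
    by (simp add: negligible_iff_null_sets)
  then show ?thesis
    by (rule AE_I') (use N \<D>(4) in blast)
qed

section \<open>Differentiability\<close>

context orlicz_sobolev_map
begin

text \<open>The boxes of the chain are not explicit; therefore \<open>A m\<close> has to bound the
  average for every candidate box of side \<open>L / 2 ^ m\<close> around \<open>y\<close>.\<close>

lemma chain_deviation:
  assumes sub: "cbox a b \<subseteq> U" and sides: "\<And>j. b $ j - a $ j = L" and L: "L > 0" and y: "y \<in> cbox a b"
    and A: "\<And>m a' b'. y \<in> cbox a' b' \<Longrightarrow> cbox a' b' \<subseteq> cbox a b \<Longrightarrow> (\<And>j. b' $ j - a' $ j = L / 2 ^ m) \<Longrightarrow>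
      box_avg a' b' (\<lambda>z. norm (D z - C)) \<le> A m"
  shows "\<exists>a' b'. y \<in> cbox a' b' \<and> cbox a' b' \<subseteq> cbox a b \<and> (\<forall>j. b' $ j - a' $ j = L / 2 ^ M) \<and>
    norm (deviation C a' b' - deviation C a b) \<le> (\<Sum>m<M. K * (L / 2 ^ m) * A m)"
proof -
  have ab: "a $ j < b $ j" for j using sides[of j] L by simp
  have L': "\<forall>j\<in>UNIV. b $ j - a $ j \<le> L" "0 \<le> L" using sides L by auto
  from dyadic_chain[OF sub ab y, of UNIV L C, OF L']
  obtain P Q where PQ: "P 0 = a" "Q 0 = b" and chain: "\<forall>m. y \<in> cbox (P m) (Q m) \<and> cbox (P m) (Q m) \<subseteq> cbox a b \<and>
    (\<forall>j. Q m $ j - P m $ j = (if j \<in> UNIV then (b $ j - a $ j) / 2 ^ m else b $ j - a $ j)) \<and>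
    norm (deviation C (P (Suc m)) (Q (Suc m)) - deviation C (P m) (Q m))
      \<le> chain_const (UNIV :: 'n set) * (L / 2 ^ m) * box_avg (P m) (Q m) (\<lambda>y. norm (D y - C))"
    by (elim exE conjE)
  have mem: "y \<in> cbox (P m) (Q m)" and sub': "cbox (P m) (Q m) \<subseteq> cbox a b"
    and sides': "Q m $ j - P m $ j = L / 2 ^ m"
    and step: "norm (deviation C (P (Suc m)) (Q (Suc m)) - deviation C (P m) (Q m))
      \<le> K * (L / 2 ^ m) * box_avg (P m) (Q m) (\<lambda>y. norm (D y - C))" for m j
    using chain[rule_format, of m] sides by (simp_all add: K_def)
  have "norm (deviation C (P M) (Q M) - deviation C a b)
      = norm (\<Sum>m<M. deviation C (P (Suc m)) (Q (Suc m)) - deviation C (P m) (Q m))"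
    by (subst sum_lessThan_telescope) (simp add: PQ)
  also have "\<dots> \<le> (\<Sum>m<M. K * (L / 2 ^ m) * A m)"
  proof (rule sum_norm_le)
    fix m
    have "K * (L / 2 ^ m) * box_avg (P m) (Q m) (\<lambda>y. norm (D y - C)) \<le> K * (L / 2 ^ m) * A m"
      using A[OF mem sub' sides'] K_nonneg L by (intro mult_left_mono) auto
    then show "norm (deviation C (P (Suc m)) (Q (Suc m)) - deviation C (P m) (Q m)) \<le> K * (L / 2 ^ m) * A m"
      using step[of m] by linarith
  qed
  finally show ?thesis using mem[of M] sub'[of M] sides'[of M] by blast
qed

text \<open>End of a chain: on a small box the average of \<open>f\<close> is close to
  \<open>f y\<close>, and the midpoint, where the linear part is evaluated, is close to
  \<open>y\<close>.\<close>

lemma deviation_close: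
  assumes sub: "cbox a b \<subseteq> U" and sides: "\<And>j. b $ j - a $ j = s" and s: "s > 0" and y: "y \<in> cbox a b"
    and osc: "\<And>z. z \<in> cbox a b \<Longrightarrow> norm (f z - f y) \<le> w" and C: "\<And>v. norm (C *v v) \<le> norm v * B" and B: "B \<ge> 0"
  shows "norm (deviation C a b - (f y - C *v y)) \<le> w + B * (real CARD('n) * s)"
proof -
  have ab: "a $ j < b $ j" for j using sides[of j] s by simp
  have "w \<ge> 0" using osc[OF y] norm_ge_zero by (rule order_trans[rotated])
  then have avg: "norm (box_avg a b f - f y) \<le> w"
    using integrable_map[OF sub] ab osc by (intro box_avg_close) (auto simp: absolutely_integrable_on_def)
  have "(1/2) *\<^sub>R (a + b) \<in> cbox a b"
    using ab by (auto simp: mem_box_cart less_imp_le field_simps)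
  then have "norm ((1/2) *\<^sub>R (a + b) - y) \<le> real CARD('n) * s"
    using norm_diff_in_box[OF y] sides by simp
  then have "norm (C *v ((1/2) *\<^sub>R (a + b) - y)) \<le> B * (real CARD('n) * s)"
    using C[of "(1/2) *\<^sub>R (a + b) - y"] B mult_right_mono[of "norm ((1/2) *\<^sub>R (a + b) - y)" "real CARD('n) * s" B]
    by (simp add: mult.commute)
  moreover have eq: "deviation C a b - (f y - C *v y) = (box_avg a b f - f y) - C *v ((1/2) *\<^sub>R (a + b) - y)"
    by (simp add: deviation_def matrix_vector_mult_diff_distrib)
  ultimately show ?thesis
    unfolding eq using avg norm_triangle_ineq4[of "box_avg a b f - f y" "C *v ((1/2) *\<^sub>R (a + b) - y)"] by linarith
qed

text \<open>A box of side \<open>r\<close> around \<open>x\<close> lies in the cube of side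
  \<open>2 * r\<close> centred at \<open>x\<close>, so its gradient average is at most
  \<open>2 ^ CARD('n) * \<eta>\<close> at every scale. The cost of the chain is then a convergent
  geometric series, and continuity at \<open>x\<close> allows halving down to the value
  \<open>f x\<close>.\<close>

lemma center_deviation:
  assumes \<rho>: "\<rho> > 0" and x: "x \<in> U" and sub: "cbox (x - vec \<rho>) (x + vec \<rho>) \<subseteq> U"
    and \<eta>: "\<And>r. 0 < r \<Longrightarrow> r \<le> 2 * \<rho> \<Longrightarrow> cbox (x - vec r) (x + vec r) \<subseteq> U \<and>
      box_avg (x - vec r) (x + vec r) (\<lambda>z. norm (D z - C)) \<le> \<eta>"
    and C: "\<And>v. norm (C *v v) \<le> norm v * B" and B: "B \<ge> 0"
  shows "norm (f x - C *v x - deviation C (x - vec \<rho>) (x + vec \<rho>)) \<le> 4 * K * 2 ^ CARD('n) * \<eta> * \<rho>"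
proof (rule field_le_epsilon)
  fix e :: real assume e: "e > 0"
  have "isCont f x"
    using continuous_map open_domain x by (simp add: continuous_on_eq_continuous_at)
  then obtain \<delta> where \<delta>: "\<delta> > 0" "\<And>z. norm (z - x) < \<delta> \<Longrightarrow> norm (f z - f x) < e / 2"
    unfolding continuous_at_eps_delta dist_norm using e by (meson half_gt_zero)
  define n where "n = real CARD('n)"
  have n: "n > 0" by (simp add: n_def)
  \<comment> \<open>The two terms of the minimum make the oscillation of \<open>f\<close> and that
    of the linear part on the final box at most \<open>e / 2\<close>; \<open>B + 1\<close> avoids a
    zero denominator.\<close>
  obtain M where M: "(1/2) ^ M < min (\<delta> / (n * (2 * \<rho>))) (e / (2 * (B + 1) * (n * (2 * \<rho>))))"
    using real_arch_pow_inv[of "min (\<delta> / (n * (2 * \<rho>))) (e / (2 * (B + 1) * (n * (2 * \<rho>))))" "1/2"] \<delta>(1) e \<rho> B n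
    by auto
  define s where "s = 2 * \<rho> / 2 ^ M"
  have s: "s > 0" using \<rho> by (simp add: s_def)
  have s1: "n * s < \<delta>"
    using M \<rho> n unfolding s_def by (simp add: field_simps power_one_over)
  have s2: "B * (n * s) \<le> e / 2"
  proof -
    have "(1/2) ^ M * (2 * (B + 1) * (n * (2 * \<rho>))) < e"
      using M \<rho> n B by (subst (asm) min_less_iff_conj) (auto simp: pos_less_divide_eq)
    then have "(B + 1) * (n * s) \<le> e / 2" by (simp add: s_def power_one_over field_simps)
    moreover have "B * (n * s) \<le> (B + 1) * (n * s)" using n s by (intro mult_right_mono) auto
    ultimately show ?thesis by linarith
  qed
  have sides: "(x + vec \<rho>) $ j - (x - vec \<rho>) $ j = 2 * \<rho>" for j by simp
  have xin: "x \<in> cbox (x - vec \<rho>) (x + vec \<rho>)" using \<rho> by (simp add: mem_box_cart)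
  have A: "box_avg a' b' (\<lambda>z. norm (D z - C)) \<le> 2 ^ CARD('n) * \<eta>"
    if x': "x \<in> cbox a' b'" and side': "\<And>j. b' $ j - a' $ j = 2 * \<rho> / 2 ^ m" for m a' b'
  proof -
    define r where "r = 2 * \<rho> / 2 ^ m"
    have "2 * \<rho> / 2 ^ m \<le> 2 * \<rho> / 1" using \<rho> by (intro divide_left_mono) auto
    then have r: "0 < r" "r \<le> 2 * \<rho>" using \<rho> by (simp_all add: r_def)
    have "x $ j - r \<le> a' $ j \<and> b' $ j \<le> x $ j + r" for j
      using x' side'[of j] unfolding mem_box_cart r_def[symmetric] by (smt (verit))
    then have sub': "cbox a' b' \<subseteq> cbox (x - vec r) (x + vec r)"
      by (intro cbox_subset_cart) auto
    have lt: "(x - vec r) $ j < (x + vec r) $ j" for j using r by simp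
    have "measure lborel (cbox a' b') = measure lborel (cbox (x - vec r) (x + vec r)) / 2 ^ (1 * card (UNIV :: 'n set))"
      by (rule measure_box_halved[OF lt]) (simp add: side' r_def)
    then have "box_avg a' b' (\<lambda>z. norm (D z - C)) \<le> 2 ^ CARD('n) * box_avg (x - vec r) (x + vec r) (\<lambda>z. norm (D z - C))"
      using \<eta>[OF r] by (intro box_avg_mono_box integrable_gradient_diff sub' lt) auto
    also have "\<dots> \<le> 2 ^ CARD('n) * \<eta>" using \<eta>[OF r] by simp
    finally show ?thesis .
  qed
  have \<eta>0: "\<eta> \<ge> 0"
    using \<eta>[OF \<rho>] \<rho> box_avg_nonneg[of "\<lambda>z. norm (D z - C)" "x - vec \<rho>" "x + vec \<rho>"] by auto
  have "\<exists>a' b'. x \<in> cbox a' b' \<and> cbox a' b' \<subseteq> cbox (x - vec \<rho>) (x + vec \<rho>) \<and> (\<forall>j. b' $ j - a' $ j = s) \<and>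
    norm (deviation C a' b' - deviation C (x - vec \<rho>) (x + vec \<rho>)) \<le> (\<Sum>m<M. K * (2 * \<rho> / 2 ^ m) * (2 ^ CARD('n) * \<eta>))"
    unfolding s_def by (rule chain_deviation[OF sub sides _ xin]) (use \<rho> A in auto)
  then obtain a' b' where B': "x \<in> cbox a' b'" "cbox a' b' \<subseteq> cbox (x - vec \<rho>) (x + vec \<rho>)" "\<And>j. b' $ j - a' $ j = s"
    "norm (deviation C a' b' - deviation C (x - vec \<rho>) (x + vec \<rho>)) \<le> (\<Sum>m<M. K * (2 * \<rho> / 2 ^ m) * (2 ^ CARD('n) * \<eta>))"
    by blast
  have "(\<Sum>m<M. K * (2 * \<rho> / 2 ^ m) * (2 ^ CARD('n) * \<eta>)) = K * 2 * \<rho> * 2 ^ CARD('n) * \<eta> * (\<Sum>m<M. (1/2) ^ m)"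
    by (simp add: sum_distrib_left power_one_over field_simps)
  also have "\<dots> \<le> K * 2 * \<rho> * 2 ^ CARD('n) * \<eta> * (2 * 1)"
    using K_nonneg \<rho> \<eta>0 by (intro mult_left_mono sum_half_powers_le) (auto simp: power_le_one)
  finally have "norm (deviation C a' b' - deviation C (x - vec \<rho>) (x + vec \<rho>)) \<le> 4 * K * 2 ^ CARD('n) * \<eta> * \<rho>"
    using B'(4) by (simp add: mult_ac)
  moreover have "norm (deviation C a' b' - (f x - C *v x)) \<le> e / 2 + B * (real CARD('n) * s)"
  proof (rule deviation_close[OF _ B'(3) s B'(1) _ C B])
    show "cbox a' b' \<subseteq> U" using B'(2) sub by blast
    fix z assume "z \<in> cbox a' b'"
    then have "norm (z - x) \<le> n * s"
      unfolding n_def using B'(3) by (intro norm_diff_in_box[OF B'(1)]) auto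
    then show "norm (f z - f x) \<le> e / 2" using \<delta>(2)[of z] s1 by simp
  qed
  moreover have "norm (f x - C *v x - deviation C (x - vec \<rho>) (x + vec \<rho>))
      \<le> norm (deviation C a' b' - (f x - C *v x)) + norm (deviation C a' b' - deviation C (x - vec \<rho>) (x + vec \<rho>))"
    using norm_triangle_ineq4[of "deviation C a' b' - deviation C (x - vec \<rho>) (x + vec \<rho>)" "deviation C a' b' - (f x - C *v x)"]
    by (simp add: add.commute)
  ultimately show "norm (f x - C *v x - deviation C (x - vec \<rho>) (x + vec \<rho>)) \<le> 4 * K * 2 ^ CARD('n) * \<eta> * \<rho> + e"
    using s2 unfolding n_def by linarith
qed

definition osc_const :: "real \<Rightarrow> real" where
  "osc_const t = 8 * (1 + 4 * K * (level_total + 8 * (t + 1)))"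

text \<open>Since \<open>2 * s \<le> 4 * \<rho>\<close>, the cube around \<open>y\<close> lies in
  the one of half side \<open>5 * \<rho>\<close> around \<open>x\<close>. The threshold in
  \<open>small\<close> is their volume ratio, so the deviation from \<open>t\<close> averages to at
  most \<open>1\<close> on the smaller cube; this is the \<open>t + 1\<close> of
  \<open>osc_const\<close>.\<close>

lemma face_bound_near:
  assumes \<rho>: "\<rho> > 0" and y: "y \<in> cbox (x - vec \<rho>) (x + vec \<rho>)"
    and sub: "cbox (x - vec (5 * \<rho>)) (x + vec (5 * \<rho>)) \<subseteq> U"
    and small: "box_avg (x - vec (5 * \<rho>)) (x + vec (5 * \<rho>)) (\<lambda>z. norm (\<phi> (norm (D z)) - t)) \<le> (4 / (5 * 2 ^ M)) ^ CARD('n)"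
    and s: "s = 2 * \<rho> / 2 ^ M"
  shows "cbox (y - vec (2 * s)) (y + vec (2 * s)) \<subseteq> U" and "4 * face_bound y s \<le> osc_const t * s"
proof -
  have "2 * \<rho> / 2 ^ M \<le> 2 * \<rho> / 1" using \<rho> by (intro divide_left_mono) auto
  then have s2: "0 < s" "s \<le> 2 * \<rho>" using \<rho> by (simp_all add: s)
  have "x $ j - \<rho> \<le> y $ j \<and> y $ j \<le> x $ j + \<rho>" for j
    using y by (simp add: mem_box_cart)
  then have "x $ j - 5 * \<rho> \<le> y $ j - 2 * s \<and> y $ j + 2 * s \<le> x $ j + 5 * \<rho>" for j
    using s2(2) by (smt (verit))
  then have sub': "cbox (y - vec (2 * s)) (y + vec (2 * s)) \<subseteq> cbox (x - vec (5 * \<rho>)) (x + vec (5 * \<rho>))"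
    by (intro cbox_subset_cart) auto
  then show subU: "cbox (y - vec (2 * s)) (y + vec (2 * s)) \<subseteq> U" using sub by blast
  define g where "g z = norm (\<phi> (norm (D z)) - t)" for z
  define R where "R = (5 * 2 ^ M / 4 :: real) ^ CARD('n)"
  have R: "R > 0" by (simp add: R_def)
  have g_int: "g integrable_on cbox (x - vec (5 * \<rho>)) (x + vec (5 * \<rho>))"
  proof -
    have "(\<lambda>z. \<phi> (norm (D z))) absolutely_integrable_on cbox (x - vec (5 * \<rho>)) (x + vec (5 * \<rho>))"
      using energy_integrable sub by (auto simp: locally_integrable_on_def)
    then have "(\<lambda>z. \<phi> (norm (D z)) - t) absolutely_integrable_on cbox (x - vec (5 * \<rho>)) (x + vec (5 * \<rho>))"
      by (intro set_integral_diff absolutely_integrable_on_const) auto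
    then show ?thesis by (simp add: absolutely_integrable_on_def g_def[abs_def])
  qed
  have "box_avg (y - vec (2 * s)) (y + vec (2 * s)) g \<le> R * box_avg (x - vec (5 * \<rho>)) (x + vec (5 * \<rho>)) g"
  proof (rule box_avg_mono_box[OF g_int _ sub'])
    have "(2 * s) ^ CARD('n) * R = (5 * \<rho>) ^ CARD('n)"
      unfolding R_def power_mult_distrib[symmetric] by (simp add: s)
    then show "measure lborel (cbox (y - vec (2 * s)) (y + vec (2 * s)))
        = measure lborel (cbox (x - vec (5 * \<rho>)) (x + vec (5 * \<rho>))) / R"
      using \<rho> s2(1) R by (subst (1 2) measure_cube) (auto simp: field_simps)
  qed (use \<rho> R in \<open>auto simp: g_def\<close>)
  also have "\<dots> \<le> R * (4 / (5 * 2 ^ M)) ^ CARD('n)"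
    using small R unfolding g_def by (intro mult_left_mono) auto
  also have "\<dots> = 1"
    unfolding R_def power_mult_distrib[symmetric] by simp
  finally have avg: "box_avg (y - vec (2 * s)) (y + vec (2 * s)) g \<le> 1" .
  have lt: "(y - vec (2 * s)) $ j < (y + vec (2 * s)) $ j" for j using s2 by simp
  define P where "P = cbox (y - vec (2 * s)) (y + vec (2 * s))"
  have V: "measure lborel P > 0" unfolding P_def by (rule measure_box_pos[OF lt])
  have "integral P (\<lambda>z. \<phi> (norm (D z))) \<le> integral P (\<lambda>z. t + g z)"
  proof (rule integral_le)
    show "(\<lambda>z. \<phi> (norm (D z))) integrable_on P"
      unfolding P_def by (rule integrable_energy[OF subU])
    show "(\<lambda>z. t + g z) integrable_on P"
      unfolding P_def using g_int sub' by (intro integrable_add integrable_const) (rule integrable_on_subcbox)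
  qed (auto simp: g_def)
  also have "\<dots> = measure lborel P * t + integral P g"
    unfolding P_def using integrable_on_subcbox[OF g_int sub'] by (subst integral_add) (auto intro: integrable_const)
  finally have "integral P (\<lambda>z. \<phi> (norm (D z))) / measure lborel P \<le> (measure lborel P * t + integral P g) / measure lborel P"
    using V by (intro divide_right_mono) auto
  moreover have "(measure lborel P * t + integral P g) / measure lborel P = t + integral P g / measure lborel P"
    using V by (simp add: add_divide_distrib)
  ultimately have "energy (y - vec (2 * s)) (y + vec (2 * s)) \<le> t + 1"
    using avg unfolding energy_def box_avg_real P_def[symmetric] by linarith
  then have "K * (4 * s) * (level_total + 8 * energy (y - vec (2 * s)) (y + vec (2 * s))) \<le> K * (4 * s) * (level_total + 8 * (t + 1))"
    using K_nonneg s2 by (intro mult_left_mono) auto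
  then show "4 * face_bound y s \<le> osc_const t * s"
    unfolding face_bound_def osc_const_def by (simp add: algebra_simps)
qed

lemma has_derivative_at_lebesgue_point:
  assumes om: "open_map (top_of_set U) euclidean f" and x: "x \<in> U"
    and LD: "lebesgue_point U D x" and LE: "lebesgue_point U (\<lambda>z. \<phi> (norm (D z))) x"
  shows "(f has_derivative (\<lambda>v. D x *v v)) (at x)"
proof -
  define C where "C = D x"
  define t where "t = \<phi> (norm (D x))"
  define n where "n = real CARD('n)"
  obtain B where B: "B > 0" "\<And>v. norm (C *v v) \<le> norm v * B"
    using bounded_linear.pos_bounded[OF matrix_vector_mul_bounded_linear[of C]] by blast
  have G: "osc_const t \<ge> 0"
    unfolding osc_const_def t_def using K_nonneg level_total_nonneg by (simp add: nonneg)
  have "\<exists>d>0. \<forall>y. norm (y - x) < d \<longrightarrow> norm (f y - f x - D x *v (y - x)) \<le> e * norm (y - x)" if e: "e > 0" for e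
  proof -
    define H where "H = osc_const t + B * n"
    have H: "H > 0" unfolding H_def n_def using G B(1) by (simp add: add_nonneg_pos)
    \<comment> \<open>\<open>M\<close> depends on \<open>e\<close> alone and makes the final
      oscillation error at most \<open>e / 3 * \<rho>\<close>. The accuracies demanded of the two
      Lebesgue points are chosen after it.\<close>
    obtain M where M: "(1/2) ^ M < e / (6 * H)"
      using real_arch_pow_inv[of "e / (6 * H)" "1/2"] e H by auto
    \<comment> \<open>Boxes shrinking to \<open>y\<close> need not be comparable to cubes centred at
      \<open>x\<close>, so only the volume ratio \<open>2 ^ (m * CARD('n))\<close> bounds their
      gradient averages. With \<open>M\<close> fixed, \<open>T\<close> is a constant, and a small
      \<open>\<eta>\<close> outweighs it.\<close>
    define T where "T = (\<Sum>m<M. K * (2 / 2 ^ m) * (2 ^ (m * CARD('n))))"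
    have T: "T \<ge> 0" unfolding T_def using K_nonneg by (intro sum_nonneg) auto
    define W where "W = T + 4 * K * 2 ^ CARD('n) + 1"
    have W: "W > 0" unfolding W_def using T K_nonneg by (simp add: add_nonneg_pos)
    define \<eta> where "\<eta> = e / (3 * W)"
    have \<eta>: "\<eta> > 0" using e W by (simp add: \<eta>_def)
    obtain d1 where d1: "d1 > 0" "\<And>h. 0 < h \<Longrightarrow> h < d1 \<Longrightarrow>
        cbox (x - vec h) (x + vec h) \<subseteq> U \<and> box_avg (x - vec h) (x + vec h) (\<lambda>z. norm (D z - C)) \<le> \<eta>"
      using LD \<eta> unfolding lebesgue_point_def C_def by meson
    have "(4 / (5 * 2 ^ M) :: real) ^ CARD('n) > 0" by simp
    then obtain d2 where d2: "d2 > 0" "\<And>h. 0 < h \<Longrightarrow> h < d2 \<Longrightarrow> cbox (x - vec h) (x + vec h) \<subseteq> U \<and>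
        box_avg (x - vec h) (x + vec h) (\<lambda>z. norm (\<phi> (norm (D z)) - t)) \<le> (4 / (5 * 2 ^ M)) ^ CARD('n)"
      using LE unfolding lebesgue_point_def t_def by meson
    define d where "d = min d1 d2 / 5"
    show ?thesis
    proof (intro exI[of _ d] conjI allI impI)
      show "d > 0" using d1 d2 by (simp add: d_def)
      fix y assume y: "norm (y - x) < d"
      show "norm (f y - f x - D x *v (y - x)) \<le> e * norm (y - x)"
      proof (cases "y = x")
        case False
        define \<rho> where "\<rho> = norm (y - x)"
        have \<rho>: "\<rho> > 0" "5 * \<rho> < d1" "5 * \<rho> < d2" using False y by (auto simp: \<rho>_def d_def)
        define s where "s = 2 * \<rho> / 2 ^ M"
        have s: "s > 0" using \<rho> by (simp add: s_def)
        have y_in: "y \<in> cbox (x - vec \<rho>) (x + vec \<rho>)"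
        proof -
          have "\<bar>y $ j - x $ j\<bar> \<le> \<rho>" for j
            using component_le_norm_cart[of "y - x" j] by (simp add: \<rho>_def)
          then show ?thesis by (auto simp: mem_box_cart abs_le_iff algebra_simps)
        qed
        have sub: "cbox (x - vec \<rho>) (x + vec \<rho>) \<subseteq> U" using d1(2)[of \<rho>] \<rho> by auto
        have sides: "(x + vec \<rho>) $ j - (x - vec \<rho>) $ j = 2 * \<rho>" for j by simp
        have lt: "(x - vec \<rho>) $ j < (x + vec \<rho>) $ j" for j using \<rho> by simp
        have A: "box_avg a' b' (\<lambda>z. norm (D z - C)) \<le> 2 ^ (m * CARD('n)) * \<eta>"
          if sub': "cbox a' b' \<subseteq> cbox (x - vec \<rho>) (x + vec \<rho>)" and side': "\<And>j. b' $ j - a' $ j = 2 * \<rho> / 2 ^ m" for m a' b'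
        proof -
          have "measure lborel (cbox a' b') = measure lborel (cbox (x - vec \<rho>) (x + vec \<rho>)) / 2 ^ (m * card (UNIV :: 'n set))"
            by (rule measure_box_halved[OF lt]) (simp add: side')
          then have "box_avg a' b' (\<lambda>z. norm (D z - C)) \<le> 2 ^ (m * CARD('n)) * box_avg (x - vec \<rho>) (x + vec \<rho>) (\<lambda>z. norm (D z - C))"
            by (intro box_avg_mono_box integrable_gradient_diff sub sub' lt) auto
          also have "\<dots> \<le> 2 ^ (m * CARD('n)) * \<eta>" using d1(2)[of \<rho>] \<rho> by simp
          finally show ?thesis .
        qed
        have "\<exists>a' b'. y \<in> cbox a' b' \<and> cbox a' b' \<subseteq> cbox (x - vec \<rho>) (x + vec \<rho>) \<and> (\<forall>j. b' $ j - a' $ j = s) \<and>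
          norm (deviation C a' b' - deviation C (x - vec \<rho>) (x + vec \<rho>)) \<le> (\<Sum>m<M. K * (2 * \<rho> / 2 ^ m) * (2 ^ (m * CARD('n)) * \<eta>))"
          unfolding s_def by (rule chain_deviation[OF sub sides _ y_in]) (use \<rho> A in auto)
        then obtain a' b' where B': "y \<in> cbox a' b'" "cbox a' b' \<subseteq> cbox (x - vec \<rho>) (x + vec \<rho>)" "\<And>j. b' $ j - a' $ j = s"
          "norm (deviation C a' b' - deviation C (x - vec \<rho>) (x + vec \<rho>)) \<le> (\<Sum>m<M. K * (2 * \<rho> / 2 ^ m) * (2 ^ (m * CARD('n)) * \<eta>))"
          by blast
        have "(\<Sum>m<M. K * (2 * \<rho> / 2 ^ m) * (2 ^ (m * CARD('n)) * \<eta>)) = T * \<eta> * \<rho>"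
          unfolding T_def sum_distrib_right by (intro sum.cong) auto
        then have 1: "norm (deviation C a' b' - deviation C (x - vec \<rho>) (x + vec \<rho>)) \<le> T * \<eta> * \<rho>"
          using B'(4) by simp
        have 2: "norm (f x - C *v x - deviation C (x - vec \<rho>) (x + vec \<rho>)) \<le> 4 * K * 2 ^ CARD('n) * \<eta> * \<rho>"
          using \<rho> d1(2) B by (intro center_deviation[OF \<rho>(1) x sub]) auto
        have "cbox (x - vec (5 * \<rho>)) (x + vec (5 * \<rho>)) \<subseteq> U"
          "box_avg (x - vec (5 * \<rho>)) (x + vec (5 * \<rho>)) (\<lambda>z. norm (\<phi> (norm (D z)) - t)) \<le> (4 / (5 * 2 ^ M)) ^ CARD('n)"
          using d2(2)[of "5 * \<rho>"] \<rho> by auto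
        note near = face_bound_near[OF \<rho>(1) y_in this s_def]
        have 3: "norm (deviation C a' b' - (f y - C *v y)) \<le> osc_const t * s + B * (real CARD('n) * s)"
        proof (rule deviation_close[OF _ B'(3) s B'(1) _ B(2)])
          show "cbox a' b' \<subseteq> U" using B'(2) sub by blast
          fix z assume z: "z \<in> cbox a' b'"
          have "y $ j - s \<le> a' $ j \<and> b' $ j \<le> y $ j + s" for j
            using B'(1) B'(3)[of j] unfolding mem_box_cart by (smt (verit))
          then have "cbox a' b' \<subseteq> cbox (y - vec s) (y + vec s)"
            by (intro cbox_subset_cart) auto
          then have "norm (f z - f y) \<le> 4 * face_bound y s"
            using z B'(1) by (intro oscillation_bound[OF s near(1) om]) auto
          then show "norm (f z - f y) \<le> osc_const t * s" using near(2) by linarith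
        qed (use B in simp)
        have 4: "osc_const t * s + B * (real CARD('n) * s) \<le> e / 3 * \<rho>"
        proof -
          have "osc_const t * s + B * (real CARD('n) * s) = (1/2) ^ M * (2 * H) * \<rho>"
            by (simp add: H_def n_def s_def power_one_over field_simps)
          also have "\<dots> \<le> e / 3 * \<rho>"
            using M H \<rho> by (intro mult_right_mono) (auto simp: field_simps)
          finally show ?thesis .
        qed
        have 5: "T * \<eta> * \<rho> + 4 * K * 2 ^ CARD('n) * \<eta> * \<rho> \<le> e / 3 * \<rho>"
        proof -
          have "T * \<eta> * \<rho> + 4 * K * 2 ^ CARD('n) * \<eta> * \<rho> = (W - 1) * \<eta> * \<rho>"
            by (simp add: W_def algebra_simps)
          also have "\<dots> \<le> W * \<eta> * \<rho>"
            using \<eta> \<rho> by (intro mult_right_mono) auto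
          also have "W * \<eta> = e / 3" using W by (simp add: \<eta>_def)
          finally show ?thesis .
        qed
        \<comment> \<open>Both \<open>f y\<close> and \<open>f x\<close>, less their linear parts,
          are compared with the deviation over the same cube around \<open>x\<close>.\<close>
        have eq: "f y - f x - D x *v (y - x) = (deviation C a' b' - deviation C (x - vec \<rho>) (x + vec \<rho>))
            - (f x - C *v x - deviation C (x - vec \<rho>) (x + vec \<rho>)) - (deviation C a' b' - (f y - C *v y))"
          by (simp add: C_def matrix_vector_mult_diff_distrib)
        have "norm (f y - f x - D x *v (y - x)) \<le> T * \<eta> * \<rho> + 4 * K * 2 ^ CARD('n) * \<eta> * \<rho> + e / 3 * \<rho>"
          unfolding eq using 1 2 3 4 norm_triangle_ineq4[of "(deviation C a' b' - deviation C (x - vec \<rho>) (x + vec \<rho>))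
            - (f x - C *v x - deviation C (x - vec \<rho>) (x + vec \<rho>))" "deviation C a' b' - (f y - C *v y)"]
            norm_triangle_ineq4[of "deviation C a' b' - deviation C (x - vec \<rho>) (x + vec \<rho>)"
              "f x - C *v x - deviation C (x - vec \<rho>) (x + vec \<rho>)"]
          by linarith
        also have "\<dots> \<le> e * \<rho>"
        proof -
          have "e / 3 * \<rho> + e / 3 * \<rho> \<le> e * \<rho>" using e \<rho> by (simp add: field_simps)
          then show ?thesis using 5 by linarith
        qed
        finally show ?thesis unfolding \<rho>_def .
      qed simp
    qed
  qed
  then show ?thesis
    unfolding has_derivative_at_alt by (simp add: matrix_vector_mul_bounded_linear)
qed

end

theorem theorem3p1:
  fixes \<Omega> :: "(real ^ 'n) set" and \<phi> :: "real \<Rightarrow> real" and f :: "real ^ 'n \<Rightarrow> real ^ 'n"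
  assumes "CARD('n) \<ge> 3"
    and "open \<Omega>"
    and "\<phi> \<in> {0..} \<rightarrow> {0..}"
    and "mono_on {0..} \<phi>"
    and "\<phi> 0 = 0"
    and "calderon_integral \<phi> (1 / (real CARD('n) - 2)) < \<infinity>"
    and "continuous_on \<Omega> f"
    and "open_map (top_of_set \<Omega>) euclidean f"
    and "f \<in> W1_phi_loc \<phi> \<Omega>"
  shows "AE x in lebesgue. x \<in> \<Omega> \<longrightarrow> f differentiable (at x)"
proof -
  obtain D :: "real ^ 'n \<Rightarrow> real ^ 'n ^ 'n" where
    weak: "\<And>i j. weak_partial \<Omega> j (\<lambda>x. f x $ i) (\<lambda>x. D x $ i $ j)" and
    energy: "(\<lambda>x. \<phi> (sqrt (\<Sum>i\<in>UNIV. \<Sum>j\<in>UNIV. (D x $ i $ j)\<^sup>2))) locally_integrable_on \<Omega>"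
    using assms(9) unfolding W1_phi_loc_def by blast
  \<comment> \<open>The nested Euclidean norm on matrices is the Frobenius norm.\<close>
  have norm_D: "sqrt (\<Sum>i\<in>UNIV. \<Sum>j\<in>UNIV. (D x $ i $ j)\<^sup>2) = norm (D x)" for x
    by (simp add: norm_vec_def L2_set_def sum_nonneg)
  have exponent: "1 / real (CARD('n) - 2) = 1 / (real CARD('n) - 2)"
    using assms(1) by (simp add: of_nat_diff)
  interpret orlicz_sobolev_map \<Omega> f D \<phi>
  proof
    show "1 \<le> CARD('n) - 2" using assms(1) by simp
    show "0 \<le> \<phi> t" if "0 \<le> t" for t using assms(3) that by auto
    show "\<phi> s \<le> \<phi> t" if "0 \<le> s" "s \<le> t" for s t
      using assms(4) that by (auto simp: mono_on_def)
    show "calderon_integral \<phi> (1 / real (CARD('n) - 2)) < \<infinity>"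
      unfolding exponent by (rule assms(6))
    show "(\<lambda>x. \<phi> (norm (D x))) locally_integrable_on \<Omega>"
      using energy unfolding norm_D .
  qed (use weak assms in auto)
  have "D locally_integrable_on \<Omega>"
    unfolding locally_integrable_on_def
  proof (intro allI impI, rule absolutely_integrable_componentwise)
    fix S v assume S: "compact S \<and> S \<subseteq> \<Omega>" and "v \<in> (Basis :: (real ^ 'n ^ 'n) set)"
    then obtain k j where "v = axis k (axis j 1)" by (auto simp: Basis_vec_def)
    then show "(\<lambda>x. D x \<bullet> v) absolutely_integrable_on S"
      using weak[of j k] S by (simp add: weak_partial_def locally_integrable_on_def inner_axis)
  qed
  then have "AE x in lebesgue. x \<in> \<Omega> \<longrightarrow> lebesgue_point \<Omega> D x"
    by (rule AE_lebesgue_point[OF assms(2)])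
  moreover have "AE x in lebesgue. x \<in> \<Omega> \<longrightarrow> lebesgue_point \<Omega> (\<lambda>z. \<phi> (norm (D z))) x"
    by (rule AE_lebesgue_point[OF assms(2) energy_integrable])
  ultimately show ?thesis
  proof eventually_elim
    case (elim x)
    then show ?case
      using has_derivative_at_lebesgue_point[OF assms(8)] by (auto simp: differentiable_def)
  qed
qed

end
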